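(* Let $\mathbf{H}=A\circ\mathbf{X}$ be a semicircular mixture. Then $$\mathcal{G}_{\mathbf{H}}(z\mathrm{I})=\lim_{n\to\infty}\mathbb{E}\big(T_{z\mathrm{I}}^{\circ n}(W)\big)$$ for all $z\in\mathbb{C}^+$ and all $W\in\mathrm{M}_d(\mathbb{C})^-$, where $T_{z\mathrm{I}}(D)=(z\mathrm{I}-\eta(D))^{-1}$, $T_{z\mathrm{I}}^{\circ n}$ is its $n$-fold composition, and $\eta$ is the random map with values in diagonal matrices given by $\eta(D)_{i,i}=\sum_{j=1}^d A_{i,j}^2D_{j,j}$ for $1\le i\le d$.
   Context: $d$ is a fixed positive integer; $(\Omega,\mathcal{F},\mathbb{P})$ is a probability space with expectation $\mathbb{E}$; $L^{\infty-}(\Omega,\mathcal{F},\mathbb{P})=\bigcap_{1\le p<\infty}L^p(\Omega,\mathcal{F},\mathbb{P})$; $(\mathcal{A},\varphi)$ is a non-commutative ($C^*$-)probability space; $E=\mathrm{I}\otimes\varphi:\mathrm{M}_d(\mathcal{A})\to\mathrm{M}_d(\mathbb{C})$ applies $\varphi$ entrywise. A random operator-valued matrix is an element of $L^{\infty-}(\Omega,\mathcal{F},\mathbb{P})\otimes\mathrm{M}_d(\mathcal{A})$, viewed also as a random element $\omega\mapsto\mathbf{H}(\omega)\in\mathrm{M}_d(\mathcal{A})$. $\circ$ between matrices is the Hadamard (entrywise) product. Semicircular mixture: $\mathbf{H}=A\circ\mathbf{X}$, i.e. $\mathbf{H}_{i,j}=A_{i,j}\otimes\mathbf{X}_{i,j}$,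 where $A$ is a $d\times d$ selfadjoint random matrix with non-negative entries in $L^{\infty-}(\Omega,\mathcal{F},\mathbb{P})$ and $\mathbf{X}\in\mathrm{M}_d(\mathcal{A})$ is selfadjoint with $\{\mathbf{X}_{i,j}\mid 1\le i,j\le d\}$ a free circular family up to symmetry: $\mathbf{X}_{j,i}=\mathbf{X}_{i,j}^*$, the $\mathbf{X}_{i,i}$ are semicircular, the $\mathbf{X}_{i,j}$ ($i<j$) are circular, and the families $\{\mathbf{X}_{i,j},\mathbf{X}_{i,j}^*\}$, $i\le j$, are free with respect to $\varphi$; all are centered and normalized by $\varphi(\mathbf{X}_{i,j}\mathbf{X}_{k,l})=\delta_{i,l}\delta_{j,k}$. $\Im(B)=(B-B^* )/(2\mathrm{i})$; $\mathrm{M}_d(\mathbb{C})^{\pm}=\{B\in\mathrm{M}_d(\mathbb{C})\mid \pm\Im(B)>0\}$ and $\mathbb{C}^\pm=\mathrm{M}_1(\mathbb{C})^\pm$. For fixed $\omega$, $G_{\mathbf{H}(\omega)}(B)=E\big((B-\mathbf{H}(\omega))^{-1}\big)$ for $B$ with $B-\mathbf{H}(\omega)$ invertible. The mean $\mathrm{M}_d(\mathbb{C})$-valued Cauchy transform is $\mathcal{G}_{\mathbf{H}}(B)=\mathbb{E}(G_{\mathbf{H}}(B))$ for $B\in\mathrm{M}_d(\mathbb{C})$ with $B-\mathbf{H}$ invertible almost surely. *)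

theory Defs
  imports "HOL-Probability.Probability"
begin

class cstar_algebra = real_normed_algebra_1 + banach +
  fixes scaleC :: "complex \<Rightarrow> 'a \<Rightarrow> 'a" (infixr "*\<^sub>C" 75)
    and star :: "'a \<Rightarrow> 'a"
  assumes scaleC_add_right: "c *\<^sub>C (x + y) = c *\<^sub>C x + c *\<^sub>C y"
    and scaleC_add_left: "(c + e) *\<^sub>C x = c *\<^sub>C x + e *\<^sub>C x"
    and scaleC_scaleC: "c *\<^sub>C e *\<^sub>C x = (c * e) *\<^sub>C x"
    and scaleC_of_real: "complex_of_real r *\<^sub>C x = r *\<^sub>R x"
    and mult_scaleC_left: "(c *\<^sub>C x) * y = c *\<^sub>C (x * y)"
    and mult_scaleC_right: "x * (c *\<^sub>C y) = c *\<^sub>C (x * y)"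
    and norm_scaleC: "norm (c *\<^sub>C x) = cmod c * norm x"
    and star_star: "star (star x) = x"
    and star_add: "star (x + y) = star x + star y"
    and star_mult: "star (x * y) = star y * star x"
    and star_scaleC: "star (c *\<^sub>C x) = cnj c *\<^sub>C star x"
    and cstar_identity: "norm (star x * x) = (norm x)\<^sup>2"

instantiation complex :: cstar_algebra
begin

definition scaleC_complex :: "complex \<Rightarrow> complex \<Rightarrow> complex"
  where "scaleC_complex c x = c * x"

definition star_complex :: "complex \<Rightarrow> complex"
  where "star_complex x = cnj x"

instance
  by standard
    (simp_all add: scaleC_complex_def star_complex_def algebra_simps norm_mult
      scaleR_conv_of_real power2_eq_square)

end

definition cstar_prob_space :: "('a::cstar_algebra \<Rightarrow> complex) \<Rightarrow> bool" where
  "cstar_prob_space \<phi> \<longleftrightarrow>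
     (\<forall>x y. \<phi> (x + y) = \<phi> x + \<phi> y) \<and>
     (\<forall>c x. \<phi> (c *\<^sub>C x) = c * \<phi> x) \<and>
     (\<forall>x. \<phi> (star x * x) \<in> \<real>\<^sub>\<ge>\<^sub>0) \<and>
     \<phi> 1 = 1"

inductive_set unital_subalgebra :: "'a::cstar_algebra set \<Rightarrow> 'a set" for S where
  one: "1 \<in> unital_subalgebra S"
| gen: "x \<in> S \<Longrightarrow> x \<in> unital_subalgebra S"
| add: "x \<in> unital_subalgebra S \<Longrightarrow> y \<in> unital_subalgebra S \<Longrightarrow> x + y \<in> unital_subalgebra S"
| mult: "x \<in> unital_subalgebra S \<Longrightarrow> y \<in> unital_subalgebra S \<Longrightarrow> x * y \<in> unital_subalgebra S"
| scale: "x \<in> unital_subalgebra S \<Longrightarrow> c *\<^sub>C x \<in> unital_subalgebra S"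

definition free_sets :: "('a::cstar_algebra \<Rightarrow> complex) \<Rightarrow> 'i set \<Rightarrow> ('i \<Rightarrow> 'a set) \<Rightarrow> bool" where
  "free_sets \<phi> I S \<longleftrightarrow>
     (\<forall>n (k :: nat \<Rightarrow> 'i) (a :: nat \<Rightarrow> 'a).
        n \<ge> 1 \<longrightarrow>
        (\<forall>m<n. k m \<in> I \<and> a m \<in> unital_subalgebra (S (k m)) \<and> \<phi> (a m) = 0) \<longrightarrow>
        (\<forall>m. Suc m < n \<longrightarrow> k m \<noteq> k (Suc m)) \<longrightarrow>
        \<phi> (prod_list (map a [0..<n])) = 0)"

text \<open>A (centred) semicircular element is a selfadjoint element whose moments are those of the
  semicircle distribution with density
  \<open>sqrt (4 * \<sigma>\<^sup>2 - t\<^sup>2) / (2 * pi * \<sigma>\<^sup>2)\<close> on \<open>{- 2 * \<sigma>..2 * \<sigma>}\<close>,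
  for some standard deviation \<open>\<sigma> > 0\<close>.\<close>

definition semicircular :: "('a::cstar_algebra \<Rightarrow> complex) \<Rightarrow> 'a \<Rightarrow> bool" where
  "semicircular \<phi> s \<longleftrightarrow>
     star s = s \<and>
     (\<exists>\<sigma>::real. \<sigma> > 0 \<and>
        (\<forall>n. \<phi> (s ^ n) = complex_of_real
           (integral {- 2 * \<sigma>..2 * \<sigma>}
              (\<lambda>t. t ^ n * (sqrt (4 * \<sigma>\<^sup>2 - t\<^sup>2) / (2 * pi * \<sigma>\<^sup>2))))))"

definition circular :: "('a::cstar_algebra \<Rightarrow> complex) \<Rightarrow> 'a \<Rightarrow> bool" where
  "circular \<phi> c \<longleftrightarrow>
     (\<exists>s t. semicircular \<phi> s \<and> semicircular \<phi> t \<and> \<phi> (s * s) = \<phi> (t * t) \<and>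
        free_sets \<phi> (UNIV :: bool set) (\<lambda>b. if b then {s} else {t}) \<and>
        c = complex_of_real (1 / sqrt 2) *\<^sub>C (s + \<i> *\<^sub>C t))"

definition adjoint_matrix :: "'a::cstar_algebra ^ 'n ^ 'm \<Rightarrow> 'a ^ 'm ^ 'n" where
  "adjoint_matrix B = (\<chi> i j. star (B $ j $ i))"

definition Im_matrix :: "complex ^ 'n ^ 'n \<Rightarrow> complex ^ 'n ^ 'n" where
  "Im_matrix B = (\<chi> i j. (B - adjoint_matrix B) $ i $ j / (2 * \<i>))"

definition positive_definite :: "complex ^ 'n ^ 'n \<Rightarrow> bool" where
  "positive_definite B \<longleftrightarrow>
     adjoint_matrix B = B \<and>
     (\<forall>v. v \<noteq> 0 \<longrightarrow> 0 < Re (\<Sum>i\<in>UNIV. \<Sum>j\<in>UNIV. cnj (v $ i) * B $ i $ j * v $ j))"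

definition lower_half_plane :: "(complex ^ 'n ^ 'n) set" where
  "lower_half_plane = {B. positive_definite (- Im_matrix B)}"

definition embed_matrix :: "complex ^ 'n ^ 'n \<Rightarrow> 'a::cstar_algebra ^ 'n ^ 'n" where
  "embed_matrix B = (\<chi> i j. B $ i $ j *\<^sub>C 1)"

definition hadamard :: "complex ^ 'n ^ 'n \<Rightarrow> 'a::cstar_algebra ^ 'n ^ 'n \<Rightarrow> 'a ^ 'n ^ 'n" where
  "hadamard A X = (\<chi> i j. A $ i $ j *\<^sub>C X $ i $ j)"

definition entrywise :: "('a \<Rightarrow> complex) \<Rightarrow> 'a ^ 'n ^ 'n \<Rightarrow> complex ^ 'n ^ 'n" where
  "entrywise \<phi> X = (\<chi> i j. \<phi> (X $ i $ j))"

definition L_infty_minus :: "'w measure \<Rightarrow> ('w \<Rightarrow> complex) set" where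
  "L_infty_minus M =
     {f \<in> borel_measurable M. \<forall>p::real. p \<ge> 1 \<longrightarrow> integrable M (\<lambda>\<omega>. cmod (f \<omega>) powr p)}"

definition free_circular_family ::
  "('a::cstar_algebra \<Rightarrow> complex) \<Rightarrow> 'a ^ 'n::{finite,linorder} ^ 'n::{finite,linorder} \<Rightarrow> bool" where
  "free_circular_family \<phi> X \<longleftrightarrow>
     adjoint_matrix X = X \<and>
     (\<forall>i. semicircular \<phi> (X $ i $ i)) \<and>
     (\<forall>i j. i < j \<longrightarrow> circular \<phi> (X $ i $ j)) \<and>
     free_sets \<phi> {(i, j). i \<le> j} (\<lambda>(i, j). {X $ i $ j, star (X $ i $ j)}) \<and>
     (\<forall>i j. \<phi> (X $ i $ j) = 0) \<and>
     (\<forall>i j k l. \<phi> (X $ i $ j * X $ k $ l) = (if i = l \<and> j = k then 1 else 0))"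

text \<open>Elements of \<open>L_infty_minus\<close> are random variables up to almost sure equality, so that
  properties of the random matrix \<open>A\<close> are required almost surely only.\<close>

definition semicircular_mixture ::
  "'w measure \<Rightarrow> ('a::cstar_algebra \<Rightarrow> complex) \<Rightarrow>
     ('w \<Rightarrow> complex ^ 'n::{finite,linorder} ^ 'n::{finite,linorder}) \<Rightarrow>
     'a ^ 'n::{finite,linorder} ^ 'n::{finite,linorder} \<Rightarrow>
     ('w \<Rightarrow> 'a ^ 'n::{finite,linorder} ^ 'n::{finite,linorder}) \<Rightarrow> bool" where
  "semicircular_mixture M \<phi> A X H \<longleftrightarrow>
     (\<forall>i j. (\<lambda>\<omega>. A \<omega> $ i $ j) \<in> L_infty_minus M) \<and>
     (AE \<omega> in M. adjoint_matrix (A \<omega>) = A \<omega> \<and> (\<forall>i j. A \<omega> $ i $ j \<in> \<real>\<^sub>\<ge>\<^sub>0)) \<and>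
     free_circular_family \<phi> X \<and>
     H = (\<lambda>\<omega>. hadamard (A \<omega>) X)"

definition cauchy_transform ::
  "('a::cstar_algebra \<Rightarrow> complex) \<Rightarrow> 'a ^ 'n ^ 'n \<Rightarrow> complex ^ 'n ^ 'n \<Rightarrow> complex ^ 'n ^ 'n" where
  "cauchy_transform \<phi> X B = entrywise \<phi> (matrix_inv (embed_matrix B - X))"

definition mean_cauchy_transform ::
  "'w measure \<Rightarrow> ('a::cstar_algebra \<Rightarrow> complex) \<Rightarrow> ('w \<Rightarrow> 'a ^ 'n ^ 'n) \<Rightarrow>
     complex ^ 'n ^ 'n \<Rightarrow> complex ^ 'n ^ 'n" where
  "mean_cauchy_transform M \<phi> H B = (\<integral>\<omega>. cauchy_transform \<phi> (H \<omega>) B \<partial>M)"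

definition eta :: "complex ^ 'n ^ 'n \<Rightarrow> complex ^ 'n ^ 'n \<Rightarrow> complex ^ 'n ^ 'n" where
  "eta A D = (\<chi> i j. if i = j then \<Sum>k\<in>UNIV. (A $ i $ k)\<^sup>2 * D $ k $ k else 0)"

definition T_map ::
  "complex ^ 'n ^ 'n \<Rightarrow> complex ^ 'n ^ 'n \<Rightarrow> complex ^ 'n ^ 'n \<Rightarrow> complex ^ 'n ^ 'n" where
  "T_map A B D = matrix_inv (B - eta A D)"

end

theory Submission
  imports Defs "HOL-Complex_Analysis.Conformal_Mappings"
begin

text \<open>For a fixed outcome, the diagonal of the operator-valued Cauchy transform
  \<open>G(z)\<close> of \<open>H = A \<circ> X\<close> is the fixed point of \<open>T\<close> in the lower half plane. The fixed point equation
  \<open>z G = 1 + \<eta>(G) G\<close> holds for large \<open>\<bar>z\<bar>\<close> by the free Wick recursion for the moments of \<open>H\<close> and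
  extends to the upper half plane by the identity theorem; here \<open>z - H\<close> is invertible because
  \<open>x\<^sup>* x \<ge> 0\<close> in a C*-algebra yields an a priori bound \<open>1 / Im z\<close> for the entries of the resolvent.
  On diagonal matrices with entries in the lower half plane, \<open>T\<close> contracts the hyperbolic distance to
  the fixed point by a fixed factor, so the iterates converge. They are bounded by a multiple of
  \<open>1 / Im z\<close> from the first step on, and dominated convergence gives the limit of the means.\<close>

section \<open>Positive elements of a C*-algebra\<close>

text \<open>Positivity is expressed through norms alone and rests on square roots of
  \<open>1 - k\<close>, built as fixed points. What it must deliver is that each entry of a column
  \<open>v\<close> is bounded by the norm of the sum of the products \<open>star v * v\<close>: the
  imaginary part of the resolvent identity controls only that sum. Freeness speaks of alternating
  centered products, not of words in the entries of \<open>H\<close>. The Schwinger-Dyson equation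
  bridges this gap: it survives linear combinations, products and the union of free families, and so
  passes from semicircular elements to circular ones and on to all entries of \<open>X\<close>. The
  contraction is strict because every denominator gains \<open>Im z\<close> in its imaginary part.
  The resulting factor is computed at the fixed point, which does not move, and is therefore the
  same in every step. Symmetry and sign of \<open>A\<close> hold almost surely only. Measurability
  is thus established for all outcomes, including those where \<open>matrix_inv\<close> returns its
  default value.\<close>

lemma star_zero [simp]: "star (0::'a::cstar_algebra) = 0"
  using star_add[of "0::'a" 0] by simp

lemma star_one [simp]: "star (1::'a::cstar_algebra) = 1"
  using star_mult[of "star (1::'a)" 1] by (simp add: star_star)

lemma scaleC_one [simp]: "1 *\<^sub>C x = (x::'a::cstar_algebra)"
  using scaleC_of_real[of 1 x] by simp

lemma scaleC_zero_right [simp]: "c *\<^sub>C 0 = (0::'a::cstar_algebra)"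
  using scaleC_add_right[of c "0::'a" 0] by simp

lemma scaleC_zero_left [simp]: "0 *\<^sub>C x = (0::'a::cstar_algebra)"
  using scaleC_of_real[of 0 x] by simp

lemma scaleC_minus_left [simp]: "(- c) *\<^sub>C x = - (c *\<^sub>C (x::'a::cstar_algebra))"
  using scaleC_add_left[of "-c" c x] by (simp add: eq_neg_iff_add_eq_0)

lemma scaleC_minus_right [simp]: "c *\<^sub>C (- x) = - (c *\<^sub>C (x::'a::cstar_algebra))"
  using scaleC_add_right[of c "-x" x] by (simp add: eq_neg_iff_add_eq_0)

lemma scaleC_diff_right: "c *\<^sub>C (x - y) = c *\<^sub>C x - c *\<^sub>C (y::'a::cstar_algebra)"
  using scaleC_add_right[of c x "-y"] by simp

lemma scaleC_diff_left: "(c - e) *\<^sub>C x = c *\<^sub>C x - e *\<^sub>C (x::'a::cstar_algebra)"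
  using scaleC_add_left[of c "-e" x] by simp

lemma scaleC_sum_right: "c *\<^sub>C (\<Sum>i\<in>I. f i) = (\<Sum>i\<in>I. c *\<^sub>C (f i :: 'a::cstar_algebra))"
  by (induction I rule: infinite_finite_induct) (auto simp: scaleC_add_right)

lemma star_scaleR [simp]: "star (r *\<^sub>R x) = r *\<^sub>R star (x::'a::cstar_algebra)"
  by (metis complex_cnj_complex_of_real scaleC_of_real star_scaleC)

lemma star_of_real [simp]: "star (of_real r :: 'a::cstar_algebra) = of_real r"
  by (simp add: of_real_def)

lemma star_minus [simp]: "star (- x) = - star (x::'a::cstar_algebra)"
  using star_add[of "-x" x] by (simp add: eq_neg_iff_add_eq_0)

lemma star_diff: "star (x - y) = star x - star (y::'a::cstar_algebra)"
  using star_add[of x "-y"] by simp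

lemma star_sum: "star (\<Sum>i\<in>I. f i) = (\<Sum>i\<in>I. star (f i :: 'a::cstar_algebra))"
  by (induction I rule: infinite_finite_induct) (auto simp: star_add)

lemma star_power: "star (x ^ n) = star (x::'a::cstar_algebra) ^ n"
  by (induction n) (auto simp: star_mult power_commutes)

lemma norm_star [simp]: "norm (star x) = norm (x::'a::cstar_algebra)"
proof -
  have le: "norm y \<le> norm (star y)" for y :: 'a
  proof (cases "y = 0")
    case False
    have "norm y * norm y \<le> norm (star y) * norm y"
      using norm_mult_ineq[of "star y" y] by (simp add: cstar_identity power2_eq_square)
    then show ?thesis using False by simp
  qed simp
  from le[of x] le[of "star x"] show ?thesis by (simp add: star_star)
qed

lemma bounded_linear_star: "bounded_linear (star :: 'a::cstar_algebra \<Rightarrow> 'a)"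
  by (rule bounded_linear_intro[where K = 1]) (auto simp: star_add)

lemmas continuous_on_star [continuous_intros] = bounded_linear.continuous_on[OF bounded_linear_star]

text \<open>If \<open>u = (k + u * u) / 2\<close>, then \<open>(1 - u) * (1 - u) = 1 - k\<close>.
  The map is a contraction with constant \<open>norm k\<close> on the ball of that radius; the
  closed conditions it preserves, selfadjointness and commutation with whatever commutes with
  \<open>k\<close>, pass to the fixed point.\<close>

lemma sqrt_one_minus:
  fixes k :: "'a::cstar_algebra"
  assumes "star k = k" "norm k < 1"
  obtains y where "star y = y" "y * y = 1 - k" "\<And>c. c * k = k * c \<Longrightarrow> c * y = y * c"
proof -
  define S where "S = {u. norm u \<le> norm k} \<inter> {u. star u = u} \<inter>
    (\<Inter>c\<in>{c. c * k = k * c}. {u. c * u = u * c})"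
  define f where "f u = (1/2::real) *\<^sub>R (k + u * u)" for u
  have "closed S"
    unfolding S_def
    by (intro closed_Int closed_INT ballI closed_Collect_le closed_Collect_eq continuous_intros)
  note complete = this[folded complete_eq_closed]
  have ne: "S \<noteq> {}" using assms by (auto simp: S_def)
  have img: "f ` S \<subseteq> S"
  proof
    fix v assume "v \<in> f ` S"
    then obtain u where u: "u \<in> S" and v: "v = f u" by auto
    have "norm u \<le> norm k" and su: "star u = u" using u by (auto simp: S_def)
    have "norm (k + u * u) \<le> norm k + norm u * norm u"
      by (meson add_left_mono norm_mult_ineq norm_triangle_le)
    also have "norm u * norm u \<le> norm k * 1"
      using \<open>norm u \<le> norm k\<close> assms by (intro mult_mono) auto
    finally have "norm v \<le> norm k" by (simp add: v f_def)
    moreover have "star v = v" using assms su by (simp add: v f_def star_add star_mult)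
    moreover have "c * v = v * c" if "c * k = k * c" for c
    proof -
      have "c * u = u * c" using u that by (auto simp: S_def)
      then have "c * (u * u) = (u * u) * c" by (metis mult.assoc)
      with that show ?thesis by (simp add: v f_def algebra_simps)
    qed
    ultimately show "v \<in> S" by (auto simp: S_def)
  qed
  have lip: "dist (f u) (f v) \<le> norm k * dist u v" if "u \<in> S \<and> v \<in> S" for u v
  proof -
    have n: "norm u \<le> norm k" "norm v \<le> norm k" using that by (auto simp: S_def)
    have "f u - f v = (1/2) *\<^sub>R (u * (u - v) + (u - v) * v)"
      by (simp add: f_def algebra_simps)
    then have "dist (f u) (f v) \<le> (1/2) * (norm u * norm (u - v) + norm (u - v) * norm v)"
      by (simp add: dist_norm) (intro norm_triangle_mono norm_mult_ineq)
    also have "\<dots> \<le> (1/2) * (norm k * norm (u - v) + norm (u - v) * norm k)"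
      using n by (intro mult_left_mono add_mono mult_mono) auto
    finally show ?thesis by (simp add: dist_norm)
  qed
  obtain u where u: "u \<in> S" "f u = u"
    using Banach_fix[OF complete ne norm_ge_zero[of k] assms(2) img] lip by auto
  have "2 *\<^sub>R u = k + u * u" using u(2) by (metis f_def scaleR_half_double scaleR_2 scaleR_add_right)
  then have "(1 - u) * (1 - u) = 1 - k" by (simp add: algebra_simps scaleR_2)
  moreover have "star (1 - u) = 1 - u" using u(1) by (simp add: S_def star_diff)
  moreover have "c * (1 - u) = (1 - u) * c" if "c * k = k * c" for c
    using u(1) that by (simp add: S_def algebra_simps)
  ultimately show thesis using that by blast
qed

text \<open>As \<open>y\<close> and \<open>w\<close> commute, \<open>u = y + \<i> w\<close>
  satisfies \<open>star u * u = y * y + w * w\<close>, so the C*-identity computes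
  \<open>norm u\<close>; and \<open>y\<close> is the real part of \<open>u\<close>.\<close>

lemma norm_square_le_if_sum_of_squares:
  fixes y w :: "'a::cstar_algebra"
  assumes "star y = y" "star w = w" "y * w = w * y" "y * y + w * w = of_real t"
  shows "norm (y * y) \<le> \<bar>t\<bar>"
proof -
  define u where "u = y + \<i> *\<^sub>C w"
  have su: "star u = y - \<i> *\<^sub>C w" using assms by (simp add: u_def star_add star_scaleC)
  have "star u * u = y * y + w * w"
    unfolding su unfolding u_def using assms(3)
    by (simp add: algebra_simps mult_scaleC_left mult_scaleC_right scaleC_scaleC scaleC_diff_right)
  then have nu: "(norm u)\<^sup>2 = \<bar>t\<bar>" using assms(4) by (metis cstar_identity norm_of_real)
  have "y = (1/2) *\<^sub>R (u + star u)" by (simp add: su) (simp add: u_def flip: scaleR_2)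
  then have "norm y \<le> (1/2) * (norm u + norm (star u))"
    by (metis abs_of_pos half_gt_zero_iff norm_scaleR norm_triangle_ineq zero_less_one mult_le_cancel_left_pos)
  then have "norm y \<le> norm u" by simp
  then have "norm y * norm y \<le> norm u * norm u" by (intro mult_mono) auto
  with nu show ?thesis
    using norm_mult_ineq[of y y] by (simp add: power2_eq_square)
qed

text \<open>For selfadjoint \<open>h\<close> the inequality says that the spectrum lies between 0
  and \<open>2 * t\<close>. In this form the cone properties follow from the triangle
  inequality.\<close>

definition cpositive :: "'a::cstar_algebra \<Rightarrow> bool" where
  "cpositive h \<longleftrightarrow> star h = h \<and> (\<exists>t\<ge>0. norm (of_real t - h) \<le> t)"

lemma cpositive_star: "cpositive h \<Longrightarrow> star h = h"
  by (simp add: cpositive_def)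

lemma cpositive_add: "cpositive a \<Longrightarrow> cpositive b \<Longrightarrow> cpositive (a + b)"
proof -
  assume "cpositive a" "cpositive b"
  then obtain s t where "s \<ge> 0" "t \<ge> 0" "norm (of_real s - a) \<le> s" "norm (of_real t - b) \<le> t"
    and st: "star a = a" "star b = b"
    by (auto simp: cpositive_def)
  then have "norm ((of_real s - a) + (of_real t - b)) \<le> s + t"
    by (intro norm_triangle_le) auto
  then have "norm (of_real (s + t) - (a + b)) \<le> s + t" by (simp add: algebra_simps)
  with st \<open>s \<ge> 0\<close> \<open>t \<ge> 0\<close> show ?thesis
    by (auto simp: cpositive_def star_add intro!: exI[of _ "s + t"])
qed

lemma cpositive_scaleR: "cpositive a \<Longrightarrow> r \<ge> 0 \<Longrightarrow> cpositive (r *\<^sub>R a)"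
proof -
  assume "cpositive a" and r: "r \<ge> 0"
  then obtain t where "t \<ge> 0" "norm (of_real t - a) \<le> t" "star a = a"
    by (auto simp: cpositive_def)
  moreover from this r have "norm (r *\<^sub>R (of_real t - a)) \<le> r * t"
    by (simp add: mult_left_mono)
  ultimately show ?thesis using r
    by (auto simp: cpositive_def of_real_def algebra_simps intro!: exI[of _ "r * t"])
qed

lemma cpositive_diffI: "star h = h \<Longrightarrow> norm h \<le> t \<Longrightarrow> cpositive (of_real t - h)"
  using order_trans[OF norm_ge_zero[of h]] by (auto simp: cpositive_def star_diff intro!: exI[of _ t])

lemma cpositive_of_real: "t \<ge> 0 \<Longrightarrow> cpositive (of_real t)"
  using cpositive_diffI[of 0 t] by simp

lemma cpositive_zero [simp]: "cpositive 0"
  using cpositive_of_real[of 0] by simp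

lemma cpositive_sum: "(\<And>i. i \<in> I \<Longrightarrow> cpositive (f i)) \<Longrightarrow> cpositive (\<Sum>i\<in>I. f i)"
  by (induction I rule: infinite_finite_induct) (auto intro: cpositive_add)

section \<open>Square roots and commuting products of positive elements\<close>

lemma of_real_commute: "of_real t * x = x * (of_real t :: 'a::real_algebra_1)"
  by (simp add: of_real_def)

text \<open>Scaled to norm below 1, \<open>1 - g * g\<close> has a square root \<open>y\<close>
  commuting with \<open>g\<close>. The squares of \<open>y\<close> and \<open>g\<close> sum to 1, so
  \<open>1 - g * g = y * y\<close> has norm at most 1.\<close>

lemma cpositive_square:
  assumes "star h = h"
  shows "cpositive (h * h)"
proof -
  define c where "c = 1 / (norm h + 1)"
  have c: "c > 0" by (simp add: c_def add_nonneg_pos)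
  define g where "g = c *\<^sub>R h"
  have ng: "norm g < 1" by (simp add: g_def c_def divide_simps add_nonneg_pos)
  have sg: "star g = g" using assms by (simp add: g_def)
  have "norm (g * g) < 1"
    using ng norm_mult_ineq[of g g] mult_left_le[of "norm g" "norm g"] by simp
  moreover have "star (g * g) = g * g" by (simp add: sg star_mult)
  ultimately obtain y where y: "star y = y" "y * y = 1 - g * g"
    and comm: "\<And>c. c * (g * g) = (g * g) * c \<Longrightarrow> c * y = y * c"
    using sqrt_one_minus by blast
  have "g * y = y * g" by (rule comm) (simp add: mult.assoc)
  then have "norm (y * y) \<le> \<bar>1\<bar>"
    using y sg by (intro norm_square_le_if_sum_of_squares[where w = g]) auto
  then have "cpositive (g * g)"
    using y sg by (auto simp: cpositive_def star_mult intro!: exI[of _ 1])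
  then have "cpositive ((1 / (c * c)) *\<^sub>R (g * g))" by (intro cpositive_scaleR) auto
  also have "(1 / (c * c)) *\<^sub>R (g * g) = h * h" using c by (simp add: g_def)
  finally show ?thesis .
qed

text \<open>The shift by \<open>e\<close> makes the bound strict:
  \<open>k = (t - h) / (t + e)\<close> has norm below 1, and
  \<open>h + e = (t + e) (1 - k)\<close>.\<close>

lemma cpositive_sqrt:
  assumes "cpositive h" "e > 0"
  obtains y where "star y = y" "y * y = h + of_real e" "\<And>c. c * h = h * c \<Longrightarrow> c * y = y * c"
proof -
  obtain t where t: "t \<ge> 0" "norm (of_real t - h) \<le> t" and sh: "star h = h"
    using assms by (auto simp: cpositive_def)
  define T where "T = t + e"
  have T: "T > 0" using t assms by (simp add: T_def)
  define k where "k = (1 / T) *\<^sub>R (of_real t - h)"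
  have "norm k < 1" using t T assms by (simp add: k_def divide_simps T_def)
  moreover have "star k = k" by (simp add: k_def star_diff sh)
  ultimately obtain y where y: "star y = y" "y * y = 1 - k"
    "\<And>c. c * k = k * c \<Longrightarrow> c * y = y * c" using sqrt_one_minus by blast
  have "(sqrt T *\<^sub>R y) * (sqrt T *\<^sub>R y) = T *\<^sub>R (1 - k)" using T by (simp add: y)
  also have "\<dots> = h + of_real e"
    using T by (simp add: k_def algebra_simps of_real_def) (simp add: T_def algebra_simps)
  finally have "(sqrt T *\<^sub>R y) * (sqrt T *\<^sub>R y) = h + of_real e" .
  moreover have "c * (sqrt T *\<^sub>R y) = (sqrt T *\<^sub>R y) * c" if "c * h = h * c" for c
  proof -
    have "c * k = k * c" using that by (simp add: k_def algebra_simps of_real_def)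
    from y(3)[OF this] show ?thesis by simp
  qed
  ultimately show thesis using y(1) that[of "sqrt T *\<^sub>R y"] by simp
qed

lemma cpositive_commuting_sqrts:
  assumes "cpositive a" "cpositive b" "a * b = b * a" "e > 0"
  obtains y w where "star y = y" "star w = w" "y * w = w * y"
    "y * y = a + of_real e" "w * w = b + of_real e"
proof -
  obtain y where y: "star y = y" "y * y = a + of_real e" "\<And>c. c * a = a * c \<Longrightarrow> c * y = y * c"
    using cpositive_sqrt[OF assms(1,4)] by blast
  obtain w where w: "star w = w" "w * w = b + of_real e" "\<And>c. c * b = b * c \<Longrightarrow> c * w = w * c"
    using cpositive_sqrt[OF assms(2,4)] by blast
  \<comment> \<open>\<open>b\<close> commutes with \<open>a\<close>, hence with \<open>y\<close>; so
    \<open>y\<close> commutes with \<open>b\<close>, hence with \<open>w\<close>.\<close>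
  have "y * w = w * y" using y(3) w(3) assms(3) by metis
  with y w that show thesis by blast
qed

text \<open>The square roots of \<open>a + e/3\<close> and \<open>t - a + e/3\<close> commute, and
  their squares sum to the scalar \<open>t + 2 * (e/3)\<close>. The last third of \<open>e\<close>
  pays for removing the shift from \<open>a\<close>.\<close>

lemma norm_le_if_cpositive:
  assumes "cpositive a" "cpositive (of_real t - a)" "t \<ge> 0"
  shows "norm a \<le> t"
proof (rule field_le_epsilon)
  fix e :: real assume e: "e > 0"
  have "a * (of_real t - a) = (of_real t - a) * a" by (simp add: algebra_simps of_real_commute)
  then obtain y w where yw: "star y = y" "star w = w" "y * w = w * y"
    "y * y = a + of_real (e/3)" "w * w = of_real t - a + of_real (e/3)"
    using cpositive_commuting_sqrts[OF assms(1,2), of "e/3"] e by auto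
  have "y * y + w * w = of_real t + (of_real (e/3) + of_real (e/3))" by (simp add: yw)
  also have "\<dots> = of_real (t + 2*(e/3))" unfolding of_real_add[symmetric] by simp
  finally have "y * y + w * w = of_real (t + 2*(e/3))" .
  from norm_square_le_if_sum_of_squares[OF yw(1-3) this]
  have "norm (a + of_real (e/3)) \<le> t + 2*(e/3)" using e assms by (simp add: yw)
  moreover have "norm a \<le> norm (a + of_real (e/3)) + norm (of_real (e/3) :: 'a)"
    by (metis add_diff_cancel_right' norm_triangle_ineq4)
  ultimately show "norm a \<le> t + e" using e by simp
qed

text \<open>The witness \<open>t\<close> can always be \<open>norm h\<close>. Without the
  existential quantifier the cone is visibly closed.\<close>

lemma cpositive_iff: "cpositive h \<longleftrightarrow> star h = h \<and> norm (of_real (norm h) - h) \<le> norm h"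
proof
  assume h: "cpositive h"
  have "cpositive (of_real (norm h) - h)" using h by (auto intro!: cpositive_diffI simp: cpositive_star)
  then have "norm (of_real (norm h) - h) \<le> norm h"
    by (rule norm_le_if_cpositive) (use h in auto)
  then show "star h = h \<and> norm (of_real (norm h) - h) \<le> norm h" using h by (simp add: cpositive_star)
next
  assume "star h = h \<and> norm (of_real (norm h) - h) \<le> norm h"
  then show "cpositive h" by (auto simp: cpositive_def intro!: exI[of _ "norm h"])
qed

lemma norm_diff_le_if_cpositive:
  assumes "cpositive h" "norm h \<le> s"
  shows "norm (of_real s - h) \<le> s"
proof (rule norm_le_if_cpositive)
  show "cpositive (of_real s - h)"
    using assms by (intro cpositive_diffI cpositive_star)
  show "cpositive (of_real s - (of_real s - h))" using assms by simp
  show "0 \<le> s" using assms(2) norm_ge_zero[of h] by linarith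
qed

lemma norm_mono_if_cpositive:
  assumes "cpositive a" "cpositive (b - a)"
  shows "norm a \<le> norm b"
proof (rule norm_le_if_cpositive[OF assms(1)])
  have "cpositive b" using cpositive_add[OF assms] by simp
  then have "cpositive (of_real (norm b) - b)"
    by (intro cpositive_diffI cpositive_star order_refl)
  from cpositive_add[OF this assms(2)]
  have "cpositive (of_real (norm b) - b + (b - a))" .
  then show "cpositive (of_real (norm b) - a)" by simp
qed auto

lemma closed_cpositive: "closed {h. cpositive h}"
proof -
  have eq: "{h. cpositive h} = {h. star h = h} \<inter> {h. norm (of_real (norm h) - h) \<le> norm h}"
    by (simp only: cpositive_iff) (rule Collect_conj_eq)
  show ?thesis unfolding eq
    by (intro closed_Int closed_Collect_eq closed_Collect_le continuous_intros)
qed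

text \<open>Up to a vanishing shift the product is \<open>(y * y) * (w * w)\<close> with commuting
  square roots, hence the square of the selfadjoint element \<open>y * w\<close>.\<close>

lemma cpositive_mult:
  assumes "cpositive a" "cpositive b" "a * b = b * a"
  shows "cpositive (a * b)"
proof -
  define f where "f n = (a + of_real (inverse (real (Suc n)))) * (b + of_real (inverse (real (Suc n))))" for n
  have "cpositive (f n)" for n
  proof -
    obtain y w where yw: "star y = y" "star w = w" "y * w = w * y"
      "y * y = a + of_real (inverse (real (Suc n)))" "w * w = b + of_real (inverse (real (Suc n)))"
      using cpositive_commuting_sqrts[OF assms, of "inverse (real (Suc n))"] by auto
    have "f n = (y * w) * (y * w)" unfolding f_def yw(4,5)[symmetric] using yw(3) by (metis mult.assoc)
    moreover have "star (y * w) = y * w" using yw by (simp add: star_mult)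
    ultimately show ?thesis using cpositive_square by metis
  qed
  moreover have "f \<longlonglongrightarrow> (a + of_real 0) * (b + of_real 0)"
    unfolding f_def by (intro tendsto_intros LIMSEQ_inverse_real_of_nat)
  ultimately have "(a + of_real 0) * (b + of_real 0) \<in> {h. cpositive h}"
    using closed_sequentially[OF closed_cpositive] by blast
  then show ?thesis by simp
qed

lemma cpositive_power: "cpositive s \<Longrightarrow> cpositive (s ^ n)"
  by (induction n) (use cpositive_of_real[of 1] in \<open>auto intro!: cpositive_mult simp: power_commutes\<close>)

text \<open>The C*-identity gives equality for the exponents \<open>2 ^ m\<close>. A strict
  inequality at \<open>k\<close> would, by submultiplicativity, force one at
  \<open>2 ^ k = k + (2 ^ k - k)\<close>.\<close>

lemma norm_power_selfadjoint:
  fixes s :: "'a::cstar_algebra"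
  assumes "star s = s"
  shows "norm (s ^ k) = norm s ^ k"
proof (cases "s = 0")
  case False
  have *: "norm (s ^ (2 ^ m)) = norm s ^ (2 ^ m)" for m
  proof (induction m)
    case (Suc m)
    have "s ^ (2 ^ Suc m) = star (s ^ (2 ^ m)) * s ^ (2 ^ m)"
      by (simp add: star_power assms mult_2 power_add)
    then show ?case using Suc by (simp add: cstar_identity power_mult[symmetric] mult.commute)
  qed simp
  have "k < 2 ^ k" by (rule less_exp)
  have "norm s ^ k * norm s ^ (2 ^ k - k) = norm (s ^ (2 ^ k))"
    using \<open>k < 2 ^ k\<close> by (simp add: * power_add[symmetric])
  also have "\<dots> = norm (s ^ k * s ^ (2 ^ k - k))"
    using \<open>k < 2 ^ k\<close> by (simp add: power_add[symmetric])
  also have "\<dots> \<le> norm (s ^ k) * norm (s ^ (2 ^ k - k))" by (rule norm_mult_ineq)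
  also have "\<dots> \<le> norm (s ^ k) * norm s ^ (2 ^ k - k)" by (intro mult_left_mono norm_power_ineq) auto
  finally have "norm s ^ k \<le> norm (s ^ k)" using False by simp
  then show ?thesis using norm_power_ineq[of s k] by simp
qed (cases k; simp)

text \<open>A linear factor does not change an exponential rate. Together with
  \<open>norm_power_selfadjoint\<close>, growth of powers becomes a bound on the norm.\<close>

lemma le_if_power_le_linear:
  fixes b K :: real
  assumes "K > 0" "\<And>n. b ^ n \<le> K ^ n * (1 + real n * C)"
  shows "b \<le> K"
proof (rule ccontr)
  assume "\<not> b \<le> K"
  then have r: "norm (K / b) < 1" and b: "b > 0" using assms by auto
  have "(\<lambda>n. (K/b) ^ n + real n * (K/b) ^ n * C) \<longlonglongrightarrow> 0 + 0 * C"
    by (intro tendsto_intros powser_times_n_limit_0[OF r] LIMSEQ_power_zero[OF r])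
  moreover have "1 \<le> (K/b) ^ n + real n * (K/b) ^ n * C" for n
  proof -
    have "1 \<le> K ^ n * (1 + real n * C) / b ^ n" using assms(2)[of n] b by simp
    also have "\<dots> = (K/b) ^ n + real n * (K/b) ^ n * C"
      by (simp add: power_divide ring_distribs add_divide_distrib)
    finally show ?thesis .
  qed
  ultimately have "1 \<le> 0 + 0 * C" by (intro LIMSEQ_le_const) auto
  then show False by simp
qed

text \<open>For large \<open>M\<close>, positivity of \<open>h + e\<close> means \<open>norm (M - h) \<le> M + e\<close>. The powers of
  \<open>M - y\<^sup>* y\<close> and \<open>M - y y\<^sup>*\<close> differ by factors of \<open>y\<close> only, so that both have the same
  exponential growth; this replaces the spectral argument.\<close>

lemma cpositive_star_mult_swap:
  fixes y :: "'a::cstar_algebra"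
  assumes "cpositive (y * star y + of_real e)" "e \<ge> 0"
  shows "cpositive (star y * y + of_real e)"
proof -
  define p q where "p = star y * y" and "q = y * star y"
  define M where "M = norm q + 1"
  define K where "K = M + e"
  define C where "C = (norm y)\<^sup>2"
  have M: "M > 0" "M \<le> K" "K > 0" "C \<ge> 0"
    unfolding M_def K_def C_def using norm_ge_zero[of q] assms(2) by (linarith | simp)+
  have "norm (q + of_real e) \<le> K"
    using norm_triangle_ineq[of q "of_real e"] assms by (simp add: K_def M_def)
  then have "norm (of_real K - (q + of_real e)) \<le> K"
    using assms by (intro norm_diff_le_if_cpositive) (auto simp: q_def)
  then have nq: "norm (of_real M - q) \<le> K" by (simp add: K_def)
  have intertw: "(of_real M - p) ^ n * star y = star y * (of_real M - q) ^ n" for n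
  proof (induction n)
    case (Suc n)
    have "(of_real M - p) * star y = star y * (of_real M - q)"
      by (simp add: p_def q_def algebra_simps of_real_commute)
    with Suc show ?case by (metis mult.assoc power_Suc power_Suc2)
  qed simp
  \<comment> \<open>Each step multiplies by \<open>M \<le> K\<close> only; the remaining term is
    rewritten by \<open>intertw\<close> in powers of \<open>M - q\<close> and costs at most
    \<open>C * K ^ n\<close>. These costs add up to the linear factor.\<close>
  have bound: "norm ((of_real M - p) ^ n) \<le> K ^ n * (1 + real n * (C / K))" for n
  proof (induction n)
    case (Suc n)
    have "(of_real M - p) ^ Suc n = of_real M * (of_real M - p) ^ n - (of_real M - p) ^ n * star y * y"
      by (simp add: power_Suc2 p_def algebra_simps of_real_commute del: power_Suc)
    also have "\<dots> = of_real M * (of_real M - p) ^ n - star y * (of_real M - q) ^ n * y"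
      by (simp add: intertw)
    finally have "norm ((of_real M - p) ^ Suc n) \<le>
        norm (of_real M * (of_real M - p) ^ n) + norm (star y * (of_real M - q) ^ n * y)"
      by (metis norm_triangle_ineq4)
    also have "norm (of_real M * (of_real M - p) ^ n) = M * norm ((of_real M - p) ^ n)"
      using M by (simp add: of_real_def)
    also have "M * norm ((of_real M - p) ^ n) \<le> K * (K ^ n * (1 + real n * (C / K)))"
      using Suc M by (intro mult_mono) auto
    also have "norm (star y * (of_real M - q) ^ n * y) \<le> norm y * norm (of_real M - q) ^ n * norm y"
      by (intro order_trans[OF norm_mult_ineq] mult_right_mono)
        (auto intro!: order_trans[OF norm_mult_ineq] mult_left_mono norm_power_ineq)
    also have "norm y * norm (of_real M - q) ^ n * norm y \<le> C * K ^ n"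
      using power_mono[OF nq, of n] by (simp add: C_def power2_eq_square mult_left_mono mult.commute mult.left_commute)
    finally show ?case using M by (simp add: field_simps)
  qed simp
  have "star (of_real M - p) = of_real M - p" by (simp add: p_def star_diff star_mult star_star)
  from le_if_power_le_linear[OF \<open>K > 0\<close> bound[unfolded norm_power_selfadjoint[OF this]]]
  have "norm (of_real M - p) \<le> K" .
  then have "norm (of_real (M + e) - (p + of_real e)) \<le> M + e" by (simp add: K_def)
  moreover have "star (p + of_real e) = p + of_real e" by (simp add: p_def star_add star_mult star_star)
  moreover have "M + e \<ge> 0" using M by (simp add: K_def)
  ultimately show ?thesis unfolding cpositive_def p_def by blast
qed

text \<open>With \<open>y = a + \<i> b\<close> split into selfadjoint parts, the expression equals
  \<open>2 (a * a + b * b)\<close>.\<close>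

lemma cpositive_mult_star_add_star_mult:
  fixes y :: "'a::cstar_algebra"
  shows "cpositive (y * star y + star y * y)"
proof -
  define a b where "a = (1/2::real) *\<^sub>R (y + star y)" and "b = (- \<i> / 2) *\<^sub>C (y - star y)"
  have sa: "star a = a" by (simp add: a_def star_add star_star add.commute)
  have sb: "star b = b"
    by (simp add: b_def star_diff star_star star_scaleC scaleC_diff_right)
  have "4 *\<^sub>R (a * a) = (y + star y) * (y + star y)" by (simp add: a_def)
  moreover have "4 *\<^sub>R (b * b) = - ((y - star y) * (y - star y))"
    by (simp add: b_def mult_scaleC_left mult_scaleC_right scaleC_scaleC scaleC_of_real[symmetric])
  ultimately have "4 *\<^sub>R (a * a) + 4 *\<^sub>R (b * b) = 2 *\<^sub>R (y * star y + star y * y)"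
    by (simp add: algebra_simps scaleR_2)
  then have "(1/2::real) *\<^sub>R (4 *\<^sub>R (a * a) + 4 *\<^sub>R (b * b)) = y * star y + star y * y"
    by simp
  then have "y * star y + star y * y = 2 *\<^sub>R (a * a) + 2 *\<^sub>R (b * b)"
    by (simp add: scaleR_add_right)
  then show ?thesis
    using cpositive_square[OF sa] cpositive_square[OF sb] by (simp add: cpositive_add cpositive_scaleR)
qed

text \<open>With \<open>s = 1 - x\<^sup>* x\<close> and \<open>y = x s\<^sup>n\<close>, the element \<open>y\<^sup>* y = s\<^sup>2\<^sup>n (1 - s)\<close> is at most \<open>1/2n\<close>, whereas a
  negative part of \<open>x\<^sup>* x\<close> would make it very negative. By the previous lemmas it is at least \<open>-1/2n\<close>.\<close>

lemma cpositive_star_mult_aux: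
  fixes x :: "'a::cstar_algebra"
  assumes "norm x \<le> 1"
  shows "cpositive (star x * x)"
proof -
  define h where "h = star x * x"
  define s where "s = 1 - h"
  have sh: "star h = h" by (simp add: h_def star_mult star_star)
  have ss: "star s = s" by (simp add: s_def star_diff sh)
  have "norm h \<le> 1" using assms by (simp add: h_def cstar_identity power_le_one)
  then have ps: "cpositive s" using cpositive_diffI[OF sh, of 1] by (simp add: s_def)
  \<comment> \<open>The scalar inequality \<open>m * s ^ m * (1 - s) \<le> 1 - s ^ m\<close>; the
    step from \<open>m\<close> to \<open>m + 1\<close> adds
    \<open>(m + 1) * s ^ m * (1 - s)\<^sup>2\<close> to the difference of the two sides.\<close>
  have ineq: "cpositive (1 - s ^ m - real m *\<^sub>R (s ^ m - s ^ Suc m))" for m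
  proof (induction m)
    case (Suc m)
    have "cpositive (s ^ m * ((1 - s) * (1 - s)))"
    proof (rule cpositive_mult)
      show "cpositive (s ^ m)" by (rule cpositive_power[OF ps])
      show "cpositive ((1 - s) * (1 - s))" by (rule cpositive_square) (simp add: star_diff ss)
      have "s * ((1 - s) * (1 - s)) = ((1 - s) * (1 - s)) * s" by (simp add: algebra_simps)
      from power_commuting_commutes[OF this]
      show "s ^ m * ((1 - s) * (1 - s)) = ((1 - s) * (1 - s)) * s ^ m" .
    qed
    then have "cpositive (real (Suc m) *\<^sub>R (s ^ m * ((1 - s) * (1 - s))))"
      by (rule cpositive_scaleR) auto
    from cpositive_add[OF Suc this] show ?case
      by (simp add: algebra_simps power_commutes)
        (simp add: mult.assoc power_commutes flip: mult.assoc[of "s ^ m"])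
  qed simp
  have main: "norm s ^ Suc (2 * n) \<le> norm s ^ (2 * n) + 1 / real (2 * n)" if n: "n > 0" for n
  proof -
    define e where "e = 1 / real (2 * n)"
    have e: "e \<ge> 0" by (simp add: e_def)
    define y where "y = x * s ^ n"
    have yy: "star y * y = s ^ (2 * n) - s ^ Suc (2 * n)"
    proof -
      have "star y * y = s ^ n * (1 - s) * s ^ n"
        by (simp add: y_def star_mult star_power ss mult.assoc) (simp add: s_def h_def mult.assoc)
      also have "\<dots> = (s ^ n - s ^ n * s) * s ^ n" by (simp add: algebra_simps)
      also have "\<dots> = s ^ (2 * n) - s ^ Suc (2 * n)"
        by (simp add: algebra_simps power_commutes flip: power_add mult_2_right)
      finally show ?thesis .
    qed
    have "cpositive (1 - real (2 * n) *\<^sub>R (star y * y))"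
      using cpositive_add[OF ineq[of "2 * n"] cpositive_power[OF ps, of "2 * n"]] by (simp add: yy)
    then have "cpositive (e *\<^sub>R (1 - real (2 * n) *\<^sub>R (star y * y)))"
      using e by (rule cpositive_scaleR)
    then have "cpositive (of_real e - star y * y)"
      using n by (simp add: scaleR_diff_right of_real_def e_def)
    \<comment> \<open>Since \<open>y * star y + star y * y\<close> is positive, the upper bound
      \<open>e\<close> for \<open>star y * y\<close> is a lower bound \<open>- e\<close> for
      \<open>y * star y\<close>; swapping the factors returns it to
      \<open>star y * y\<close>.\<close>
    from cpositive_add[OF cpositive_mult_star_add_star_mult[of y] this]
    have "cpositive (y * star y + of_real e)" by (simp add: algebra_simps)
    then have "cpositive (star y * y + of_real e)" using e by (rule cpositive_star_mult_swap)
    then have "cpositive (s ^ (2 * n) + of_real e - s ^ Suc (2 * n))" by (simp add: yy algebra_simps)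
    then have "norm (s ^ Suc (2 * n)) \<le> norm (s ^ (2 * n) + of_real e)"
      by (intro norm_mono_if_cpositive cpositive_power ps)
    also have "\<dots> \<le> norm (s ^ (2 * n)) + e"
      using e by (metis norm_triangle_ineq norm_of_real abs_of_nonneg)
    finally show ?thesis by (simp add: norm_power_selfadjoint[OF ss] e_def del: power_Suc)
  qed
  \<comment> \<open>For \<open>norm s > 1\<close> the two powers in \<open>main\<close> differ by at
    least \<open>norm s - 1\<close>, for every \<open>n\<close>, whereas \<open>main\<close> allows
    only \<open>1 / (2 * n)\<close>.\<close>
  have "norm s \<le> 1"
  proof (rule ccontr)
    assume "\<not> norm s \<le> 1"
    then obtain n where n: "inverse (real (Suc n)) < norm s - 1"
      using reals_Archimedean[of "norm s - 1"] by auto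
    have "1 * (norm s - 1) \<le> norm s ^ (2 * Suc n) * (norm s - 1)"
      using \<open>\<not> norm s \<le> 1\<close> by (intro mult_right_mono one_le_power) auto
    also have "\<dots> \<le> 1 / real (2 * Suc n)"
      using main[of "Suc n"] by (simp add: algebra_simps)
    also have "\<dots> \<le> inverse (real (Suc n))" by (simp add: field_simps)
    finally show False using n by simp
  qed
  then have "cpositive (of_real 1 - s)" using ss by (rule cpositive_diffI[rotated])
  then show ?thesis by (simp add: s_def h_def)
qed

theorem cpositive_star_mult: "cpositive (star x * (x::'a::cstar_algebra))"
proof -
  define c where "c = norm x + 1"
  have c: "c > 0" by (simp add: c_def add_nonneg_pos)
  have "norm ((1 / c) *\<^sub>R x) \<le> 1" using c by (simp add: c_def divide_simps)
  then have "cpositive (star ((1 / c) *\<^sub>R x) * ((1 / c) *\<^sub>R x))" by (rule cpositive_star_mult_aux)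
  then have "cpositive ((c * c) *\<^sub>R (star ((1 / c) *\<^sub>R x) * ((1 / c) *\<^sub>R x)))"
    by (rule cpositive_scaleR) auto
  then show ?thesis using c by simp
qed

text \<open>The other summands are positive and the norm is monotone on positive elements. This
  bounds single resolvent entries by their column.\<close>

lemma norm_square_le_norm_sum:
  fixes v :: "'i \<Rightarrow> 'a::cstar_algebra"
  assumes "finite I" "i \<in> I"
  shows "(norm (v i))\<^sup>2 \<le> norm (\<Sum>j\<in>I. star (v j) * v j)"
proof -
  have "(\<Sum>j\<in>I. star (v j) * v j) - star (v i) * v i = (\<Sum>j\<in>I - {i}. star (v j) * v j)"
    using assms by (simp add: sum.remove[OF assms])
  also have "cpositive \<dots>"
    by (rule cpositive_sum) (rule cpositive_star_mult)
  finally have "norm (star (v i) * v i) \<le> norm (\<Sum>j\<in>I. star (v j) * v j)"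
    by (rule norm_mono_if_cpositive[OF cpositive_star_mult])
  then show ?thesis by (simp add: cstar_identity)
qed

section \<open>States\<close>

context
  fixes \<phi> :: "'a::cstar_algebra \<Rightarrow> complex"
  assumes phi: "cstar_prob_space \<phi>"
begin

lemma phi_add: "\<phi> (x + y) = \<phi> x + \<phi> y"
  and phi_scaleC: "\<phi> (c *\<^sub>C x) = c * \<phi> x"
  and phi_one: "\<phi> 1 = 1"
  and phi_star_mult: "\<phi> (star x * x) \<in> \<real>\<^sub>\<ge>\<^sub>0"
  using phi by (auto simp: cstar_prob_space_def)

lemma phi_zero: "\<phi> 0 = 0"
  using phi_scaleC[of 0 0] by simp

lemma phi_minus: "\<phi> (- x) = - \<phi> x"
  using phi_scaleC[of "-1" x] by simp

lemma phi_diff: "\<phi> (x - y) = \<phi> x - \<phi> y"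
  using phi_add[of x "-y"] by (simp add: phi_minus)

lemma phi_sum: "\<phi> (\<Sum>i\<in>I. f i) = (\<Sum>i\<in>I. \<phi> (f i))"
  by (induction I rule: infinite_finite_induct) (auto simp: phi_add phi_zero)

text \<open>\<open>\<phi>\<close> is real on \<open>star y * y\<close> for \<open>y = x + c\<close>;
  the choices \<open>c = 1\<close> and \<open>c = \<i>\<close> yield the imaginary and the real
  part.\<close>

lemma phi_star: "\<phi> (star x) = cnj (\<phi> x)"
proof -
  have real: "Im (\<phi> (star y * y)) = 0" for y
    using phi_star_mult[of y] by (auto simp: complex_nonneg_Reals_iff)
  have "Im (cnj c * \<phi> x + c * \<phi> (star x)) = 0" for c
  proof -
    have "star (x + c *\<^sub>C 1) * (x + c *\<^sub>C 1) =
        star x * x + cnj c *\<^sub>C x + c *\<^sub>C star x + (c * cnj c) *\<^sub>C 1"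
      by (simp add: star_add star_scaleC algebra_simps mult_scaleC_left mult_scaleC_right
          scaleC_scaleC scaleC_add_right)
    then show ?thesis using real[of "x + c *\<^sub>C 1"] real[of x]
      by (simp add: phi_add phi_scaleC phi_one)
  qed
  from this[of 1] this[of \<i>] show ?thesis by (simp add: complex_eq_iff)
qed

text \<open>The variance, that is \<open>\<phi>\<close> of \<open>star y * y\<close> for the
  centered \<open>y = x - \<phi> x\<close>, is nonnegative.\<close>

lemma cmod_phi_square_le: "(cmod (\<phi> x))\<^sup>2 \<le> Re (\<phi> (star x * x))"
proof -
  define y where "y = x - \<phi> x *\<^sub>C 1"
  have "star y * y = star x * x - cnj (\<phi> x) *\<^sub>C x - \<phi> x *\<^sub>C star x + (\<phi> x * cnj (\<phi> x)) *\<^sub>C 1"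
    by (simp add: y_def star_diff star_scaleC algebra_simps mult_scaleC_left mult_scaleC_right
        scaleC_scaleC scaleC_diff_right)
  then have "\<phi> (star y * y) = \<phi> (star x * x) - complex_of_real ((cmod (\<phi> x))\<^sup>2)"
    unfolding complex_norm_square
    by (simp add: phi_add phi_diff phi_scaleC phi_one phi_star)
  with phi_star_mult[of y] show ?thesis by (simp add: complex_nonneg_Reals_iff)
qed

text \<open>Continuity comes from positivity: \<open>(norm x)\<^sup>2 + e - star x * x\<close> is
  the square of a selfadjoint element, so \<open>\<phi>\<close> is nonnegative on it.\<close>

lemma cmod_phi_le_norm: "cmod (\<phi> x) \<le> norm x"
proof -
  have "(cmod (\<phi> x))\<^sup>2 \<le> (norm x)\<^sup>2 + e" if e: "e > 0" for e
  proof -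
    have "star (star x * x) = star x * x" by (simp add: star_mult star_star)
    from cpositive_diffI[OF this order_refl]
    obtain y where "star y = y" "y * y = of_real (norm (star x * x)) - star x * x + of_real e"
      using cpositive_sqrt[OF _ e] by metis
    then have y: "star y * y = ((norm x)\<^sup>2 + e) *\<^sub>R 1 - star x * x"
      by (simp add: cstar_identity of_real_def algebra_simps)
    have "\<phi> (r *\<^sub>R 1) = of_real r" for r
      using phi_scaleC[of "of_real r" 1] by (simp add: scaleC_of_real phi_one)
    then have "\<phi> (star y * y) = of_real ((norm x)\<^sup>2 + e) - \<phi> (star x * x)"
      by (simp only: y phi_diff)
    then have "Re (\<phi> (star x * x)) \<le> (norm x)\<^sup>2 + e"
      using phi_star_mult[of y] by (simp add: complex_nonneg_Reals_iff)
    then show ?thesis using cmod_phi_square_le[of x] by linarith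
  qed
  then have "(cmod (\<phi> x))\<^sup>2 \<le> (norm x)\<^sup>2" by (rule field_le_epsilon)
  then show ?thesis by (simp add: power2_le_iff_abs_le)
qed

lemma bounded_linear_phi: "bounded_linear \<phi>"
proof (rule bounded_linear_intro[where K = 1])
  show "\<phi> (r *\<^sub>R x) = r *\<^sub>R \<phi> x" for r x
    by (metis phi_scaleC scaleC_of_real scaleR_conv_of_real)
qed (auto simp: phi_add cmod_phi_le_norm)

end

section \<open>Free integration by parts\<close>

definition bilin :: "('a::cstar_algebra \<Rightarrow> 'a \<Rightarrow> complex) \<Rightarrow> bool" where
  "bilin D \<longleftrightarrow>
     (\<forall>a a' b. D (a + a') b = D a b + D a' b) \<and> (\<forall>a b b'. D a (b + b') = D a b + D a b') \<and>
     (\<forall>c a b. D (c *\<^sub>C a) b = c * D a b) \<and> (\<forall>c a b. D a (c *\<^sub>C b) = c * D a b)"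

fun leib :: "'a::cstar_algebra \<Rightarrow> ('a \<times> ('a \<Rightarrow> 'a \<Rightarrow> complex)) list \<Rightarrow> 'a \<Rightarrow> complex" where
  "leib a [] b = 0"
| "leib a ((P, D) # r) b = D a (prod_list (map fst r) * b) + leib (a * P) r b"

text \<open>\<open>derives \<phi> \<kappa> S P D\<close> says that \<open>P\<close> is a polynomial expression in \<open>S\<close> and that
  \<open>D a b = (\<phi> \<otimes> \<phi>)((a \<otimes> 1) \<partial>P (1 \<otimes> b))\<close> for the free difference quotient \<open>\<partial>\<close> with \<open>\<partial>y = \<kappa> y (1 \<otimes> 1)\<close>.
  Since \<open>\<partial>\<close> acts on formal expressions, \<open>D\<close> need not be determined by the element \<open>P\<close>. In \<open>leib\<close> the
  list entries are such pairs \<open>(P, D)\<close>, and the Leibniz rule is applied to their product.\<close>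

inductive derives ::
  "('a::cstar_algebra \<Rightarrow> complex) \<Rightarrow> ('a \<Rightarrow> complex) \<Rightarrow> 'a set \<Rightarrow> 'a \<Rightarrow> ('a \<Rightarrow> 'a \<Rightarrow> complex) \<Rightarrow> bool"
  for \<phi> \<kappa> S where
  one: "derives \<phi> \<kappa> S 1 (\<lambda>a b. 0)"
| gen: "y \<in> S \<Longrightarrow> derives \<phi> \<kappa> S y (\<lambda>a b. \<kappa> y * \<phi> a * \<phi> b)"
| add: "derives \<phi> \<kappa> S P D \<Longrightarrow> derives \<phi> \<kappa> S Q E \<Longrightarrow> derives \<phi> \<kappa> S (P + Q) (\<lambda>a b. D a b + E a b)"
| mult: "derives \<phi> \<kappa> S P D \<Longrightarrow> derives \<phi> \<kappa> S Q E \<Longrightarrow>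
    derives \<phi> \<kappa> S (P * Q) (\<lambda>a b. D a (Q * b) + E (a * P) b)"
| scale: "derives \<phi> \<kappa> S P D \<Longrightarrow> derives \<phi> \<kappa> S (c *\<^sub>C P) (\<lambda>a b. c * D a b)"

lemma derives_cong:
  "derives \<phi> \<kappa> S P D \<Longrightarrow> P = P' \<Longrightarrow> (\<And>a b. D a b = D' a b) \<Longrightarrow> derives \<phi> \<kappa> S P' D'"
proof -
  assume "derives \<phi> \<kappa> S P D" "P = P'" "\<And>a b. D a b = D' a b"
  moreover from this(3) have "D = D'" by (intro ext)
  ultimately show ?thesis by simp
qed

lemma derives_unital_subalgebra: "derives \<phi> \<kappa> S P D \<Longrightarrow> P \<in> unital_subalgebra S"
  by (induction rule: derives.induct) (auto intro: unital_subalgebra.intros)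

lemma leib_append:
  "leib a (xs @ ys) b = leib a xs (prod_list (map fst ys) * b) + leib (a * prod_list (map fst xs)) ys b"
  by (induction a xs b rule: leib.induct) (auto simp: mult.assoc)

lemma bilin_leib: "(\<And>P D. (P, D) \<in> set xs \<Longrightarrow> bilin D) \<Longrightarrow> bilin (\<lambda>a b. leib a xs b)"
proof (induction xs)
  case Nil
  then show ?case by (simp add: bilin_def)
next
  case (Cons x xs)
  obtain P D where x: "x = (P, D)" by (cases x)
  have "bilin D" "bilin (\<lambda>a b. leib a xs b)" using Cons x by auto
  then show ?case
    by (simp add: x bilin_def algebra_simps mult_scaleC_left mult_scaleC_right)
qed

definition letter :: "('a::cstar_algebra \<Rightarrow> complex) \<Rightarrow> ('a \<Rightarrow> complex) \<Rightarrow> 'a \<Rightarrow> 'a \<times> ('a \<Rightarrow> 'a \<Rightarrow> complex)" where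
  "letter \<phi> \<kappa> y = (y, \<lambda>a b. \<kappa> y * \<phi> a * \<phi> b)"

lemma map_fst_letter [simp]: "map (fst \<circ> letter \<phi> \<kappa>) ys = ys"
  by (simp add: letter_def comp_def)

text \<open>The equation \<open>\<phi> (x P) = (\<phi> \<otimes> \<phi>) (\<partial>P)\<close> for
  the product \<open>P\<close> of the entries. Keeping the factors in a list allows each to be
  treated separately.\<close>

definition schwinger_dyson ::
  "('a::cstar_algebra \<Rightarrow> complex) \<Rightarrow> 'a \<Rightarrow> ('a \<times> ('a \<Rightarrow> 'a \<Rightarrow> complex)) list \<Rightarrow> bool" where
  "schwinger_dyson \<phi> x xs \<longleftrightarrow> \<phi> (x * prod_list (map fst xs)) = leib 1 xs 1"

text \<open>The free Wick formula: \<open>\<phi> (x y1 ... yn)\<close> is the sum over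
  \<open>k\<close> of \<open>\<phi> (x yk)\<close> times \<open>\<phi>\<close> of the letters before
  \<open>yk\<close> times \<open>\<phi>\<close> of those after it.\<close>

definition wick :: "('a::cstar_algebra \<Rightarrow> complex) \<Rightarrow> 'a set \<Rightarrow> 'a \<Rightarrow> bool" where
  "wick \<phi> S x \<longleftrightarrow> (\<forall>ys\<in>lists S. schwinger_dyson \<phi> x (map (letter \<phi> (\<lambda>y. \<phi> (x * y))) ys))"

lemma wick_mono: "wick \<phi> S x \<Longrightarrow> T \<subseteq> S \<Longrightarrow> wick \<phi> T x"
  unfolding wick_def using lists_mono by blast

context
  fixes \<phi> :: "'a::cstar_algebra \<Rightarrow> complex"
  assumes phi: "cstar_prob_space \<phi>"
begin

section \<open>Reduction of polynomial expressions to words\<close>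

lemma bilin_letter: "bilin (\<lambda>a b. c * \<phi> a * \<phi> b)"
  by (simp add: bilin_def phi_add[OF phi] phi_scaleC[OF phi] algebra_simps)

lemma bilin_derives: "derives \<phi> \<kappa> S P D \<Longrightarrow> bilin D"
  by (induction rule: derives.induct)
    (auto simp: bilin_def phi_add[OF phi] phi_scaleC[OF phi] algebra_simps mult_scaleC_left mult_scaleC_right)

lemma schwinger_dyson_one:
  "schwinger_dyson \<phi> x (pre @ post) \<Longrightarrow> schwinger_dyson \<phi> x (pre @ (1, \<lambda>a b. 0) # post)"
  by (simp add: schwinger_dyson_def leib_append)

lemma schwinger_dyson_mult:
  "schwinger_dyson \<phi> x (pre @ (P * Q, \<lambda>a b. D a (Q * b) + E (a * P) b) # post) \<longleftrightarrow>
   schwinger_dyson \<phi> x (pre @ (P, D) # (Q, E) # post)"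
  by (simp add: schwinger_dyson_def leib_append algebra_simps)

lemma schwinger_dyson_add:
  assumes "bilin (\<lambda>a b. leib a pre b)" "bilin (\<lambda>a b. leib a post b)"
    and "schwinger_dyson \<phi> x (pre @ (P, D) # post)" "schwinger_dyson \<phi> x (pre @ (Q, E) # post)"
  shows "schwinger_dyson \<phi> x (pre @ (P + Q, \<lambda>a b. D a b + E a b) # post)"
  using assms
  by (simp add: schwinger_dyson_def leib_append bilin_def algebra_simps phi_add[OF phi])

lemma schwinger_dyson_scale:
  assumes "bilin (\<lambda>a b. leib a pre b)" "bilin (\<lambda>a b. leib a post b)"
    and "schwinger_dyson \<phi> x (pre @ (P, D) # post)"
  shows "schwinger_dyson \<phi> x (pre @ (c *\<^sub>C P, \<lambda>a b. c * D a b) # post)"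
  using assms
  by (simp add: schwinger_dyson_def leib_append bilin_def phi_scaleC[OF phi]
      mult_scaleC_left mult_scaleC_right flip: distrib_left)

text \<open>Both sides are linear in the entry \<open>P\<close> and do not change when a product is
  split into two entries, so \<open>P\<close> dissolves into words.\<close>

lemma schwinger_dyson_derives:
  assumes "derives \<phi> \<kappa> S P D"
    and "\<forall>(P, D)\<in>set pre. bilin D" "\<forall>(P, D)\<in>set post. bilin D"
    and "\<And>ys. ys \<in> lists S \<Longrightarrow> schwinger_dyson \<phi> x (pre @ map (letter \<phi> \<kappa>) ys @ post)"
  shows "schwinger_dyson \<phi> x (pre @ (P, D) # post)"
  using assms
proof (induction arbitrary: pre post rule: derives.induct)
  case one
  from one(3)[of "[]"] show ?case by (simp add: schwinger_dyson_one)
next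
  case (gen y)
  from gen(4)[of "[y]"] gen(1) show ?case by (simp add: letter_def)
next
  case (add P D Q E)
  show ?case
    by (rule schwinger_dyson_add) (use add in \<open>auto intro!: bilin_leib\<close>)
next
  case (mult P D Q E)
  \<comment> \<open>\<open>P\<close> is dissolved with \<open>Q\<close> standing on its right, then
    \<open>Q\<close> with a word on its left; hence the arbitrary \<open>pre\<close> and
    \<open>post\<close>.\<close>
  have "schwinger_dyson \<phi> x (pre @ (P, D) # ((Q, E) # post))"
  proof (rule mult.IH(1))
    show "\<forall>(P, D)\<in>set ((Q, E) # post). bilin D"
      using mult.prems bilin_derives[OF mult.hyps(2)] by auto
    fix ys assume ys: "ys \<in> lists S"
    have "schwinger_dyson \<phi> x ((pre @ map (letter \<phi> \<kappa>) ys) @ (Q, E) # post)"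
    proof (rule mult.IH(2))
      show "\<forall>(P, D)\<in>set (pre @ map (letter \<phi> \<kappa>) ys). bilin D"
        using mult.prems by (auto simp: letter_def bilin_letter)
      fix zs assume "zs \<in> lists S"
      with ys have "ys @ zs \<in> lists S" by auto
      from mult.prems(3)[OF this]
      show "schwinger_dyson \<phi> x ((pre @ map (letter \<phi> \<kappa>) ys) @ map (letter \<phi> \<kappa>) zs @ post)"
        by simp
    qed (use mult.prems in auto)
    then show "schwinger_dyson \<phi> x (pre @ map (letter \<phi> \<kappa>) ys @ (Q, E) # post)" by simp
  qed (use mult.prems in auto)
  then show ?case by (simp add: schwinger_dyson_mult)
next
  case (scale P D c)
  show ?case
    by (rule schwinger_dyson_scale) (use scale in \<open>auto intro!: bilin_leib\<close>)
qed

lemma wick_derives: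
  assumes "wick \<phi> S x" "derives \<phi> (\<lambda>y. \<phi> (x * y)) S P D"
  shows "\<phi> (x * P) = D 1 1"
proof -
  have "schwinger_dyson \<phi> x ([] @ (P, D) # [])"
    using assms by (intro schwinger_dyson_derives) (auto simp: wick_def)
  then show ?thesis by (simp add: schwinger_dyson_def)
qed

lemma derives_prod_list:
  assumes "\<forall>(P, D)\<in>set xs. derives \<phi> \<kappa> S P D"
  shows "derives \<phi> \<kappa> S (prod_list (map fst xs)) (\<lambda>a b. leib a xs b)"
  using assms
proof (induction xs)
  case Nil
  then show ?case by (simp add: derives.one)
next
  case (Cons x xs)
  obtain P D where x: "x = (P, D)" by (cases x)
  show ?case
    by (rule derives_cong[OF derives.mult[of \<phi> \<kappa> S P D]]) (use Cons x in auto)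
qed

lemma derives_sum:
  assumes "finite I" "\<And>i. i \<in> I \<Longrightarrow> derives \<phi> \<kappa> S (P i) (D i)"
  shows "derives \<phi> \<kappa> S (\<Sum>i\<in>I. P i) (\<lambda>a b. \<Sum>i\<in>I. D i a b)"
  using assms
proof (induction I rule: finite_induct)
  case empty
  show ?case
    by (rule derives_cong[OF derives.scale[OF derives.one, of \<phi> \<kappa> S 0]]) auto
next
  case (insert i I)
  show ?case
    by (rule derives_cong[OF derives.add[of \<phi> \<kappa> S "P i" "D i"]]) (use insert in auto)
qed

section \<open>Linear combinations\<close>

lemma leib_letter_linear:
  "leib a (map (letter \<phi> (\<lambda>y. \<alpha> * \<kappa> y + \<beta> * \<kappa>' y)) ys) b =
   \<alpha> * leib a (map (letter \<phi> \<kappa>) ys) b + \<beta> * leib a (map (letter \<phi> \<kappa>') ys) b"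
  by (induction ys arbitrary: a) (auto simp: letter_def algebra_simps comp_def)

lemma wick_linear:
  assumes "wick \<phi> S x" "wick \<phi> S x'"
  shows "wick \<phi> S (\<alpha> *\<^sub>C x + \<beta> *\<^sub>C x')"
  unfolding wick_def
proof
  fix ys assume ys: "ys \<in> lists S"
  have "\<phi> (x * prod_list ys) = leib 1 (map (letter \<phi> (\<lambda>y. \<phi> (x * y))) ys) 1"
    "\<phi> (x' * prod_list ys) = leib 1 (map (letter \<phi> (\<lambda>y. \<phi> (x' * y))) ys) 1"
    using assms ys unfolding wick_def schwinger_dyson_def by auto
  then show "schwinger_dyson \<phi> (\<alpha> *\<^sub>C x + \<beta> *\<^sub>C x')
      (map (letter \<phi> (\<lambda>y. \<phi> ((\<alpha> *\<^sub>C x + \<beta> *\<^sub>C x') * y))) ys)"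
    by (simp add: schwinger_dyson_def distrib_right phi_add[OF phi] phi_scaleC[OF phi]
        mult_scaleC_left leib_letter_linear)
qed

text \<open>A word in linear combinations is a polynomial in \<open>s\<close> and \<open>t\<close>.
  Linearity of the covariance makes its letterwise derivative agree with the one from
  \<open>derives\<close>.\<close>

lemma wick_span_pair:
  assumes "wick \<phi> {s, t} x"
  shows "wick \<phi> {\<alpha> *\<^sub>C s + \<beta> *\<^sub>C t |\<alpha> \<beta>. True} x"
  unfolding wick_def
proof
  fix ys assume ys: "ys \<in> lists {\<alpha> *\<^sub>C s + \<beta> *\<^sub>C t |\<alpha> \<beta>. True}"
  define \<kappa> where "\<kappa> y = \<phi> (x * y)" for y
  have "derives \<phi> \<kappa> {s, t} y (\<lambda>a b. \<kappa> y * \<phi> a * \<phi> b)" if "y \<in> set ys" for y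
  proof -
    have "y \<in> {\<alpha> *\<^sub>C s + \<beta> *\<^sub>C t |\<alpha> \<beta>. True}" using ys that by (rule in_listsD[THEN bspec])
    then obtain \<alpha> \<beta> where y: "y = \<alpha> *\<^sub>C s + \<beta> *\<^sub>C t" by blast
    have "derives \<phi> \<kappa> {s, t} (\<alpha> *\<^sub>C s + \<beta> *\<^sub>C t)
        (\<lambda>a b. \<alpha> * (\<kappa> s * \<phi> a * \<phi> b) + \<beta> * (\<kappa> t * \<phi> a * \<phi> b))"
      by (intro derives.add derives.scale derives.gen) simp_all
    then show ?thesis
      by (rule derives_cong)
        (simp_all only: y \<kappa>_def distrib_left distrib_right phi_add[OF phi] phi_scaleC[OF phi]
          mult_scaleC_right mult.assoc)
  qed
  then have "derives \<phi> \<kappa> {s, t} (prod_list (map fst (map (letter \<phi> \<kappa>) ys)))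
      (\<lambda>a b. leib a (map (letter \<phi> \<kappa>) ys) b)"
    by (intro derives_prod_list) (simp add: letter_def)
  from wick_derives[OF assms this[unfolded \<kappa>_def]]
  show "schwinger_dyson \<phi> x (map (letter \<phi> (\<lambda>y. \<phi> (x * y))) ys)"
    by (simp add: schwinger_dyson_def)
qed

section \<open>Free families\<close>

context
  fixes I :: "'i set" and S :: "'i \<Rightarrow> 'a set"
  assumes free: "free_sets \<phi> I S"
begin

definition admissible :: "('i \<times> 'a) list \<Rightarrow> bool" where
  "admissible cs \<longleftrightarrow> distinct_adj (map fst cs) \<and>
     (\<forall>(k, a)\<in>set cs. k \<in> I \<and> a \<in> unital_subalgebra (S k) \<and> \<phi> a = 0)"

lemma free_admissible:
  assumes "admissible cs" "cs \<noteq> []"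
  shows "\<phi> (prod_list (map snd cs)) = 0"
proof -
  have len: "length cs \<ge> 1" using assms(2) by (cases cs) auto
  have mem: "\<forall>m<length cs. fst (cs ! m) \<in> I \<and> snd (cs ! m) \<in> unital_subalgebra (S (fst (cs ! m))) \<and> \<phi> (snd (cs ! m)) = 0"
  proof (intro allI impI)
    fix m assume "m < length cs"
    then have "cs ! m \<in> set cs" by simp
    from bspec[OF conjunct2[OF assms(1)[unfolded admissible_def]] this]
    show "fst (cs ! m) \<in> I \<and> snd (cs ! m) \<in> unital_subalgebra (S (fst (cs ! m))) \<and> \<phi> (snd (cs ! m)) = 0"
      by (simp add: case_prod_unfold)
  qed
  have alt: "\<forall>m. Suc m < length cs \<longrightarrow> fst (cs ! m) \<noteq> fst (cs ! Suc m)"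
  proof (intro allI impI)
    fix m assume "Suc m < length cs"
    then show "fst (cs ! m) \<noteq> fst (cs ! Suc m)"
      using distinct_adj_nth[OF conjunct1[OF assms(1)[unfolded admissible_def]], of m] by simp
  qed
  from free[unfolded free_sets_def, THEN spec, THEN spec, THEN spec, THEN mp, THEN mp, THEN mp,
      OF len mem alt]
  have "\<phi> (prod_list (map (\<lambda>m. snd (cs ! m)) [0..<length cs])) = 0" .
  also have "map (\<lambda>m. snd (cs ! m)) [0..<length cs] = map snd cs"
    by (rule nth_equalityI) simp_all
  finally show ?thesis .
qed

lemma centered_unital_subalgebra:
  assumes "u \<in> unital_subalgebra T"
  shows "u + (- \<phi> u) *\<^sub>C 1 \<in> unital_subalgebra T" "\<phi> (u + (- \<phi> u) *\<^sub>C 1) = 0"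
  using assms unital_subalgebra.add[OF assms unital_subalgebra.scale[OF unital_subalgebra.one, of "- \<phi> u"]]
  by (simp_all add: phi_diff[OF phi] phi_scaleC[OF phi] phi_one[OF phi])

text \<open>\<open>u\<close> need not be centered: its scalar part leaves the non-empty alternating
  product, whose expectation vanishes as well.\<close>

lemma free_admissible_left:
  assumes "admissible cs" "cs \<noteq> []" "k \<in> I" "u \<in> unital_subalgebra (S k)" "fst (hd cs) \<noteq> k"
  shows "\<phi> (u * prod_list (map snd cs)) = 0"
proof -
  define u' where "u' = u + (- \<phi> u) *\<^sub>C 1"
  have "admissible ((k, u') # cs)"
    using assms centered_unital_subalgebra[OF assms(4)]
    by (auto simp: admissible_def distinct_adj_Cons hd_map u'_def)
  from free_admissible[OF this] free_admissible[OF assms(1,2)]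
  show ?thesis
    by (simp add: u'_def algebra_simps phi_diff[OF phi] phi_scaleC[OF phi] mult_scaleC_left)
qed

lemma free_admissible_right:
  assumes "admissible cs" "cs \<noteq> []" "k \<in> I" "u \<in> unital_subalgebra (S k)" "fst (last cs) \<noteq> k"
  shows "\<phi> (prod_list (map snd cs) * u) = 0"
proof -
  define u' where "u' = u + (- \<phi> u) *\<^sub>C 1"
  have "admissible (cs @ [(k, u')])"
    using assms centered_unital_subalgebra[OF assms(4)]
    by (auto simp: admissible_def distinct_adj_append_iff last_map u'_def)
  from free_admissible[OF this] free_admissible[OF assms(1,2)]
  show ?thesis
    by (simp add: u'_def algebra_simps phi_diff[OF phi] phi_scaleC[OF phi] mult_scaleC_right)
qed

text \<open>Every term of \<open>D a b\<close> has a factor \<open>\<phi> (a * u)\<close>, where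
  \<open>u\<close> is what precedes the differentiated letter.\<close>

lemma derives_zero_left:
  assumes "derives \<phi> \<kappa> T P D" "\<And>u. u \<in> unital_subalgebra T \<Longrightarrow> \<phi> (a * u) = 0"
  shows "D a b = 0"
  using assms
proof (induction arbitrary: a b rule: derives.induct)
  case (gen y)
  from gen(2)[OF unital_subalgebra.one] show ?case by simp
next
  case (mult P D Q E)
  have "\<phi> (a * P * u) = 0" if "u \<in> unital_subalgebra T" for u
    using mult.prems[of "P * u"] that derives_unital_subalgebra[OF mult.hyps(1)]
    by (auto simp: mult.assoc intro: unital_subalgebra.mult)
  then have "E (a * P) b = 0" by (rule mult.IH(2))
  moreover have "D a (Q * b) = 0" by (rule mult.IH(1)[OF mult.prems])
  ultimately show ?case by simp
next
  case (add P D Q E)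
  from add.IH(1)[OF add.prems] add.IH(2)[OF add.prems] show ?case by simp
next
  case (scale P D c)
  from scale.IH[OF scale.prems] show ?case by simp
qed simp

lemma derives_zero_right:
  assumes "derives \<phi> \<kappa> T P D" "\<And>u. u \<in> unital_subalgebra T \<Longrightarrow> \<phi> (u * b) = 0"
  shows "D a b = 0"
  using assms
proof (induction arbitrary: a b rule: derives.induct)
  case (gen y)
  from gen(2)[OF unital_subalgebra.one] show ?case by simp
next
  case (mult P D Q E)
  have "\<phi> (u * (Q * b)) = 0" if "u \<in> unital_subalgebra T" for u
    using mult.prems[of "u * Q"] that derives_unital_subalgebra[OF mult.hyps(2)]
    by (auto simp: mult.assoc intro: unital_subalgebra.mult)
  then have "D a (Q * b) = 0" by (rule mult.IH(1))
  moreover have "E (a * P) b = 0" by (rule mult.IH(2)[OF mult.prems])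
  ultimately show ?case by simp
next
  case (add P D Q E)
  from add.IH(1)[OF add.prems] add.IH(2)[OF add.prems] show ?case by simp
next
  case (scale P D c)
  from scale.IH[OF scale.prems] show ?case by simp
qed simp

context
  fixes x :: 'a and k0 :: 'i
  assumes k0: "k0 \<in> I" and x: "x \<in> S k0" and wick_x: "wick \<phi> (S k0) x" and phi_x: "\<phi> x = 0"
begin

abbreviation (input) derives_in where "derives_in k \<equiv> derives \<phi> (\<lambda>y. \<phi> (x * y)) (S k)"

lemma phi_mult_other:
  assumes "k \<in> I" "k \<noteq> k0" "u \<in> unital_subalgebra (S k)"
  shows "\<phi> (x * u) = 0"
  using free_admissible_right[of "[(k0, x)]" k u] assms k0 x phi_x
  by (auto simp: admissible_def unital_subalgebra.gen)

text \<open>For a family other than that of \<open>x\<close>, freeness makes \<open>x\<close>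
  uncorrelated with each letter and with the whole word, so both sides are 0.\<close>

lemma wick_other:
  assumes "k \<in> I"
  shows "wick \<phi> (S k) x"
proof (cases "k = k0")
  case False
  have "schwinger_dyson \<phi> x (map (letter \<phi> (\<lambda>y. \<phi> (x * y))) ys)" if ys: "ys \<in> lists (S k)" for ys
  proof -
    have "prod_list ys \<in> unital_subalgebra (S k)"
      using ys by (induction ys) (auto intro: unital_subalgebra.intros)
    moreover have "leib a (map (letter \<phi> (\<lambda>y. \<phi> (x * y))) ys) b = 0" for a b
      using ys
    proof (induction ys arbitrary: a)
      case (Cons y ys)
      then have "\<phi> (x * y) = 0"
        using phi_mult_other[OF assms False, of y] by (auto intro: unital_subalgebra.gen)
      with Cons show ?case by (simp add: letter_def)
    qed simp
    ultimately show ?thesis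
      using phi_mult_other[OF assms False] by (simp add: schwinger_dyson_def)
  qed
  then show ?thesis by (simp add: wick_def)
qed (use wick_x in simp)

definition labelled :: "('i \<times> 'a \<times> ('a \<Rightarrow> 'a \<Rightarrow> complex)) list \<Rightarrow> bool" where
  "labelled ls \<longleftrightarrow> (\<forall>(k, P, D)\<in>set ls. k \<in> I \<and> derives_in k P D)"

abbreviation (input) forget where "forget ls \<equiv> map (\<lambda>(k, P, D). (k, P)) ls"

lemma map_fst_forget: "map fst (forget ws) = map fst ws"
  and map_snd_forget: "map snd (forget ws) = map (fst \<circ> snd) ws"
  by (induction ws) auto

text \<open>A term of the Leibniz rule cuts the product inside one factor. With two or more factors,
  a non-empty alternating centered product remains on one side of the cut, next to an element of the
  algebra of the cut factor, and freeness annihilates it.\<close>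

lemma leib_admissible:
  assumes "labelled (us @ vs)" "admissible (forget (us @ vs))" "length (us @ vs) \<ge> 2"
  shows "leib (prod_list (map (fst \<circ> snd) us)) (map snd vs) 1 = 0"
  using assms
proof (induction vs arbitrary: us)
  case (Cons v vs)
  obtain k P D where v: "v = (k, P, D)" by (cases v)
  have kI: "k \<in> I" and der: "derives_in k P D" using Cons.prems v by (auto simp: labelled_def)
  have adj: "distinct_adj (map fst (us @ v # vs))"
    using Cons.prems(2) unfolding admissible_def map_fst_forget by simp
  have adm: "admissible (forget us)" "admissible (forget vs)"
    using Cons.prems(2) adj unfolding admissible_def map_fst_forget
    by (auto simp: distinct_adj_append_iff distinct_adj_Cons)
  have "D (prod_list (map (fst \<circ> snd) us)) (prod_list (map (fst \<circ> snd) vs)) = 0"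
  proof (cases "us = []")
    case False
    have "fst (last us) \<noteq> k"
      using adj False by (auto simp: distinct_adj_append_iff v last_map)
    moreover have "fst (last (forget us)) = fst (last us)"
      using False by (simp add: last_map split: prod.splits)
    ultimately have "\<phi> (prod_list (map snd (forget us)) * u) = 0"
      if "u \<in> unital_subalgebra (S k)" for u
      using False that kI adm by (intro free_admissible_right) auto
    then show ?thesis
      unfolding map_snd_forget by (intro derives_zero_left[OF der]) auto
  next
    case True
    then have "vs \<noteq> []" using Cons.prems(3) by auto
    have "fst (hd vs) \<noteq> k"
      using adj \<open>vs \<noteq> []\<close> by (auto simp: distinct_adj_append_iff v distinct_adj_Cons hd_map)
    moreover have "fst (hd (forget vs)) = fst (hd vs)"
      using \<open>vs \<noteq> []\<close> by (simp add: hd_map split: prod.splits)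
    ultimately have "\<phi> (u * prod_list (map snd (forget vs))) = 0"
      if "u \<in> unital_subalgebra (S k)" for u
      using \<open>vs \<noteq> []\<close> that kI adm by (intro free_admissible_left) auto
    then show ?thesis
      unfolding map_snd_forget by (intro derives_zero_right[OF der]) auto
  qed
  moreover have "leib (prod_list (map (fst \<circ> snd) (us @ [v]))) (map snd vs) 1 = 0"
    using Cons.prems by (intro Cons.IH) auto
  ultimately show ?case by (simp add: v comp_def)
qed simp

lemma schwinger_dyson_admissible:
  assumes "labelled ls" "admissible (forget ls)"
  shows "schwinger_dyson \<phi> x (map snd ls)"
proof (cases "length ls \<ge> 2")
  case True
  then obtain k P D rest where ls: "ls = (k, P, D) # rest" and "rest \<noteq> []"
    by (cases ls) (auto simp: Suc_le_eq)
  have leib: "leib 1 (map snd ls) 1 = 0"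
    using leib_admissible[of "[]" ls] assms True by simp
  have hd_forget: "fst (hd (forget ws)) = fst (hd ws)" if "ws \<noteq> []" for ws :: "('i \<times> 'a \<times> ('a \<Rightarrow> 'a \<Rightarrow> complex)) list"
    using that by (simp add: hd_map split: prod.splits)
  have P: "P \<in> unital_subalgebra (S k)"
    using assms(1) by (auto simp: labelled_def ls intro: derives_unital_subalgebra)
  have "\<phi> (x * prod_list (map snd (forget ls))) = 0"
  \<comment> \<open>If the first factor comes from the family of \<open>x\<close>, then
    \<open>x * P\<close> acts as the uncentered factor on the left.\<close>
  proof (cases "k = k0")
    case True
    have "admissible (forget rest)" "fst (hd (forget rest)) \<noteq> k0"
      using assms(2) \<open>rest \<noteq> []\<close> True
      by (auto simp: ls admissible_def distinct_adj_Cons hd_map)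
    moreover have "x * P \<in> unital_subalgebra (S k0)"
      using P x True by (auto intro: unital_subalgebra.intros)
    ultimately have "\<phi> ((x * P) * prod_list (map snd (forget rest))) = 0"
      using \<open>rest \<noteq> []\<close> k0 by (intro free_admissible_left) auto
    then show ?thesis by (simp add: ls mult.assoc)
  next
    case False
    then show ?thesis
      using assms(2) k0 x by (intro free_admissible_left) (auto simp: ls intro: unital_subalgebra.gen)
  qed
  then show ?thesis unfolding map_snd_forget schwinger_dyson_def by (simp add: leib)
next
  case False
  then consider "ls = []" | k P D where "ls = [(k, P, D)]"
    by (cases ls; cases "tl ls") auto
  then show ?thesis
  proof cases
    case 1
    then show ?thesis by (simp add: schwinger_dyson_def phi_x)
  next
    case (2 k P D)
    with assms(1) have "k \<in> I" "derives_in k P D" by (auto simp: labelled_def)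
    from wick_derives[OF wick_other[OF this(1)] this(2)] show ?thesis
      by (simp add: 2 schwinger_dyson_def)
  qed
qed

lemma bilin_leib_labelled:
  assumes "labelled ls"
  shows "bilin (\<lambda>a b. leib a (map snd ls) b)"
  using assms by (intro bilin_leib) (force simp: labelled_def dest: bilin_derives)

text \<open>Neighbours from the same family are merged; otherwise the factors are centered one after the
  other. Both steps reduce to shorter lists or to alternating centered products, on which both
  sides vanish by freeness unless the product has a single factor.\<close>

lemma schwinger_dyson_labelled: "labelled ls \<Longrightarrow> schwinger_dyson \<phi> x (map snd ls)"
proof (induction "length ls" arbitrary: ls rule: less_induct)
  case less
  show ?case
  proof (cases "distinct_adj (map fst ls)")
    case False
    then obtain i where i: "Suc i < length ls" "fst (ls ! i) = fst (ls ! Suc i)"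
      by (auto simp: distinct_adj_conv_nth)
    obtain k P D where p: "ls ! i = (k, P, D)" by (cases "ls ! i")
    obtain Q E where q: "ls ! Suc i = (k, Q, E)" using i p by (cases "ls ! Suc i") auto
    define pre post where "pre = take i ls" and "post = drop (Suc (Suc i)) ls"
    have ls: "ls = pre @ (k, P, D) # (k, Q, E) # post"
      using i p q id_take_nth_drop[of i ls] Cons_nth_drop_Suc[of "Suc i" ls] by (simp add: pre_def post_def)
    define ls' where "ls' = pre @ (k, P * Q, \<lambda>a b. D a (Q * b) + E (a * P) b) # post"
    have "labelled ls'"
      using less.prems by (auto simp: ls ls'_def labelled_def intro: derives.mult)
    then have "schwinger_dyson \<phi> x (map snd ls')"
      by (intro less.hyps) (simp_all add: ls ls'_def)
    then show ?thesis by (simp add: ls ls'_def schwinger_dyson_mult)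
  next
    case True
    have "schwinger_dyson \<phi> x (map snd (pre @ post))"
      if "labelled (pre @ post)" "distinct_adj (map fst (pre @ post))" "length (pre @ post) = length ls"
        "\<forall>(k, P, D)\<in>set pre. \<phi> P = 0" for pre post
      using that
    proof (induction post arbitrary: pre)
      case Nil
      have "P \<in> unital_subalgebra (S k)" if "(k, P, D) \<in> set pre" for k P D
        using that Nil.prems(1) by (auto simp: labelled_def intro: derives_unital_subalgebra)
      moreover have "k \<in> I \<and> \<phi> P = 0" if "(k, P, D) \<in> set pre" for k P D
        using that Nil.prems(1,4) by (auto simp: labelled_def)
      ultimately have "admissible (forget pre)"
        using Nil.prems(2) unfolding admissible_def map_fst_forget by auto
      with Nil.prems show ?case by (simp add: schwinger_dyson_admissible)
    next
      case (Cons v post)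
      obtain k P D where v: "v = (k, P, D)" by (cases v)
      \<comment> \<open>\<open>D\<close> also serves \<open>P'\<close>, as scalars have derivative
        0. What is subtracted is \<open>\<phi> P\<close> times the list without this factor, which
        is shorter.\<close>
      define P' where "P' = P + (- \<phi> P) *\<^sub>C 1"
      have der: "derives_in k P D" and k: "k \<in> I" using Cons.prems(1) v by (auto simp: labelled_def)
      have der': "derives_in k P' D"
        unfolding P'_def
        by (rule derives_cong[OF derives.add[OF der derives.scale[OF derives.one, where c = "- \<phi> P"]]]) auto
      have phi_P': "\<phi> P' = 0" by (simp add: P'_def phi_diff[OF phi] phi_scaleC[OF phi] phi_one[OF phi])
      have lab: "labelled pre" "labelled post" using Cons.prems(1) by (auto simp: labelled_def)
      have "schwinger_dyson \<phi> x (map snd ((pre @ [(k, P', D)]) @ post))"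
        using Cons.prems der' k lab phi_P' by (intro Cons.IH) (auto simp: labelled_def v)
      then have 1: "schwinger_dyson \<phi> x (map snd pre @ (P', D) # map snd post)" by simp
      have "schwinger_dyson \<phi> x (map snd (pre @ post))"
        using Cons.prems by (intro less.hyps) (auto simp: labelled_def)
      then have 2: "schwinger_dyson \<phi> x (map snd pre @ (1, \<lambda>a b. 0) # map snd post)"
        by (simp add: schwinger_dyson_one)
      note bil = bilin_leib_labelled[OF lab(1)] bilin_leib_labelled[OF lab(2)]
      from schwinger_dyson_add[OF bil 1 schwinger_dyson_scale[OF bil 2, of "\<phi> P"]]
      show ?case by (simp add: v P'_def)
    qed
    from this[of "[]" ls] show ?thesis using less.prems True by simp
  qed
qed

theorem wick_free_aux: "wick \<phi> (\<Union>k\<in>I. S k) x"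
  unfolding wick_def
proof
  fix ys assume ys: "ys \<in> lists (\<Union>k\<in>I. S k)"
  \<comment> \<open>The sets \<open>S k\<close> may overlap; any family containing a letter can
    label it.\<close>
  define f where "f y = (SOME k. k \<in> I \<and> y \<in> S k)" for y
  have f: "f y \<in> I \<and> y \<in> S (f y)" if "y \<in> set ys" for y
    unfolding f_def by (rule someI_ex) (use that ys in blast)
  define ls where "ls = map (\<lambda>y. (f y, letter \<phi> (\<lambda>y. \<phi> (x * y)) y)) ys"
  have "labelled ls"
    using f by (auto simp: labelled_def ls_def letter_def intro: derives.gen)
  from schwinger_dyson_labelled[OF this]
  show "schwinger_dyson \<phi> x (map (letter \<phi> (\<lambda>y. \<phi> (x * y))) ys)"
    by (simp add: ls_def comp_def)
qed

end

end

lemma wick_free: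
  assumes "free_sets \<phi> I S" "\<And>k y. k \<in> I \<Longrightarrow> y \<in> S k \<Longrightarrow> \<phi> y = 0"
    and "\<And>k y. k \<in> I \<Longrightarrow> y \<in> S k \<Longrightarrow> wick \<phi> (S k) y"
    and "x \<in> (\<Union>k\<in>I. S k)"
  shows "wick \<phi> (\<Union>k\<in>I. S k) x"
  using assms(4) wick_free_aux[OF assms(1)] assms(2,3) by blast

end

section \<open>Moments of the semicircle distribution\<close>

text \<open>The integrand is the derivative of \<open>F\<close>, which vanishes at both ends. The
  square root is not differentiable there, so \<open>F\<close> is differentiated in the interior
  only. At \<open>m = 0\<close> the truncated exponent \<open>m - 1\<close> has coefficient
  0.\<close>

lemma semicircle_by_parts:
  fixes \<sigma> :: real
  assumes "\<sigma> > 0"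
  shows "((\<lambda>t. (real m * (4 * \<sigma>\<^sup>2) * t ^ (m - 1) - real (m + 3) * t ^ (m + 1)) *
    (sqrt (4 * \<sigma>\<^sup>2 - t\<^sup>2) / (2 * pi * \<sigma>\<^sup>2))) has_integral 0) {- 2 * \<sigma>..2 * \<sigma>}"
proof -
  define F where "F t = t ^ m * (4 * \<sigma>\<^sup>2 - t\<^sup>2) * (sqrt (4 * \<sigma>\<^sup>2 - t\<^sup>2) / (2 * pi * \<sigma>\<^sup>2))" for t
  have "((\<lambda>t. (real m * (4 * \<sigma>\<^sup>2) * t ^ (m - 1) - real (m + 3) * t ^ (m + 1)) *
    (sqrt (4 * \<sigma>\<^sup>2 - t\<^sup>2) / (2 * pi * \<sigma>\<^sup>2))) has_integral F (2 * \<sigma>) - F (- 2 * \<sigma>)) {- 2 * \<sigma>..2 * \<sigma>}"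
  proof (rule fundamental_theorem_of_calculus_interior)
    show "- 2 * \<sigma> \<le> 2 * \<sigma>" using assms by simp
    show "continuous_on {- 2 * \<sigma>..2 * \<sigma>} F"
      unfolding F_def using assms by (intro continuous_intros) auto
    fix t assume t: "t \<in> {- 2 * \<sigma><..<2 * \<sigma>}"
    define u where "u = 4 * \<sigma>\<^sup>2 - t\<^sup>2"
    have "\<bar>t\<bar> < 2 * \<sigma>" using t by auto
    then have "t\<^sup>2 < (2 * \<sigma>)\<^sup>2" using power_strict_mono[of "\<bar>t\<bar>" "2 * \<sigma>" 2] by simp
    then have u: "u > 0" by (simp add: u_def power_mult_distrib)
    then have su: "sqrt u * sqrt u = u" "u * inverse (sqrt u) = sqrt u"
      by (simp_all add: field_simps)
    have d1: "((\<lambda>t. t ^ m * (4 * \<sigma>\<^sup>2 - t\<^sup>2)) has_field_derivative (real m * t ^ (m - 1)) * u + t ^ m * (- 2 * t)) (at t)"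
      unfolding u_def by (auto intro!: derivative_eq_intros)
    have d2: "((\<lambda>t. sqrt (4 * \<sigma>\<^sup>2 - t\<^sup>2) / (2 * pi * \<sigma>\<^sup>2)) has_field_derivative
        (inverse (sqrt u) / 2 * (- 2 * t)) / (2 * pi * \<sigma>\<^sup>2)) (at t)"
      unfolding u_def
      by (rule DERIV_cdivide, rule DERIV_chain2[OF DERIV_real_sqrt])
        (use u in \<open>auto simp: u_def intro!: derivative_eq_intros\<close>)
    have "(F has_field_derivative
       ((real m * t ^ (m - 1)) * u + t ^ m * (- 2 * t)) * (sqrt u / (2 * pi * \<sigma>\<^sup>2)) +
       t ^ m * u * ((inverse (sqrt u) / 2 * (- 2 * t)) / (2 * pi * \<sigma>\<^sup>2))) (at t)"
      unfolding F_def using DERIV_mult[OF d1 d2] by (simp only: u_def add.commute mult.commute mult.left_commute)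
    also have "((real m * t ^ (m - 1)) * u + t ^ m * (- 2 * t)) * (sqrt u / (2 * pi * \<sigma>\<^sup>2)) +
       t ^ m * u * ((inverse (sqrt u) / 2 * (- 2 * t)) / (2 * pi * \<sigma>\<^sup>2)) =
       ((real m * t ^ (m - 1)) * u + t ^ m * (- 2 * t)) * (sqrt u / (2 * pi * \<sigma>\<^sup>2)) +
       t ^ m * (- t) * ((u * inverse (sqrt u)) / (2 * pi * \<sigma>\<^sup>2))"
      by simp
    also have "\<dots> = ((real m * t ^ (m - 1)) * u - 3 * t ^ (m + 1)) * (sqrt u / (2 * pi * \<sigma>\<^sup>2))"
      unfolding su(2) by (simp add: algebra_simps)
    also have "(real m * t ^ (m - 1)) * u - 3 * t ^ (m + 1) =
        real m * (4 * \<sigma>\<^sup>2) * t ^ (m - 1) - real (m + 3) * t ^ (m + 1)"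
      by (cases m) (simp_all add: u_def algebra_simps power2_eq_square)
    finally show "(F has_vector_derivative (real m * (4 * \<sigma>\<^sup>2) * t ^ (m - 1) - real (m + 3) * t ^ (m + 1)) *
        (sqrt (4 * \<sigma>\<^sup>2 - t\<^sup>2) / (2 * pi * \<sigma>\<^sup>2))) (at t)"
      by (simp add: u_def has_real_derivative_iff_has_vector_derivative)
  qed
  then show ?thesis by (simp add: F_def)
qed

lemma semicircle_moment_step:
  fixes \<sigma> :: real
  assumes "\<sigma> > 0"
  defines "I \<equiv> \<lambda>n. integral {- 2 * \<sigma>..2 * \<sigma>} (\<lambda>t. t ^ n * (sqrt (4 * \<sigma>\<^sup>2 - t\<^sup>2) / (2 * pi * \<sigma>\<^sup>2)))"
  shows "I 1 = 0" "real (n + 4) * I (n + 2) = 4 * \<sigma>\<^sup>2 * real (n + 1) * I n"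
proof -
  have int: "((\<lambda>t. t ^ n * (sqrt (4 * \<sigma>\<^sup>2 - t\<^sup>2) / (2 * pi * \<sigma>\<^sup>2))) has_integral I n) {- 2 * \<sigma>..2 * \<sigma>}" for n
    unfolding I_def using assms
    by (intro integrable_integral integrable_continuous_interval continuous_intros) auto
  have *: "real m * (4 * \<sigma>\<^sup>2) * I (m - 1) - real (m + 3) * I (m + 1) = 0" for m
  proof (rule has_integral_unique[OF _ semicircle_by_parts[OF assms(1), of m]])
    have "((\<lambda>t. real m * (4 * \<sigma>\<^sup>2) * (t ^ (m - 1) * (sqrt (4 * \<sigma>\<^sup>2 - t\<^sup>2) / (2 * pi * \<sigma>\<^sup>2))) -
        real (m + 3) * (t ^ (m + 1) * (sqrt (4 * \<sigma>\<^sup>2 - t\<^sup>2) / (2 * pi * \<sigma>\<^sup>2))))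
        has_integral real m * (4 * \<sigma>\<^sup>2) * I (m - 1) - real (m + 3) * I (m + 1)) {- 2 * \<sigma>..2 * \<sigma>}"
      by (intro has_integral_diff has_integral_mult_right int)
    then show "((\<lambda>t. (real m * (4 * \<sigma>\<^sup>2) * t ^ (m - 1) - real (m + 3) * t ^ (m + 1)) *
        (sqrt (4 * \<sigma>\<^sup>2 - t\<^sup>2) / (2 * pi * \<sigma>\<^sup>2)))
        has_integral real m * (4 * \<sigma>\<^sup>2) * I (m - 1) - real (m + 3) * I (m + 1)) {- 2 * \<sigma>..2 * \<sigma>}"
      by (simp only: left_diff_distrib mult.assoc)
  qed
  from *[of 0] show "I 1 = 0" by simp
  from *[of "n + 1"] show "real (n + 4) * I (n + 2) = 4 * \<sigma>\<^sup>2 * real (n + 1) * I n"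
    by (simp add: algebra_simps numeral_eq_Suc)
qed

text \<open>The weights \<open>j + 2\<close> in a convolution of \<open>m\<close> with itself can be symmetrised; on the other hand
  the two-term recursion shifts the weighted convolution by two steps.\<close>

lemma semicircle_moment_convolution:
  fixes m :: "nat \<Rightarrow> real"
  assumes m0: "m 0 = 1" and m1: "m 1 = 0"
    and step: "\<And>n. real (n + 4) * m (n + 2) = 4 * v * real (n + 1) * m n"
  shows "m (n + 2) = v * (\<Sum>j\<le>n. m j * m (n - j))"
proof (induction n rule: less_induct)
  case (less n)
  have sym: "2 * (\<Sum>j\<le>k. (real j + c) * (m j * m (k - j))) = (real k + 2 * c) * (\<Sum>j\<le>k. m j * m (k - j))" for k c
  proof -
    have "(\<Sum>j\<le>k. (real j + c) * (m j * m (k - j))) = (\<Sum>j\<le>k. (real (k - j) + c) * (m (k - j) * m j))"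
      by (rule sum.reindex_bij_witness[of _ "\<lambda>j. k - j" "\<lambda>j. k - j"]) auto
    then have "2 * (\<Sum>j\<le>k. (real j + c) * (m j * m (k - j))) =
        (\<Sum>j\<le>k. (real j + c) * (m j * m (k - j)) + (real (k - j) + c) * (m (k - j) * m j))"
      by (simp add: sum.distrib)
    also have "\<dots> = (\<Sum>j\<le>k. (real k + 2 * c) * (m j * m (k - j)))"
      by (intro sum.cong) (auto simp: of_nat_diff algebra_simps)
    finally show ?thesis by (simp add: sum_distrib_left)
  qed
  \<comment> \<open>The weight \<open>j + 2\<close> fits twice: shifted by two it is the
    \<open>j + 4\<close> of \<open>step\<close>, and symmetrised it yields the factor
    \<open>n + 4\<close> of the claim.\<close>
  have T: "(\<Sum>j\<le>n. (real j + 2) * (m j * m (n - j))) = 2 * (real n + 1) * m n"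
  proof -
    consider "n = 0" | "n = 1" | k where "n = k + 2"
      by (metis One_nat_def Suc_1 add.commute add_2_eq_Suc not0_implies_Suc)
    then show ?thesis
    proof cases
      case (3 k)
      have "(\<Sum>j\<le>n. (real j + 2) * (m j * m (n - j))) = 2 * m n + (\<Sum>j\<le>k. (real j + 4) * (m (j + 2) * m (k - j)))"
        unfolding 3 add_2_eq_Suc' sum.atMost_Suc_shift using m0 m1 by (simp add: algebra_simps)
      also have "(\<Sum>j\<le>k. (real j + 4) * (m (j + 2) * m (k - j))) = (\<Sum>j\<le>k. 4 * v * ((real j + 1) * (m j * m (k - j))))"
      proof (rule sum.cong[OF refl])
        fix j
        have "(real j + 4) * m (j + 2) = 4 * v * (real j + 1) * m j"
          using step[of j] by (simp add: add.commute)
        then show "(real j + 4) * (m (j + 2) * m (k - j)) = 4 * v * ((real j + 1) * (m j * m (k - j)))"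
          by (simp only: mult.assoc[symmetric])
      qed
      also have "\<dots> = 2 * v * (2 * (\<Sum>j\<le>k. (real j + 1) * (m j * m (k - j))))"
        by (simp add: sum_distrib_left mult.assoc)
      also have "\<dots> = 2 * (real k + 2) * (v * (\<Sum>j\<le>k. m j * m (k - j)))" unfolding sym by simp
      also have "v * (\<Sum>j\<le>k. m j * m (k - j)) = m n" using less[of k] 3 by simp
      finally show ?thesis by (simp add: 3 algebra_simps)
    qed (use m0 m1 in auto)
  qed
  have "(real n + 4) * m (n + 2) = v * (2 * (2 * (real n + 1) * m n))" using step[of n] by (simp add: algebra_simps)
  also have "\<dots> = (real n + 4) * (v * (\<Sum>j\<le>n. m j * m (n - j)))" using sym[of 2 n] T by simp
  finally show ?case by (simp add: add_nonneg_eq_0_iff)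
qed

lemma leib_replicate:
  "leib (s ^ j) (map (letter \<phi> \<kappa>) (replicate n s)) 1 = (\<Sum>i<n. \<kappa> s * \<phi> (s ^ (j + i)) * \<phi> (s ^ (n - 1 - i)))"
proof (induction n arbitrary: j)
  case (Suc n)
  have "leib (s ^ j * s) (map (letter \<phi> \<kappa>) (replicate n s)) 1 = (\<Sum>i<n. \<kappa> s * \<phi> (s ^ (Suc j + i)) * \<phi> (s ^ (n - 1 - i)))"
    using Suc[of "Suc j"] by (simp add: power_commutes)
  then show ?case
    by (subst sum.lessThan_Suc_shift) (simp add: letter_def prod_list_replicate)
qed simp

section \<open>Wick formula for semicircular, circular and free circular families\<close>

context
  fixes \<phi> :: "'a::cstar_algebra \<Rightarrow> complex"
  assumes phi: "cstar_prob_space \<phi>"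
begin

lemma wick_semicircular:
  assumes "semicircular \<phi> s"
  shows "wick \<phi> {s} s" "\<phi> s = 0"
proof -
  obtain \<sigma> :: real where \<sigma>: "\<sigma> > 0" and mom: "\<And>n. \<phi> (s ^ n) = complex_of_real
           (integral {- 2 * \<sigma>..2 * \<sigma>}
              (\<lambda>t. t ^ n * (sqrt (4 * \<sigma>\<^sup>2 - t\<^sup>2) / (2 * pi * \<sigma>\<^sup>2))))"
    using assms by (auto simp: semicircular_def)
  define m where "m n = integral {- 2 * \<sigma>..2 * \<sigma>}
    (\<lambda>t. t ^ n * (sqrt (4 * \<sigma>\<^sup>2 - t\<^sup>2) / (2 * pi * \<sigma>\<^sup>2)))" for n
  have phi_m: "\<phi> (s ^ n) = complex_of_real (m n)" for n by (simp add: mom m_def)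
  \<comment> \<open>The total mass is read off from \<open>\<phi> 1 = 1\<close> instead of being
    integrated.\<close>
  have m0: "m 0 = 1" using phi_m[of 0] phi_one[OF phi] by simp
  have m1: "m 1 = 0" unfolding m_def by (rule semicircle_moment_step(1)[OF \<sigma>])
  have step: "real (n + 4) * m (n + 2) = 4 * \<sigma>\<^sup>2 * real (n + 1) * m n" for n
    unfolding m_def by (rule semicircle_moment_step(2)[OF \<sigma>])
  note conv = semicircle_moment_convolution[of m, OF m0 m1 step]
  have m2: "m 2 = \<sigma>\<^sup>2" using conv[of 0] m0 by (simp add: numeral_2_eq_2)
  show phi_s: "\<phi> s = 0" using phi_m[of 1] m1 by simp
  have "schwinger_dyson \<phi> s (map (letter \<phi> (\<lambda>y. \<phi> (s * y))) (replicate n s))" for n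
  proof -
    have l: "leib 1 (map (letter \<phi> (\<lambda>y. \<phi> (s * y))) (replicate n s)) 1 =
        (\<Sum>i<n. \<phi> (s ^ 2) * \<phi> (s ^ i) * \<phi> (s ^ (n - 1 - i)))"
      using leib_replicate[of s 0] by (simp add: power2_eq_square)
    have "\<phi> (s ^ Suc n) = (\<Sum>i<n. \<phi> (s ^ 2) * \<phi> (s ^ i) * \<phi> (s ^ (n - 1 - i)))"
    proof (cases n)
      case (Suc k)
      have "\<phi> (s ^ Suc n) = complex_of_real (\<sigma>\<^sup>2 * (\<Sum>j\<le>k. m j * m (k - j)))"
        unfolding phi_m Suc using conv[of k] by simp
      then show ?thesis unfolding phi_m m2
        by (simp add: Suc lessThan_Suc_atMost sum_distrib_left mult.assoc)
    qed (simp add: phi_s)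
    then show ?thesis unfolding schwinger_dyson_def l by (simp add: prod_list_replicate letter_def)
  qed
  moreover have "ys = replicate (length ys) s" if "ys \<in> lists {s}" for ys
    by (rule replicate_length_same[symmetric]) (use that in auto)
  ultimately show "wick \<phi> {s} s" unfolding wick_def by metis
qed

text \<open>\<open>c\<close> and \<open>star c\<close> are combinations of two free semicircular
  elements; the Wick formula is linear in \<open>x\<close> and extends from two letters to their
  span.\<close>

lemma wick_circular:
  assumes "circular \<phi> c" "y \<in> {c, star c}"
  shows "wick \<phi> {c, star c} y"
proof -
  obtain s t where st: "semicircular \<phi> s" "semicircular \<phi> t"
    and free: "free_sets \<phi> (UNIV :: bool set) (\<lambda>b. if b then {s} else {t})"
    and c: "c = complex_of_real (1 / sqrt 2) *\<^sub>C (s + \<i> *\<^sub>C t)"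
    using assms(1) by (auto simp: circular_def)
  define r where "r = complex_of_real (1 / sqrt 2)"
  have sa: "star s = s" "star t = t" using st by (auto simp: semicircular_def)
  have c1: "c = r *\<^sub>C s + (r * \<i>) *\<^sub>C t"
    by (simp add: c r_def scaleC_add_right scaleC_scaleC)
  have c2: "star c = r *\<^sub>C s + (- r * \<i>) *\<^sub>C t"
    by (simp add: c1 star_add star_scaleC sa) (simp add: r_def)
  have union: "(\<Union>b\<in>UNIV. if b then {s} else {t}) = {s, t}" by (auto split: if_splits)
  have "wick \<phi> {s, t} x" if "x \<in> {s, t}" for x
  proof -
    have "wick \<phi> (\<Union>b\<in>UNIV. if b then {s} else {t}) x"
    proof (rule wick_free[OF phi free])
      fix b :: bool and y assume "y \<in> (if b then {s} else {t})"
      then show "\<phi> y = 0" "wick \<phi> (if b then {s} else {t}) y"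
        using wick_semicircular[OF st(1)] wick_semicircular[OF st(2)] by (cases b; simp)+
    qed (use that union in simp)
    then show ?thesis unfolding union .
  qed
  then have "wick \<phi> {s, t} (\<alpha> *\<^sub>C s + \<beta> *\<^sub>C t)" for \<alpha> \<beta> by (intro wick_linear[OF phi]) auto
  then have "wick \<phi> {s, t} y" using assms(2) c1 c2 by (metis insertE singletonD)
  from wick_span_pair[OF phi this] show ?thesis
    by (rule wick_mono) (use c1 c2 in blast)
qed

lemma wick_free_circular_family:
  assumes "free_circular_family \<phi> X"
  shows "wick \<phi> {X $ k $ l |k l. True} (X $ i $ j)"
proof -
  \<comment> \<open>The index set only has \<open>i \<le> j\<close>; entries below the diagonal
    enter as adjoints.\<close>
  define S where "S = (\<lambda>(i, j). {X $ i $ j, star (X $ i $ j)})"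
  have adj: "adjoint_matrix X = X" and semi: "\<And>i. semicircular \<phi> (X $ i $ i)"
    and circ: "\<And>i j. i < j \<Longrightarrow> circular \<phi> (X $ i $ j)"
    and free: "free_sets \<phi> {(i, j). i \<le> j} S" and cent: "\<And>i j. \<phi> (X $ i $ j) = 0"
    using assms by (auto simp: free_circular_family_def S_def)
  have star_X: "star (X $ i $ j) = X $ j $ i" for i j
    using arg_cong[OF adj, of "\<lambda>Y. Y $ j $ i"] by (simp add: adjoint_matrix_def)
  have "wick \<phi> (S p) y" if pI: "p \<in> {(i, j). i \<le> j}" and y: "y \<in> S p" for p y
  proof -
    obtain k l where p: "p = (k, l)" "k \<le> l" using pI by auto
    show ?thesis
    proof (cases "k = l")
      case True
      then have "S p = {X $ k $ k}" by (simp add: S_def p star_X)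
      then show ?thesis using wick_semicircular(1)[OF semi] y by auto
    next
      case False
      then show ?thesis
        using wick_circular[OF circ[of k l]] y p by (simp add: S_def)
    qed
  qed
  moreover have "\<phi> y = 0" if "y \<in> S p" for p y
    using that by (auto simp: S_def star_X cent)
  moreover have mem: "X $ k $ l \<in> (\<Union>p\<in>{(i, j). i \<le> j}. S p)" for k l
  proof (cases "k \<le> l")
    case True
    then show ?thesis by (intro UN_I[of "(k, l)"]) (auto simp: S_def)
  next
    case False
    then show ?thesis by (intro UN_I[of "(l, k)"]) (auto simp: S_def star_X)
  qed
  ultimately have "wick \<phi> (\<Union>p\<in>{(i, j). i \<le> j}. S p) (X $ i $ j)"
    by (intro wick_free[OF phi free]) auto
  then show ?thesis by (rule wick_mono) (use mem in auto)
qed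

end

section \<open>Inverses of matrices over a Banach algebra\<close>

lemma matrix_mult_nth: "(A ** B) $ i $ j = (\<Sum>k\<in>UNIV. A $ i $ k * B $ k $ j)"
  by (simp add: matrix_matrix_mult_def)

lemma norm_le_sum_entries:
  fixes A :: "'a::real_normed_vector ^ 'n ^ 'm"
  shows "norm A \<le> (\<Sum>i\<in>UNIV. \<Sum>j\<in>UNIV. norm (A $ i $ j))"
proof -
  have le: "norm x \<le> (\<Sum>i\<in>UNIV. norm (x $ i))" for x :: "'b::real_normed_vector ^ 'k"
    unfolding norm_vec_def by (rule L2_set_le_sum) simp
  have "norm A \<le> (\<Sum>i\<in>UNIV. norm (A $ i))" by (rule le)
  also have "\<dots> \<le> (\<Sum>i\<in>UNIV. \<Sum>j\<in>UNIV. norm (A $ i $ j))" by (intro sum_mono le)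
  finally show ?thesis .
qed

lemma norm_entry_le: "norm (A $ i $ j) \<le> norm (A :: 'a::real_normed_vector ^ 'n ^ 'm)"
  using Finite_Cartesian_Product.norm_nth_le[of "A $ i" j] Finite_Cartesian_Product.norm_nth_le[of A i] by linarith

lemma norm_le_if_entries_le:
  fixes A :: "'a::real_normed_vector ^ 'n ^ 'm"
  assumes "\<And>i j. norm (A $ i $ j) \<le> c"
  shows "norm A \<le> real CARD('m) * real CARD('n) * c"
proof -
  have "norm A \<le> (\<Sum>i\<in>(UNIV::'m set). \<Sum>j\<in>(UNIV::'n set). c)"
    by (rule order_trans[OF norm_le_sum_entries]) (intro sum_mono assms)
  then show ?thesis by (simp add: mult.assoc)
qed

text \<open>One factor \<open>CARD('n)\<close> comes from the sum in each entry, two from counting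
  entries. The constant is crude, but it is fixed.\<close>

lemma norm_matrix_mult_le:
  fixes A B :: "'a::real_normed_algebra_1 ^ 'n ^ 'n"
  shows "norm (A ** B) \<le> norm A * norm B * real CARD('n) ^ 3"
proof -
  have "norm ((A ** B) $ i $ j) \<le> real CARD('n) * (norm A * norm B)" for i j
  proof -
    have "norm ((A ** B) $ i $ j) \<le> (\<Sum>k\<in>UNIV. norm (A $ i $ k * B $ k $ j))"
      unfolding matrix_mult_nth by (rule norm_sum)
    also have "\<dots> \<le> (\<Sum>k\<in>(UNIV::'n set). norm A * norm B)"
      by (intro sum_mono order_trans[OF norm_mult_ineq] mult_mono norm_entry_le) auto
    finally show ?thesis by simp
  qed
  from norm_le_if_entries_le[OF this] show ?thesis
    by (simp add: power3_eq_cube algebra_simps)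
qed

lemma bounded_bilinear_matrix_mult:
  "bounded_bilinear ((**) :: 'a::real_normed_algebra_1 ^ 'n ^ 'n \<Rightarrow> 'a ^ 'n ^ 'n \<Rightarrow> 'a ^ 'n ^ 'n)"
proof (rule bounded_bilinear.intro)
  show "\<exists>K. \<forall>(A::'a ^ 'n ^ 'n) (B::'a ^ 'n ^ 'n). norm (A ** B) \<le> norm A * norm B * K"
    by (intro exI[of _ "real CARD('n) ^ 3"] allI norm_matrix_mult_le)
qed (simp_all add: vec_eq_iff matrix_mult_nth sum.distrib distrib_left distrib_right scaleR_sum_right)

interpretation matrix_mult: bounded_bilinear
  "(**) :: 'a::real_normed_algebra_1 ^ 'n ^ 'n \<Rightarrow> 'a ^ 'n ^ 'n \<Rightarrow> 'a ^ 'n ^ 'n"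
  by (rule bounded_bilinear_matrix_mult)

lemma matrix_inv_unique:
  assumes "A ** B = mat 1" "B ** A = mat 1"
  shows "matrix_inv A = B"
proof -
  have *: "A ** matrix_inv A = mat 1 \<and> matrix_inv A ** A = mat 1"
    unfolding matrix_inv_def by (rule someI_ex) (use assms in blast)
  have "matrix_inv A = matrix_inv A ** (A ** B)" using assms by simp
  also have "\<dots> = B" using * by (simp add: matrix_mul_assoc)
  finally show ?thesis .
qed

lemma matrix_inv_right: "invertible A \<Longrightarrow> A ** matrix_inv A = mat 1"
  and matrix_inv_left: "invertible A \<Longrightarrow> matrix_inv A ** A = mat 1"
  unfolding invertible_def by (metis matrix_inv_unique)+

text \<open>A matrix that is not invertible has the fixed junk inverse \<open>SOME B. False\<close>.\<close>

lemma matrix_inv_not_invertible: "\<not> invertible A \<Longrightarrow> matrix_inv A = (SOME B. False)"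
  unfolding invertible_def matrix_inv_def by (metis (no_types, lifting))

text \<open>Right and left inverse are separate fixed points, as over a noncommutative algebra a
  one-sided inverse of a matrix need not be two-sided.\<close>

lemma invertible_one_minus:
  fixes K :: "'a::{real_normed_algebra_1, banach} ^ 'n ^ 'n"
  assumes "norm K * real CARD('n) ^ 3 < 1"
  shows "invertible (mat 1 - K)"
proof -
  let ?c = "norm K * real CARD('n) ^ 3"
  have "\<exists>!Y. mat 1 + K ** Y = Y"
  proof (rule banach_fix_type)
    show "\<forall>Y Z. dist (mat 1 + K ** Y) (mat 1 + K ** Z) \<le> ?c * dist Y Z"
    proof (intro allI)
      fix Y Z
      show "dist (mat 1 + K ** Y) (mat 1 + K ** Z) \<le> ?c * dist Y Z"
        using norm_matrix_mult_le[of K "Y - Z"] by (simp add: dist_norm mult_ac flip: matrix_mult.diff_right)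
    qed
  qed (use assms in auto)
  then obtain Y where Y: "mat 1 + K ** Y = Y" by blast
  have "\<exists>!Z. mat 1 + Z ** K = Z"
  proof (rule banach_fix_type)
    show "\<forall>Y Z. dist (mat 1 + Y ** K) (mat 1 + Z ** K) \<le> ?c * dist Y Z"
    proof (intro allI)
      fix Y Z
      show "dist (mat 1 + Y ** K) (mat 1 + Z ** K) \<le> ?c * dist Y Z"
        using norm_matrix_mult_le[of "Y - Z" K] by (simp add: dist_norm mult_ac flip: matrix_mult.diff_left)
    qed
  qed (use assms in auto)
  then obtain Z where Z: "mat 1 + Z ** K = Z" by blast
  have r: "(mat 1 - K) ** Y = mat 1" using Y by (simp add: matrix_mult.diff_left algebra_simps)
  have l: "Z ** (mat 1 - K) = mat 1" using Z by (simp add: matrix_mult.diff_right algebra_simps)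
  have "Z = Z ** ((mat 1 - K) ** Y)" using r by simp
  also have "\<dots> = Y" using l by (simp add: matrix_mul_assoc)
  finally show ?thesis using r l unfolding invertible_def by blast
qed

text \<open>\<open>B = B0 (1 - R0 (B0 - B))\<close>. The explicit radius is what converts a bound on
  inverses into invertibility at a given distance.\<close>

lemma invertible_perturb:
  fixes B B0 R0 :: "'a::{real_normed_algebra_1, banach} ^ 'n ^ 'n"
  assumes "B0 ** R0 = mat 1" "R0 ** B0 = mat 1"
    and "norm R0 * norm (B0 - B) * (real CARD('n) ^ 3)\<^sup>2 < 1"
  shows "invertible B"
proof -
  have "norm (R0 ** (B0 - B)) * real CARD('n) ^ 3 \<le> (norm R0 * norm (B0 - B) * real CARD('n) ^ 3) * real CARD('n) ^ 3"
    by (intro mult_right_mono norm_matrix_mult_le) auto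
  also have "\<dots> < 1" using assms(3) by (simp add: power2_eq_square mult_ac)
  finally have "invertible (mat 1 - R0 ** (B0 - B))" by (rule invertible_one_minus)
  moreover have "invertible B0" using assms unfolding invertible_def by blast
  ultimately have "invertible (B0 ** (mat 1 - R0 ** (B0 - B)))" by (rule invertible_mult[rotated])
  also have "B0 ** (mat 1 - R0 ** (B0 - B)) = B"
    using assms by (simp add: matrix_mult.diff_right matrix_mul_assoc)
  finally show ?thesis .
qed

lemma open_invertible: "open {B :: 'a::{real_normed_algebra_1, banach} ^ 'n ^ 'n. invertible B}"
  unfolding open_dist
proof (intro ballI, clarify)
  fix B0 :: "'a ^ 'n ^ 'n" assume "invertible B0"
  then obtain R0 where R0: "B0 ** R0 = mat 1" "R0 ** B0 = mat 1" unfolding invertible_def by blast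
  define e where "e = inverse ((norm R0 + 1) * (real CARD('n) ^ 3)\<^sup>2)"
  have pos: "(norm R0 + 1) * (real CARD('n) ^ 3)\<^sup>2 > 0"
    by (intro mult_pos_pos add_nonneg_pos) auto
  then have "e > 0" unfolding e_def by (rule positive_imp_inverse_positive)
  moreover have "invertible B" if "dist B B0 < e" for B
  proof (rule invertible_perturb[OF R0])
    have "norm R0 * norm (B0 - B) * (real CARD('n) ^ 3)\<^sup>2 \<le> (norm R0 + 1) * (real CARD('n) ^ 3)\<^sup>2 * norm (B0 - B)"
      by (simp add: algebra_simps)
    also have "\<dots> < (norm R0 + 1) * (real CARD('n) ^ 3)\<^sup>2 * e"
      using that pos by (intro mult_strict_left_mono) (auto simp: dist_norm norm_minus_commute)
    also have "\<dots> = 1" using pos unfolding e_def by (intro right_inverse) auto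
    finally show "norm R0 * norm (B0 - B) * (real CARD('n) ^ 3)\<^sup>2 < 1" .
  qed
  ultimately show "\<exists>e>0. \<forall>y. dist y B0 < e \<longrightarrow> y \<in> {B. invertible B}" by auto
qed

lemma matrix_inv_diff:
  fixes B B0 :: "'a::real_normed_algebra_1 ^ 'n ^ 'n"
  assumes "invertible B" "invertible B0"
  shows "matrix_inv B - matrix_inv B0 = matrix_inv B ** (B0 - B) ** matrix_inv B0"
proof -
  have "matrix_inv B ** (B0 - B) ** matrix_inv B0 =
      matrix_inv B ** (B0 ** matrix_inv B0) - (matrix_inv B ** B) ** matrix_inv B0"
    by (simp add: matrix_mult.diff_right matrix_mult.diff_left matrix_mul_assoc)
  then show ?thesis using assms by (simp add: matrix_inv_left matrix_inv_right)
qed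

lemma continuous_on_matrix_inv:
  "continuous_on {B :: 'a::{real_normed_algebra_1, banach} ^ 'n ^ 'n. invertible B} matrix_inv"
  unfolding continuous_on_def
proof clarify
  fix B0 :: "'a ^ 'n ^ 'n" assume B0: "invertible B0"
  let ?F = "at B0 within {B. invertible B}"
  define r where "r = norm (matrix_inv B0)"
  define c where "c = real CARD('n) ^ 3"
  have c: "c > 0" by (simp add: c_def)
  have inv: "\<forall>\<^sub>F B in ?F. invertible B" by (auto simp: eventually_at_filter)
  have lim: "((\<lambda>B. norm (B0 - B) * (r * c\<^sup>2)) \<longlongrightarrow> norm (B0 - B0) * (r * c\<^sup>2)) ?F"
    by (intro tendsto_intros)
  then have "\<forall>\<^sub>F B in ?F. norm (B0 - B) * (r * c\<^sup>2) < 1 / 2"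
    by (rule order_tendstoD) simp
  then have "\<forall>\<^sub>F B in ?F. norm (matrix_inv B - matrix_inv B0) \<le> (2 * r) * (norm (B0 - B) * (r * c\<^sup>2))"
    using inv
  proof eventually_elim
    case (elim B)
    have "norm (matrix_inv B - matrix_inv B0) \<le> norm (matrix_inv B ** (B0 - B)) * r * c"
      unfolding matrix_inv_diff[OF elim(2) B0] r_def c_def by (rule norm_matrix_mult_le)
    also have "\<dots> \<le> (norm (matrix_inv B) * norm (B0 - B) * c) * r * c"
      unfolding c_def r_def by (intro mult_right_mono norm_matrix_mult_le) auto
    \<comment> \<open>Used twice: with the last factor below \<open>1 / 2\<close> it bounds
      \<open>matrix_inv B\<close> by \<open>2 * r\<close>, and with that bound inserted it gives
      convergence.\<close>
    finally have *: "norm (matrix_inv B - matrix_inv B0) \<le> norm (matrix_inv B) * (norm (B0 - B) * (r * c\<^sup>2))"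
      by (simp add: power2_eq_square mult_ac)
    also have "\<dots> \<le> norm (matrix_inv B) * (1 / 2)" using elim(1) by (intro mult_left_mono) auto
    finally have "norm (matrix_inv B) \<le> 2 * r"
      using norm_triangle_ineq2[of "matrix_inv B" "matrix_inv B0"] by (simp add: r_def)
    with * show ?case
      using c by (elim order_trans) (intro mult_right_mono mult_nonneg_nonneg, auto simp: r_def)
  qed
  then have "((\<lambda>B. matrix_inv B - matrix_inv B0) \<longlongrightarrow> 0) ?F"
    by (rule Lim_null_comparison) (use tendsto_mult_right_zero[of "\<lambda>B. norm (B0 - B) * (r * c\<^sup>2)" ?F "2 * r"] lim in simp)
  then show "(matrix_inv \<longlongrightarrow> matrix_inv B0) ?F" by (simp add: LIM_zero_iff)
qed

section \<open>The resolvent of a selfadjoint matrix\<close>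

lemma embed_mat_mult: "(embed_matrix (mat w) ** B) $ i $ j = w *\<^sub>C B $ i $ j"
proof -
  have "(embed_matrix (mat w) ** B) $ i $ j = (\<Sum>k\<in>UNIV. if k = i then w *\<^sub>C B $ i $ j else 0)"
    unfolding matrix_mult_nth by (intro sum.cong) (auto simp: embed_matrix_def mat_def mult_scaleC_left)
  then show ?thesis by simp
qed

lemma mult_embed_mat: "(B ** embed_matrix (mat w)) $ i $ j = w *\<^sub>C B $ i $ j"
proof -
  have "(B ** embed_matrix (mat w)) $ i $ j = (\<Sum>k\<in>UNIV. if k = j then w *\<^sub>C B $ i $ j else 0)"
    unfolding matrix_mult_nth by (intro sum.cong) (auto simp: embed_matrix_def mat_def mult_scaleC_right)
  then show ?thesis by simp
qed

lemma embed_mat_inverse: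
  assumes "w \<noteq> 0"
  shows "embed_matrix (mat w) ** embed_matrix (mat (inverse w)) = (mat 1 :: 'a::cstar_algebra ^ 'n ^ 'n)"
  using assms by (simp add: vec_eq_iff embed_mat_mult) (simp add: embed_matrix_def mat_def scaleC_scaleC)

lemma embed_mat_diff: "embed_matrix (mat w) - embed_matrix (mat z) = embed_matrix (mat (w - z))"
  by (simp add: vec_eq_iff embed_matrix_def mat_def scaleC_diff_left)

lemma norm_embed_mat_le:
  "norm (embed_matrix (mat w) :: 'a::cstar_algebra ^ 'n ^ 'n) \<le> real CARD('n) * real CARD('n) * cmod w"
  by (rule norm_le_if_entries_le) (simp add: embed_matrix_def mat_def norm_scaleC)

definition resolvent :: "'a::cstar_algebra ^ 'n ^ 'n \<Rightarrow> complex \<Rightarrow> 'a ^ 'n ^ 'n" where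
  "resolvent H z = matrix_inv (embed_matrix (mat z) - H)"

lemma continuous_on_embed_mat: "continuous_on S (\<lambda>z. embed_matrix (mat z) :: 'a::cstar_algebra ^ 'n ^ 'n)"
proof -
  have "isCont (\<lambda>z. embed_matrix (mat z) :: 'a ^ 'n ^ 'n) z0" for z0
    unfolding isCont_def
  proof (rule LIM_zero_cancel, rule Lim_null_comparison)
    show "\<forall>\<^sub>F z in at z0. norm (embed_matrix (mat z) - embed_matrix (mat z0) :: 'a ^ 'n ^ 'n) \<le>
        real CARD('n) * real CARD('n) * cmod (z - z0)"
      unfolding embed_mat_diff by (intro always_eventually allI norm_embed_mat_le)
    have "((\<lambda>z. real CARD('n) * real CARD('n) * cmod (z - z0)) \<longlongrightarrow> real CARD('n) * real CARD('n) * cmod (z0 - z0)) (at z0)"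
      by (intro tendsto_intros)
    then show "((\<lambda>z. real CARD('n) * real CARD('n) * cmod (z - z0)) \<longlongrightarrow> 0) (at z0)" by simp
  qed
  then show ?thesis by (simp add: continuous_at_imp_continuous_on)
qed

text \<open>Column \<open>k\<close> of \<open>R\<close> solves \<open>(z - H) v = e_k\<close>.
  Pairing with \<open>star v\<close> gives \<open>star (v k) = z N - Q\<close> with selfadjoint
  \<open>N\<close> and \<open>Q\<close>; subtracting the adjoint removes \<open>Q\<close>.\<close>

lemma resolvent_identity:
  assumes H: "adjoint_matrix H = (H :: 'a::cstar_algebra ^ 'n ^ 'n)"
    and R: "(embed_matrix (mat z) - H) ** R = mat 1"
  shows "star (R $ k $ k) - R $ k $ k = (2 * \<i> * of_real (Im z)) *\<^sub>C (\<Sum>i\<in>UNIV. star (R $ i $ k) * R $ i $ k)"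
proof -
  define v where "v i = R $ i $ k" for i
  have star_H: "star (H $ i $ j) = H $ j $ i" for i j
    using arg_cong[OF H, of "\<lambda>Y. Y $ j $ i"] by (simp add: adjoint_matrix_def)
  have eq: "z *\<^sub>C v i - (\<Sum>j\<in>UNIV. H $ i $ j * v j) = (if i = k then 1 else 0)" for i
    using arg_cong[OF R, of "\<lambda>Y. Y $ i $ k"]
    unfolding matrix_mult.diff_left vector_minus_component embed_mat_mult
    by (simp add: v_def matrix_mult_nth) (simp add: mat_def)
  define N where "N = (\<Sum>i\<in>UNIV. star (v i) * v i)"
  define Q where "Q = (\<Sum>i\<in>UNIV. \<Sum>j\<in>UNIV. star (v i) * H $ i $ j * v j)"
  have "(\<Sum>i\<in>UNIV. star (v i) * (z *\<^sub>C v i - (\<Sum>j\<in>UNIV. H $ i $ j * v j))) = star (v k)"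
    unfolding eq by (simp add: if_distrib cong: if_cong)
  then have s: "star (v k) = z *\<^sub>C N - Q"
    by (simp add: N_def Q_def right_diff_distrib sum_subtractf mult_scaleC_right scaleC_sum_right sum_distrib_left mult.assoc)
  have sN: "star N = N" by (simp add: N_def star_sum star_mult star_star)
  have "star Q = (\<Sum>i\<in>UNIV. \<Sum>j\<in>UNIV. star (v j) * H $ j $ i * v i)"
    by (simp add: Q_def star_sum star_mult star_star star_H mult.assoc)
  also have "\<dots> = Q" unfolding Q_def by (rule sum.swap)
  finally have "v k = cnj z *\<^sub>C N - Q"
    using arg_cong[OF s, of star] by (simp add: star_star star_diff star_scaleC sN)
  then have "star (v k) - v k = z *\<^sub>C N - cnj z *\<^sub>C N" using s by simp
  also have "\<dots> = (z - cnj z) *\<^sub>C N" by (simp add: scaleC_diff_left)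
  also have "z - cnj z = 2 * \<i> * of_real (Im z)" by (simp add: complex_eq_iff)
  finally show ?thesis by (simp add: v_def N_def)
qed

text \<open>For the column sum \<open>N\<close>, the identity gives
  \<open>Im z * norm N \<le> norm (R $ k $ k)\<close>, while positivity bounds each squared entry
  norm by \<open>norm N\<close>. The entry \<open>i = k\<close> is settled first and then controls
  the whole column.\<close>

lemma norm_resolvent_entry_le:
  assumes H: "adjoint_matrix H = (H :: 'a::cstar_algebra ^ 'n ^ 'n)"
    and R: "(embed_matrix (mat z) - H) ** R = mat 1" and z: "Im z > 0"
  shows "norm (R $ i $ k) \<le> 1 / Im z"
proof -
  define N where "N = (\<Sum>i\<in>UNIV. star (R $ i $ k) * R $ i $ k)"
  have le: "(norm (R $ i $ k))\<^sup>2 \<le> norm N" for i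
    unfolding N_def using norm_square_le_norm_sum[of UNIV i "\<lambda>i. R $ i $ k"] by simp
  have "2 * Im z * norm N = norm ((2 * \<i> * of_real (Im z)) *\<^sub>C N)"
    using z by (simp add: norm_scaleC norm_mult)
  also have "\<dots> = norm (star (R $ k $ k) - R $ k $ k)"
    unfolding N_def using resolvent_identity[OF H R, of k] by simp
  also have "\<dots> \<le> 2 * norm (R $ k $ k)"
    using norm_triangle_ineq4[of "star (R $ k $ k)" "R $ k $ k"] by simp
  finally have N: "Im z * norm N \<le> norm (R $ k $ k)" by simp
  have "Im z * (norm (R $ k $ k))\<^sup>2 \<le> norm (R $ k $ k)"
    using mult_left_mono[OF le[of k], of "Im z"] z N by linarith
  then have Rk: "Im z * norm (R $ k $ k) \<le> 1"
    by (cases "R $ k $ k = 0") (simp_all add: power2_eq_square)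
  have "(Im z * norm (R $ i $ k))\<^sup>2 \<le> Im z * (Im z * norm N)"
    using mult_left_mono[OF le[of i], of "(Im z)\<^sup>2"] by (simp add: power2_eq_square mult_ac)
  also have "\<dots> \<le> Im z * norm (R $ k $ k)" using N z by (intro mult_left_mono) auto
  also have "\<dots> \<le> 1\<^sup>2" using Rk by simp
  finally have "Im z * norm (R $ i $ k) \<le> 1" by (rule power2_le_imp_le) simp
  then show ?thesis using z by (simp add: field_simps)
qed

section \<open>Invertibility in the upper half plane\<close>

lemma invertible_large:
  fixes H :: "'a::cstar_algebra ^ 'n ^ 'n"
  shows "\<exists>r>0. \<forall>z. cmod z > r \<longrightarrow> invertible (embed_matrix (mat z) - H)"
proof -
  define d where "d = real CARD('n) * real CARD('n)"
  define c where "c = (real CARD('n) ^ 3)\<^sup>2"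
  have dc: "d > 0" "c > 0" by (auto simp: d_def c_def)
  define r where "r = d * norm H * c + 1"
  have "invertible (embed_matrix (mat z) - H)" if "cmod z > r" for z
  proof (rule invertible_perturb)
    have "d * norm H * c \<ge> 0" using dc by simp
    then have z: "cmod z > 0" "cmod z > d * norm H * c" using that unfolding r_def by linarith+
    then have z0: "z \<noteq> 0" by auto
    show "embed_matrix (mat z) ** embed_matrix (mat (inverse z)) = (mat 1 :: 'a ^ 'n ^ 'n)"
      using z0 by (rule embed_mat_inverse)
    show "embed_matrix (mat (inverse z)) ** embed_matrix (mat z) = (mat 1 :: 'a ^ 'n ^ 'n)"
      using embed_mat_inverse[of "inverse z"] z0 by simp
    have "norm (embed_matrix (mat (inverse z)) :: 'a ^ 'n ^ 'n) * norm (embed_matrix (mat z) - (embed_matrix (mat z) - H)) * (real CARD('n) ^ 3)\<^sup>2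
      \<le> (d * cmod (inverse z)) * norm H * c"
      unfolding d_def c_def using norm_embed_mat_le[of "inverse z", where 'a = 'a and 'n = 'n]
      by (auto intro!: mult_right_mono)
    also have "\<dots> = d * norm H * c / cmod z" by (simp add: norm_inverse divide_inverse)
    also have "\<dots> < 1" using z by (simp add: divide_less_eq)
    finally show "norm (embed_matrix (mat (inverse z)) :: 'a ^ 'n ^ 'n) * norm (embed_matrix (mat z) - (embed_matrix (mat z) - H)) * (real CARD('n) ^ 3)\<^sup>2 < 1" .
  qed
  moreover have "r > 0" using dc by (simp add: r_def add_nonneg_pos)
  ultimately show ?thesis by blast
qed

lemma exists_large_upper_half_plane: "\<exists>z. Im z > 0 \<and> cmod z > r"
  by (intro exI[of _ "Complex 0 (\<bar>r\<bar> + 1)"]) (auto simp: cmod_def)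

lemma connected_upper_half_plane: "connected {z. Im z > 0}"
  by (rule convex_connected[OF convex_halfspace_Im_gt])

lemma open_upper_half_plane: "open {z. Im z > 0}"
  by (rule open_halfspace_Im_gt)

text \<open>The a priori bound on the resolvent makes the set of invertibility closed in the upper half plane.\<close>

theorem invertible_upper_half_plane:
  assumes H: "adjoint_matrix H = (H :: 'a::cstar_algebra ^ 'n ^ 'n)" and z: "Im z > 0"
  shows "invertible (embed_matrix (mat z) - H)"
proof -
  define U where "U = {z. Im z > 0} \<inter> (\<lambda>z. embed_matrix (mat z) - H) -` {B. invertible B}"
  define V where "V = {z. Im z > 0} - U"
  have "open U" unfolding U_def
    by (intro continuous_open_preimage open_invertible open_upper_half_plane
        continuous_intros continuous_on_embed_mat)
  moreover have "open V" unfolding open_dist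
  proof
    fix w assume w: "w \<in> V"
    then have Im_w: "Im w > 0" by (simp add: V_def)
    define d where "d = real CARD('n) * real CARD('n)"
    define c where "c = (real CARD('n) ^ 3)\<^sup>2"
    have dc: "d > 0" "c > 0" by (auto simp: d_def c_def)
    \<comment> \<open>For \<open>Im y > Im w / 2\<close> the resolvent entries at \<open>y\<close>
      are at most \<open>2 / Im w\<close>; \<open>K\<close> is then the constant of
      \<open>invertible_perturb\<close> per unit of distance between \<open>y\<close> and
      \<open>w\<close>.\<close>
    define K where "K = (d * (2 / Im w)) * d * c"
    have K: "K > 0" using dc Im_w by (simp add: K_def)
    define e where "e = min (Im w / 2) (1 / K)"
    have e: "e > 0" using K Im_w by (simp add: e_def)
    have "y \<in> V" if y: "dist y w < e" for y
    proof -
      have "\<bar>Im y - Im w\<bar> < Im w / 2"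
        using y abs_Im_le_cmod[of "y - w"] by (simp add: e_def dist_norm)
      then have Im_y: "Im y > Im w / 2" by linarith
      have "\<not> invertible (embed_matrix (mat y) - H)"
      proof
        assume inv: "invertible (embed_matrix (mat y) - H)"
        let ?R = "matrix_inv (embed_matrix (mat y) - H)"
        note R = matrix_inv_right[OF inv] matrix_inv_left[OF inv]
        have "norm (?R $ i $ j) \<le> 2 / Im w" for i j
        proof -
          have "norm (?R $ i $ j) \<le> 1 / Im y"
            using Im_y Im_w by (intro norm_resolvent_entry_le[OF H R(1)]) linarith
          also have "\<dots> \<le> 2 / Im w" using Im_y Im_w by (simp add: field_simps)
          finally show ?thesis .
        qed
        then have nR: "norm ?R \<le> d * (2 / Im w)" unfolding d_def by (rule norm_le_if_entries_le)
        have "invertible (embed_matrix (mat w) - H)"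
        proof (rule invertible_perturb[OF R])
          have "embed_matrix (mat y) - H - (embed_matrix (mat w) - H) = embed_matrix (mat (y - w))"
            by (simp flip: embed_mat_diff)
          then have "norm (embed_matrix (mat y) - H - (embed_matrix (mat w) - H)) \<le> d * cmod (y - w)"
            unfolding d_def using norm_embed_mat_le by metis
          then have "norm ?R * norm (embed_matrix (mat y) - H - (embed_matrix (mat w) - H)) * (real CARD('n) ^ 3)\<^sup>2
            \<le> (d * (2 / Im w)) * (d * cmod (y - w)) * c"
            unfolding c_def using nR dc Im_w by (intro mult_right_mono mult_mono) auto
          also have "\<dots> = K * cmod (y - w)" by (simp add: K_def)
          also have "\<dots> < K * (1 / K)"
            using y K by (intro mult_strict_left_mono) (auto simp: e_def dist_norm)
          finally show "norm ?R * norm (embed_matrix (mat y) - H - (embed_matrix (mat w) - H)) * (real CARD('n) ^ 3)\<^sup>2 < 1"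
            using K by simp
        qed
        then show False using w by (simp add: V_def U_def)
      qed
      then show ?thesis using Im_y Im_w by (simp add: V_def U_def)
    qed
    with e show "\<exists>e>0. \<forall>y. dist y w < e \<longrightarrow> y \<in> V" by blast
  qed
  ultimately have "U \<inter> {z. Im z > 0} = {} \<or> V \<inter> {z. Im z > 0} = {}"
    using connectedD[OF connected_upper_half_plane] by (auto simp: V_def)
  moreover obtain r where r: "\<forall>z. cmod z > r \<longrightarrow> invertible (embed_matrix (mat z) - H)"
    using invertible_large[of H] by blast
  obtain z0 where "Im z0 > 0" "cmod z0 > r" using exists_large_upper_half_plane by blast
  then have "z0 \<in> U \<inter> {z. Im z > 0}" using r by (simp add: U_def)
  ultimately have "V \<inter> {z. Im z > 0} = {}" by blast
  then show ?thesis using z by (auto simp: V_def U_def)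
qed

section \<open>Power series of the resolvent\<close>

definition mpow :: "'a::semiring_1 ^ 'n ^ 'n \<Rightarrow> nat \<Rightarrow> 'a ^ 'n ^ 'n" where
  "mpow H k = (((**) H) ^^ k) (mat 1)"

lemma mpow_0 [simp]: "mpow H 0 = mat 1"
  and mpow_Suc: "mpow H (Suc k) = H ** mpow H k"
  by (simp_all add: mpow_def)

lemma norm_mpow_le:
  fixes H :: "'a::real_normed_algebra_1 ^ 'n ^ 'n"
  shows "norm (mpow H k) \<le> (norm H * real CARD('n) ^ 3) ^ k * norm (mat 1 :: 'a ^ 'n ^ 'n)"
proof (induction k)
  case (Suc k)
  have "norm (mpow H (Suc k)) \<le> norm H * norm (mpow H k) * real CARD('n) ^ 3"
    unfolding mpow_Suc by (rule norm_matrix_mult_le)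
  also have "\<dots> \<le> norm H * ((norm H * real CARD('n) ^ 3) ^ k * norm (mat 1 :: 'a ^ 'n ^ 'n)) * real CARD('n) ^ 3"
    by (intro mult_right_mono mult_left_mono Suc) auto
  finally show ?case by (simp add: mult_ac)
qed simp

text \<open>Iterates \<open>z R = 1 + R H\<close> with exact remainder, so that convergence is only
  discussed for scalars, after applying \<open>\<phi>\<close>.\<close>

lemma resolvent_expansion:
  fixes H :: "'a::cstar_algebra ^ 'n ^ 'n"
  assumes "R ** (embed_matrix (mat z) - H) = mat 1" "z \<noteq> 0"
  shows "R $ i $ j = (\<Sum>k<N. (1 / z ^ Suc k) *\<^sub>C mpow H k $ i $ j) + (1 / z ^ N) *\<^sub>C (R ** mpow H N) $ i $ j"
proof (induction N)
  case (Suc N)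
  have "mpow H N = R ** (embed_matrix (mat z) - H) ** mpow H N" using assms by simp
  also have "\<dots> = R ** (embed_matrix (mat z) ** mpow H N) - R ** mpow H (Suc N)"
    by (simp add: mpow_Suc matrix_mul_assoc[symmetric] matrix_mult.diff_left matrix_mult.diff_right)
  also have "R ** (embed_matrix (mat z) ** mpow H N) = R ** (mpow H N ** embed_matrix (mat z))"
    by (rule arg_cong[where f = "(**) R"]) (simp add: vec_eq_iff embed_mat_mult mult_embed_mat)
  finally have "mpow H N $ i $ j = z *\<^sub>C (R ** mpow H N) $ i $ j - (R ** mpow H (Suc N)) $ i $ j"
    unfolding matrix_mul_assoc by (metis mult_embed_mat vector_minus_component)
  then have "(1 / z) *\<^sub>C (mpow H N $ i $ j + (R ** mpow H (Suc N)) $ i $ j) = (1 / z) *\<^sub>C z *\<^sub>C (R ** mpow H N) $ i $ j"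
    by simp
  then have "(R ** mpow H N) $ i $ j = (1 / z) *\<^sub>C (mpow H N $ i $ j + (R ** mpow H (Suc N)) $ i $ j)"
    using assms(2) by (simp add: scaleC_scaleC)
  then show ?case
    by (subst Suc) (simp add: scaleC_add_right scaleC_scaleC mult.commute)
qed simp

context
  fixes \<phi> :: "'a::cstar_algebra \<Rightarrow> complex"
  assumes phi: "cstar_prob_space \<phi>"
begin

lemma cmod_phi_entry_le: "cmod (\<phi> (B $ i $ j)) \<le> norm B"
  using cmod_phi_le_norm[OF phi, of "B $ i $ j"] norm_entry_le[of B i j] by linarith

lemma summable_moments:
  fixes H :: "'a ^ 'n ^ 'n"
  assumes "cmod z > norm H * real CARD('n) ^ 3"
  shows "summable (\<lambda>k. norm (\<phi> (mpow H k $ i $ j) / z ^ Suc k))"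
proof (rule summable_comparison_test)
  define q where "q = norm H * real CARD('n) ^ 3 / cmod z"
  have "norm H * real CARD('n) ^ 3 \<ge> 0" by simp
  then have z: "cmod z > 0" using assms by linarith
  have q: "0 \<le> q" "q < 1" using assms z by (simp_all add: q_def)
  show "summable (\<lambda>k. (norm (mat 1 :: 'a ^ 'n ^ 'n) / cmod z) * q ^ k)"
    using q by (intro summable_mult summable_geometric) auto
  show "\<exists>N. \<forall>k\<ge>N. norm (norm (\<phi> (mpow H k $ i $ j) / z ^ Suc k)) \<le> (norm (mat 1 :: 'a ^ 'n ^ 'n) / cmod z) * q ^ k"
  proof (intro exI allI impI)
    fix k
    have "norm (\<phi> (mpow H k $ i $ j) / z ^ Suc k) \<le> ((norm H * real CARD('n) ^ 3) ^ k * norm (mat 1 :: 'a ^ 'n ^ 'n)) / cmod z ^ Suc k"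
      unfolding norm_divide norm_power
      by (intro divide_right_mono order_trans[OF cmod_phi_entry_le norm_mpow_le]) auto
    also have "\<dots> = (norm (mat 1 :: 'a ^ 'n ^ 'n) / cmod z) * q ^ k"
      by (simp add: q_def power_divide)
    finally show "norm (norm (\<phi> (mpow H k $ i $ j) / z ^ Suc k)) \<le> (norm (mat 1 :: 'a ^ 'n ^ 'n) / cmod z) * q ^ k"
      by simp
  qed
qed

lemma moments_sums_resolvent:
  fixes H :: "'a ^ 'n ^ 'n"
  assumes "R ** (embed_matrix (mat z) - H) = mat 1" "cmod z > norm H * real CARD('n) ^ 3"
  shows "(\<lambda>k. \<phi> (mpow H k $ i $ j) / z ^ Suc k) sums \<phi> (R $ i $ j)"
proof -
  define q where "q = norm H * real CARD('n) ^ 3 / cmod z"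
  have "norm H * real CARD('n) ^ 3 \<ge> 0" by simp
  then have z: "cmod z > 0" using assms by linarith
  have q: "0 \<le> q" "q < 1" using assms z by (simp_all add: q_def)
  define C where "C = norm R * norm (mat 1 :: 'a ^ 'n ^ 'n) * real CARD('n) ^ 3"
  have rem: "\<phi> (R $ i $ j) - (\<Sum>k<N. \<phi> (mpow H k $ i $ j) / z ^ Suc k) = (1 / z ^ N) * \<phi> ((R ** mpow H N) $ i $ j)" for N
    using z by (subst resolvent_expansion[OF assms(1), of i j N])
      (simp_all add: phi_add[OF phi] phi_sum[OF phi] phi_scaleC[OF phi])
  have "cmod ((1 / z ^ N) * \<phi> ((R ** mpow H N) $ i $ j)) \<le> C * q ^ N" for N
  proof -
    have "cmod (\<phi> ((R ** mpow H N) $ i $ j)) \<le> norm R * norm (mpow H N) * real CARD('n) ^ 3"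
      by (rule order_trans[OF cmod_phi_entry_le norm_matrix_mult_le])
    also have "\<dots> \<le> norm R * ((norm H * real CARD('n) ^ 3) ^ N * norm (mat 1 :: 'a ^ 'n ^ 'n)) * real CARD('n) ^ 3"
      by (intro mult_right_mono mult_left_mono norm_mpow_le) auto
    finally have "cmod (\<phi> ((R ** mpow H N) $ i $ j)) / cmod z ^ N \<le> (C * (norm H * real CARD('n) ^ 3) ^ N) / cmod z ^ N"
      by (intro divide_right_mono) (auto simp: C_def mult_ac)
    then show ?thesis by (simp add: norm_mult norm_divide norm_power q_def power_divide)
  qed
  then have "\<forall>\<^sub>F N in sequentially. norm ((1 / z ^ N) * \<phi> ((R ** mpow H N) $ i $ j)) \<le> C * q ^ N"
    by (intro always_eventually allI)
  moreover have "(\<lambda>N. C * q ^ N) \<longlonglongrightarrow> 0"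
    using q by (intro tendsto_mult_right_zero LIMSEQ_power_zero) simp
  ultimately have "(\<lambda>N. \<phi> (R $ i $ j) - (\<Sum>k<N. \<phi> (mpow H k $ i $ j) / z ^ Suc k)) \<longlonglongrightarrow> 0"
    unfolding rem by (rule Lim_null_comparison)
  from tendsto_diff[OF tendsto_const[of "\<phi> (R $ i $ j)"] this]
  show ?thesis by (simp add: sums_def)
qed

section \<open>The recursion for the operator-valued moments\<close>

context
  fixes A :: "complex ^ 'n::{finite,linorder} ^ 'n::{finite,linorder}" and X :: "'a ^ 'n::{finite,linorder} ^ 'n::{finite,linorder}"
  assumes X: "free_circular_family \<phi> X"
    and A_adj: "adjoint_matrix A = A" and A_real: "\<And>i j. A $ i $ j \<in> \<real>\<^sub>\<ge>\<^sub>0"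
begin

lemma A_sym: "A $ i $ j = A $ j $ i"
proof -
  have "A $ i $ j = cnj (A $ j $ i)"
    using arg_cong[OF A_adj, of "\<lambda>Y. Y $ i $ j"] by (simp add: adjoint_matrix_def star_complex_def)
  then show ?thesis using A_real[of j i] by (auto simp: complex_eq_iff complex_nonneg_Reals_iff)
qed

lemma adjoint_hadamard: "adjoint_matrix (hadamard A X) = hadamard A X"
proof -
  have adj: "adjoint_matrix X = X" using X by (simp add: free_circular_family_def)
  have "star (X $ j $ i) = X $ i $ j" for i j
    using arg_cong[OF adj, of "\<lambda>Y. Y $ i $ j"] by (simp add: adjoint_matrix_def)
  moreover have "cnj (A $ j $ i) = A $ i $ j" for i j
    using A_sym[of i j] A_real[of j i] by (auto simp: complex_eq_iff complex_nonneg_Reals_iff)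
  ultimately show ?thesis
    by (simp add: vec_eq_iff adjoint_matrix_def hadamard_def star_scaleC)
qed

lemma phi_X_mult: "\<phi> (X $ i $ j * X $ k $ l) = (if i = l \<and> j = k then 1 else 0)"
  using X by (simp add: free_circular_family_def)

text \<open>The derivation along \<open>X\<^sub>i\<^sub>a\<close> of an entry of \<open>H\<^sup>n\<close> deletes one occurrence of \<open>H\<^sub>a\<^sub>i\<close>.\<close>

lemma derives_mpow:
  "derives \<phi> (\<lambda>y. \<phi> (X $ i $ a * y)) {X $ k $ l |k l. True} (mpow (hadamard A X) n $ b $ j)
    (\<lambda>u v. \<Sum>m<n. A $ a $ i * \<phi> (u * mpow (hadamard A X) m $ b $ a) * \<phi> (mpow (hadamard A X) (n - 1 - m) $ i $ j * v))"
proof (induction n arbitrary: b)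
  case 0
  show ?case
    by (rule derives_cong[OF derives.scale[OF derives.one, where c = "if b = j then 1 else 0"]])
      (simp_all add: mat_def)
next
  case (Suc n)
  let ?d = "derives \<phi> (\<lambda>y. \<phi> (X $ i $ a * y)) {X $ k $ l |k l. True}"
  let ?D = "\<lambda>b u v. \<Sum>m<n. A $ a $ i * \<phi> (u * mpow (hadamard A X) m $ b $ a) * \<phi> (mpow (hadamard A X) (n - 1 - m) $ i $ j * v)"
  have "?d (A $ b $ c *\<^sub>C X $ b $ c) (\<lambda>u v. A $ b $ c * (\<phi> (X $ i $ a * X $ b $ c) * \<phi> u * \<phi> v))" for c
    by (intro derives.scale derives.gen) auto
  from derives.mult[OF this Suc.IH]
  have "?d (\<Sum>c\<in>UNIV. (A $ b $ c *\<^sub>C X $ b $ c) * mpow (hadamard A X) n $ c $ j)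
      (\<lambda>u v. \<Sum>c\<in>UNIV. A $ b $ c * (\<phi> (X $ i $ a * X $ b $ c) * \<phi> u * \<phi> (mpow (hadamard A X) n $ c $ j * v)) +
        ?D c (u * (A $ b $ c *\<^sub>C X $ b $ c)) v)"
    by (intro derives_sum[OF phi]) auto
  then show ?case
  proof (rule derives_cong)
    show "(\<Sum>c\<in>UNIV. (A $ b $ c *\<^sub>C X $ b $ c) * mpow (hadamard A X) n $ c $ j) = mpow (hadamard A X) (Suc n) $ b $ j"
      by (simp add: mpow_Suc matrix_mult_nth hadamard_def)
    fix u v
    \<comment> \<open>Differentiating the first factor gives the summand \<open>m = 0\<close>, since
      the power 0 is the identity matrix; the remaining power gives the summands with index raised
      by one.\<close>
    have "(\<Sum>c\<in>UNIV. A $ b $ c * (\<phi> (X $ i $ a * X $ b $ c) * \<phi> u * \<phi> (mpow (hadamard A X) n $ c $ j * v))) =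
        (\<Sum>c\<in>UNIV. if c = i then (if a = b then A $ b $ i * (\<phi> u * \<phi> (mpow (hadamard A X) n $ i $ j * v)) else 0) else 0)"
      by (intro sum.cong) (auto simp: phi_X_mult)
    also have "\<dots> = A $ a $ i * \<phi> (u * mpow (hadamard A X) 0 $ b $ a) * \<phi> (mpow (hadamard A X) n $ i $ j * v)"
      by (simp add: mat_def phi_zero[OF phi])
    finally have 1: "(\<Sum>c\<in>UNIV. A $ b $ c * (\<phi> (X $ i $ a * X $ b $ c) * \<phi> u * \<phi> (mpow (hadamard A X) n $ c $ j * v))) = \<dots>" .
    have "(\<Sum>c\<in>UNIV. ?D c (u * (A $ b $ c *\<^sub>C X $ b $ c)) v) =
        (\<Sum>m<n. \<Sum>c\<in>UNIV. A $ a $ i * \<phi> (u * (A $ b $ c *\<^sub>C X $ b $ c) * mpow (hadamard A X) m $ c $ a) * \<phi> (mpow (hadamard A X) (n - 1 - m) $ i $ j * v))"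
      by (rule sum.swap)
    also have "\<dots> = (\<Sum>m<n. A $ a $ i * \<phi> (u * mpow (hadamard A X) (Suc m) $ b $ a) * \<phi> (mpow (hadamard A X) (n - 1 - m) $ i $ j * v))"
    proof (rule sum.cong[OF refl])
      fix m
      have "u * mpow (hadamard A X) (Suc m) $ b $ a = (\<Sum>c\<in>UNIV. u * (A $ b $ c *\<^sub>C X $ b $ c) * mpow (hadamard A X) m $ c $ a)"
        by (simp add: mpow_Suc matrix_mult_nth hadamard_def sum_distrib_left mult.assoc)
      then show "(\<Sum>c\<in>UNIV. A $ a $ i * \<phi> (u * (A $ b $ c *\<^sub>C X $ b $ c) * mpow (hadamard A X) m $ c $ a) * \<phi> (mpow (hadamard A X) (n - 1 - m) $ i $ j * v)) =
          A $ a $ i * \<phi> (u * mpow (hadamard A X) (Suc m) $ b $ a) * \<phi> (mpow (hadamard A X) (n - 1 - m) $ i $ j * v)"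
        by (simp add: phi_sum[OF phi] sum_distrib_left sum_distrib_right)
    qed
    finally have 2: "(\<Sum>c\<in>UNIV. ?D c (u * (A $ b $ c *\<^sub>C X $ b $ c)) v) = \<dots>" .
    show "(\<Sum>c\<in>UNIV. A $ b $ c * (\<phi> (X $ i $ a * X $ b $ c) * \<phi> u * \<phi> (mpow (hadamard A X) n $ c $ j * v)) +
        ?D c (u * (A $ b $ c *\<^sub>C X $ b $ c)) v) =
      (\<Sum>m<Suc n. A $ a $ i * \<phi> (u * mpow (hadamard A X) m $ b $ a) * \<phi> (mpow (hadamard A X) (Suc n - 1 - m) $ i $ j * v))"
      unfolding sum.distrib 1 2 sum.lessThan_Suc_shift by simp
  qed
qed

text \<open>Integration by parts of the entries of the first factor against the remaining power;
  symmetry of \<open>A\<close> turns \<open>A $ i $ a * A $ a $ i\<close> into a square.\<close>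

lemma moment_recursion:
  "\<phi> (mpow (hadamard A X) (Suc n) $ i $ j) = (\<Sum>a\<in>UNIV. (A $ i $ a)\<^sup>2 *
    (\<Sum>m<n. \<phi> (mpow (hadamard A X) m $ a $ a) * \<phi> (mpow (hadamard A X) (n - 1 - m) $ i $ j)))"
proof -
  have "\<phi> (X $ i $ a * mpow (hadamard A X) n $ a $ j) =
      (\<Sum>m<n. A $ a $ i * \<phi> (mpow (hadamard A X) m $ a $ a) * \<phi> (mpow (hadamard A X) (n - 1 - m) $ i $ j))" for a
    using wick_derives[OF phi wick_free_circular_family[OF phi X] derives_mpow] by simp
  moreover have "mpow (hadamard A X) (Suc n) $ i $ j = (\<Sum>a\<in>UNIV. A $ i $ a *\<^sub>C (X $ i $ a * mpow (hadamard A X) n $ a $ j))"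
    by (simp add: mpow_Suc matrix_mult_nth hadamard_def mult_scaleC_left)
  ultimately show ?thesis
    by (simp add: phi_sum[OF phi] phi_scaleC[OF phi] sum_distrib_left power2_eq_square A_sym[of _ i] mult.assoc)
qed

section \<open>The equation for the operator-valued Cauchy transform\<close>

text \<open>The convolution of moments is a Cauchy product of series in \<open>1 / z\<close>. The
  recursion raises the index by two, which leaves one factor \<open>z\<close>.\<close>

lemma cauchy_equation_large:
  assumes R: "R ** (embed_matrix (mat z) - hadamard A X) = mat 1" and z: "cmod z > norm (hadamard A X) * real CARD('n) ^ 3"
  shows "z * \<phi> (R $ i $ j) = (if i = j then 1 else 0) + (\<Sum>a\<in>UNIV. (A $ i $ a)\<^sup>2 * \<phi> (R $ a $ a)) * \<phi> (R $ i $ j)"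
proof -
  have "norm (hadamard A X) * real CARD('n) ^ 3 \<ge> 0" by simp
  then have "cmod z > 0" using z by linarith
  then have z0: "z \<noteq> 0" by simp
  define f where "f k = \<phi> (mpow (hadamard A X) k $ i $ j)" for k
  define h where "h a k = \<phi> (mpow (hadamard A X) k $ a $ a)" for a k
  have f0: "f 0 = (if i = j then 1 else 0)" by (simp add: f_def mat_def phi_one[OF phi] phi_zero[OF phi])
  have f1: "f 1 = 0" using moment_recursion[of 0 i j] by (simp add: f_def)
  have f2: "f (k + 2) = (\<Sum>a\<in>UNIV. (A $ i $ a)\<^sup>2 * (\<Sum>m\<le>k. h a m * f (k - m)))" for k
    using moment_recursion[of "Suc k" i j] by (simp add: f_def h_def lessThan_Suc_atMost)
  have sf: "(\<lambda>k. f k / z ^ Suc k) sums \<phi> (R $ i $ j)"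
    unfolding f_def by (rule moments_sums_resolvent[OF R z])
  have sh: "(\<lambda>k. h a k / z ^ Suc k) sums \<phi> (R $ a $ a)" for a
    unfolding h_def by (rule moments_sums_resolvent[OF R z])
  have "(\<lambda>k. \<Sum>m\<le>k. (h a m / z ^ Suc m) * (f (k - m) / z ^ Suc (k - m))) sums (\<phi> (R $ a $ a) * \<phi> (R $ i $ j))" for a
    unfolding sums_unique[OF sf] sums_unique[OF sh]
  proof (rule Cauchy_product_sums)
    show "summable (\<lambda>k. norm (h a k / z ^ Suc k))" unfolding h_def by (rule summable_moments[OF z])
    show "summable (\<lambda>k. norm (f k / z ^ Suc k))" unfolding f_def by (rule summable_moments[OF z])
  qed
  then have "(\<lambda>k. \<Sum>a\<in>UNIV. (A $ i $ a)\<^sup>2 * (\<Sum>m\<le>k. (h a m / z ^ Suc m) * (f (k - m) / z ^ Suc (k - m)))) sums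
      (\<Sum>a\<in>UNIV. (A $ i $ a)\<^sup>2 * (\<phi> (R $ a $ a) * \<phi> (R $ i $ j)))"
    by (intro sums_sum sums_mult)
  also have "(\<lambda>k. \<Sum>a\<in>UNIV. (A $ i $ a)\<^sup>2 * (\<Sum>m\<le>k. (h a m / z ^ Suc m) * (f (k - m) / z ^ Suc (k - m)))) =
      (\<lambda>k. z * (f (k + 2) / z ^ Suc (k + 2)))"
  proof
    fix k
    have "(h a m / z ^ Suc m) * (f (k - m) / z ^ Suc (k - m)) = (h a m * f (k - m)) / z ^ (k + 2)" if "m \<le> k" for a m
      using that by (simp flip: power_add)
    then have inner: "(\<Sum>m\<le>k. (h a m / z ^ Suc m) * (f (k - m) / z ^ Suc (k - m))) = (\<Sum>m\<le>k. h a m * f (k - m)) / z ^ (k + 2)" for a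
      unfolding sum_divide_distrib by (intro sum.cong) auto
    have "(\<Sum>a\<in>UNIV. (A $ i $ a)\<^sup>2 * (\<Sum>m\<le>k. (h a m / z ^ Suc m) * (f (k - m) / z ^ Suc (k - m)))) =
        f (k + 2) / z ^ (k + 2)"
      unfolding inner f2 by (simp only: times_divide_eq_right flip: sum_divide_distrib)
    also have "\<dots> = z * (f (k + 2) / z ^ Suc (k + 2))" using z0 by simp
    finally show "(\<Sum>a\<in>UNIV. (A $ i $ a)\<^sup>2 * (\<Sum>m\<le>k. (h a m / z ^ Suc m) * (f (k - m) / z ^ Suc (k - m)))) =
        z * (f (k + 2) / z ^ Suc (k + 2))" .
  qed
  finally have 1: "(\<lambda>k. z * (f (k + 2) / z ^ Suc (k + 2))) sums (\<Sum>a\<in>UNIV. (A $ i $ a)\<^sup>2 * (\<phi> (R $ a $ a) * \<phi> (R $ i $ j)))" .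
  have "(\<lambda>k. f (k + 2) / z ^ Suc (k + 2)) sums (\<phi> (R $ i $ j) - (\<Sum>k<2. f k / z ^ Suc k))"
    using sf by (rule sums_split_initial_segment)
  then have "(\<lambda>k. z * (f (k + 2) / z ^ Suc (k + 2))) sums (z * (\<phi> (R $ i $ j) - (\<Sum>k<2. f k / z ^ Suc k)))"
    by (rule sums_mult)
  from sums_unique2[OF this 1]
  have "z * \<phi> (R $ i $ j) - f 0 = (\<Sum>a\<in>UNIV. (A $ i $ a)\<^sup>2 * (\<phi> (R $ a $ a) * \<phi> (R $ i $ j)))"
    using z0 f1 by (simp add: numeral_2_eq_2 right_diff_distrib)
  then show ?thesis
    unfolding f0 diff_eq_eq by (simp only: sum_distrib_right mult.assoc add.commute)
qed

end

text \<open>The difference quotient is minus \<open>\<phi>\<close> of an entry of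
  \<open>resolvent H w ** resolvent H z\<close>, so continuity of the resolvent suffices.\<close>

lemma holomorphic_resolvent:
  assumes H: "adjoint_matrix H = (H :: 'a ^ 'n ^ 'n)"
  shows "(\<lambda>z. \<phi> (resolvent H z $ i $ j)) holomorphic_on {z. Im z > 0}"
proof -
  have "((\<lambda>z. \<phi> (resolvent H z $ i $ j)) has_field_derivative - \<phi> ((resolvent H z ** resolvent H z) $ i $ j)) (at z)"
    if z: "Im z > 0" for z
    unfolding has_field_derivative_iff
  proof (rule Lim_transform_eventually)
    have "continuous_on {z. Im z > 0} (resolvent H)"
      unfolding resolvent_def
      by (rule continuous_on_compose2[OF continuous_on_matrix_inv])
        (auto intro!: continuous_intros continuous_on_embed_mat invertible_upper_half_plane[OF H])
    then have "isCont (resolvent H) z"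
      using z open_upper_half_plane by (simp add: continuous_on_eq_continuous_at)
    then have "(resolvent H \<longlongrightarrow> resolvent H z) (at z)" by (simp add: isCont_def)
    then have "((\<lambda>w. (resolvent H w ** resolvent H z) $ i $ j) \<longlongrightarrow> (resolvent H z ** resolvent H z) $ i $ j) (at z)"
      by (intro tendsto_vec_nth matrix_mult.tendsto tendsto_const)
    then show "((\<lambda>w. - \<phi> ((resolvent H w ** resolvent H z) $ i $ j)) \<longlongrightarrow> - \<phi> ((resolvent H z ** resolvent H z) $ i $ j)) (at z)"
      by (intro tendsto_minus bounded_linear.tendsto[OF bounded_linear_phi[OF phi]])
    have "\<forall>\<^sub>F w in at z. w \<in> {z. Im z > 0}"
      using z open_upper_half_plane by (intro eventually_at_in_open') auto
    moreover have "\<forall>\<^sub>F w in at z. w \<noteq> z" by (auto simp: eventually_at_filter)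
    ultimately show "\<forall>\<^sub>F w in at z. - \<phi> ((resolvent H w ** resolvent H z) $ i $ j) =
        (\<phi> (resolvent H w $ i $ j) - \<phi> (resolvent H z $ i $ j)) / (w - z)"
    proof eventually_elim
      case (elim w)
      have "resolvent H w - resolvent H z = resolvent H w ** embed_matrix (mat (z - w)) ** resolvent H z"
        unfolding resolvent_def using elim(1) z
        by (subst matrix_inv_diff) (auto intro!: invertible_upper_half_plane[OF H] simp flip: embed_mat_diff)
      also have "\<dots> = resolvent H w ** (embed_matrix (mat (z - w)) ** resolvent H z)" by (simp add: matrix_mul_assoc)
      also have "\<dots> = resolvent H w ** (resolvent H z ** embed_matrix (mat (z - w)))"
        by (rule arg_cong[where f = "(**) (resolvent H w)"]) (simp add: vec_eq_iff embed_mat_mult mult_embed_mat)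
      finally have "(resolvent H w - resolvent H z) $ i $ j = (z - w) *\<^sub>C (resolvent H w ** resolvent H z) $ i $ j"
        unfolding matrix_mul_assoc by (simp add: mult_embed_mat)
      then have "\<phi> (resolvent H w $ i $ j) - \<phi> (resolvent H z $ i $ j) = (z - w) * \<phi> ((resolvent H w ** resolvent H z) $ i $ j)"
        by (simp flip: phi_diff[OF phi] phi_scaleC[OF phi])
      then show ?case using elim(2) by (simp add: field_simps)
    qed
  qed
  then show ?thesis
    by (auto simp: holomorphic_on_open open_upper_half_plane)
qed

context
  fixes A :: "complex ^ 'n::{finite,linorder} ^ 'n::{finite,linorder}" and X :: "'a ^ 'n::{finite,linorder} ^ 'n::{finite,linorder}"
  assumes X: "free_circular_family \<phi> X"
    and A_adj: "adjoint_matrix A = A" and A_real: "\<And>i j. A $ i $ j \<in> \<real>\<^sub>\<ge>\<^sub>0"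
begin

lemma cauchy_equation:
  assumes z: "Im z > 0"
  defines "g \<equiv> \<lambda>z i j. \<phi> (resolvent (hadamard A X) z $ i $ j)"
  shows "z * g z i j = (if i = j then 1 else 0) + (\<Sum>a\<in>UNIV. (A $ i $ a)\<^sup>2 * g z a a) * g z i j"
proof -
  let ?H = "hadamard A X"
  have H: "adjoint_matrix ?H = ?H" by (rule adjoint_hadamard[OF X A_adj A_real])
  define r where "r = norm ?H * real CARD('n) ^ 3"
  show ?thesis
  proof (rule analytic_continuation_open[where f = "\<lambda>z. z * g z i j" and
        g = "\<lambda>z. (if i = j then 1 else 0) + (\<Sum>a\<in>UNIV. (A $ i $ a)\<^sup>2 * g z a a) * g z i j" and s = "{z. Im z > 0} \<inter> {z. cmod z > r}" and s' = "{z. Im z > 0}"])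
    show "open ({z. Im z > 0} \<inter> {z. cmod z > r})"
      by (intro open_Int open_upper_half_plane open_Collect_less continuous_intros)
    show "{z. Im z > 0} \<inter> {z. cmod z > r} \<noteq> {}"
      using exists_large_upper_half_plane[of r] by auto
    show "(\<lambda>z. z * g z i j) holomorphic_on {z. Im z > 0}"
      unfolding g_def by (intro holomorphic_intros holomorphic_resolvent H)
    show "(\<lambda>z. (if i = j then 1 else 0) + (\<Sum>a\<in>UNIV. (A $ i $ a)\<^sup>2 * g z a a) * g z i j) holomorphic_on {z. Im z > 0}"
      unfolding g_def by (intro holomorphic_intros holomorphic_resolvent H)
    fix w assume w: "w \<in> {z. Im z > 0} \<inter> {z. cmod z > r}"
    then have "invertible (embed_matrix (mat w) - ?H)" by (intro invertible_upper_half_plane[OF H]) auto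
    from matrix_inv_left[OF this] w
    show "w * g w i j = (if i = j then 1 else 0) + (\<Sum>a\<in>UNIV. (A $ i $ a)\<^sup>2 * g w a a) * g w i j"
      unfolding g_def resolvent_def
      by (intro cauchy_equation_large[OF X A_adj A_real]) (auto simp: r_def)
  qed (use z open_upper_half_plane connected_upper_half_plane in auto)
qed

text \<open>The factor that is invertible by the diagonal equation annihilates the off-diagonal
  entries. By the resolvent identity and Cauchy-Schwarz, \<open>- Im\<close> of a diagonal entry is
  at least \<open>Im z\<close> times its squared modulus, which the same equation keeps away from
  0.\<close>

theorem cauchy_transform_fixed_point:
  assumes z: "Im z > 0"
  defines "G \<equiv> cauchy_transform \<phi> (hadamard A X) (mat z)"
  shows "Im (G $ i $ i) < 0"
    and "(z - (\<Sum>a\<in>UNIV. (A $ i $ a)\<^sup>2 * G $ a $ a)) * G $ i $ i = 1"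
    and "i \<noteq> j \<Longrightarrow> G $ i $ j = 0"
proof -
  let ?H = "hadamard A X"
  have H: "adjoint_matrix ?H = ?H" by (rule adjoint_hadamard[OF X A_adj A_real])
  have G: "G $ i $ j = \<phi> (resolvent ?H z $ i $ j)" for i j
    by (simp add: G_def cauchy_transform_def entrywise_def resolvent_def)
  have eq: "(z - (\<Sum>a\<in>UNIV. (A $ i $ a)\<^sup>2 * G $ a $ a)) * G $ i $ j = (if i = j then 1 else 0)" for i j
    using cauchy_equation[OF z, of i j] unfolding G by (simp add: algebra_simps)
  show 1: "(z - (\<Sum>a\<in>UNIV. (A $ i $ a)\<^sup>2 * G $ a $ a)) * G $ i $ i = 1" using eq[of i i] by simp
  then show "G $ i $ j = 0" if "i \<noteq> j" using eq[of i j] that by auto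
  define R where "R = resolvent ?H z"
  have R: "(embed_matrix (mat z) - ?H) ** R = mat 1"
    unfolding R_def resolvent_def by (intro matrix_inv_right invertible_upper_half_plane[OF H z])
  have "\<phi> (star (R $ i $ i) - R $ i $ i) = (2 * \<i> * of_real (Im z)) * (\<Sum>k\<in>UNIV. \<phi> (star (R $ k $ i) * R $ k $ i))"
    unfolding resolvent_identity[OF H R] by (simp add: phi_scaleC[OF phi] phi_sum[OF phi])
  then have Im: "- Im (\<phi> (R $ i $ i)) = Im z * (\<Sum>k\<in>UNIV. Re (\<phi> (star (R $ k $ i) * R $ k $ i)))"
    by (simp add: phi_diff[OF phi] phi_star[OF phi] complex_eq_iff)
  have le: "(cmod (\<phi> (R $ i $ i)))\<^sup>2 \<le> (\<Sum>k\<in>UNIV. Re (\<phi> (star (R $ k $ i) * R $ k $ i)))"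
  proof -
    have "(cmod (\<phi> (R $ i $ i)))\<^sup>2 \<le> Re (\<phi> (star (R $ i $ i) * R $ i $ i))" by (rule cmod_phi_square_le[OF phi])
    also have "\<dots> \<le> (\<Sum>k\<in>UNIV. Re (\<phi> (star (R $ k $ i) * R $ k $ i)))"
      using phi_star_mult[OF phi] by (intro member_le_sum) (auto simp: complex_nonneg_Reals_iff)
    finally show ?thesis .
  qed
  have "\<phi> (R $ i $ i) \<noteq> 0"
  proof
    assume "\<phi> (R $ i $ i) = 0"
    then have "G $ i $ i = 0" by (simp add: G R_def)
    with 1 show False by simp
  qed
  then have "0 < Im z * (cmod (\<phi> (R $ i $ i)))\<^sup>2" using z by simp
  also have "\<dots> \<le> - Im (\<phi> (R $ i $ i))" unfolding Im using z le by (intro mult_left_mono) auto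
  finally show "Im (G $ i $ i) < 0" unfolding G R_def[symmetric] by simp
qed

end

end

section \<open>Contraction in the hyperbolic metric\<close>

text \<open>\<open>T_map\<close> on diagonals, which are all that \<open>eta\<close> sees;
  \<open>b i j\<close> stands for the squared entries of \<open>A\<close>.\<close>

definition scalar_T :: "('n::finite \<Rightarrow> 'n \<Rightarrow> real) \<Rightarrow> complex \<Rightarrow> ('n \<Rightarrow> complex) \<Rightarrow> 'n \<Rightarrow> complex" where
  "scalar_T b z g i = inverse (z - (\<Sum>j\<in>UNIV. of_real (b i j) * g j))"

context
  fixes b :: "'n::finite \<Rightarrow> 'n \<Rightarrow> real" and z :: complex
  assumes b_nonneg: "\<And>i j. b i j \<ge> 0" and z: "Im z > 0"
begin

lemma Im_denominator: "Im (z - (\<Sum>j\<in>UNIV. of_real (b i j) * g j)) = Im z + (\<Sum>j\<in>UNIV. b i j * - Im (g j))"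
  by (simp add: sum_negf)

lemma Im_denominator_ge:
  assumes "\<And>j. Im (g j) < 0"
  shows "Im (z - (\<Sum>j\<in>UNIV. of_real (b i j) * g j)) \<ge> Im z"
proof -
  have "b i j * - Im (g j) \<ge> 0" for j
    using b_nonneg[of i j] assms[of j] by (intro mult_nonneg_nonneg) auto
  then show ?thesis unfolding Im_denominator by (simp only: le_add_same_cancel1 sum_nonneg)
qed

lemma denominator_nonzero:
  assumes "\<And>j. Im (g j) < 0"
  shows "z - (\<Sum>j\<in>UNIV. of_real (b i j) * g j) \<noteq> 0"
proof
  assume "z - (\<Sum>j\<in>UNIV. of_real (b i j) * g j) = 0"
  then show False using Im_denominator_ge[of g i, OF assms] z by simp
qed

lemma scalar_T_bound:
  assumes "\<And>j. Im (g j) < 0"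
  shows "cmod (scalar_T b z g i) \<le> 1 / Im z"
proof -
  have "Im z \<le> cmod (z - (\<Sum>j\<in>UNIV. of_real (b i j) * g j))"
    using Im_denominator_ge[of g i, OF assms] abs_Im_le_cmod[of "z - (\<Sum>j\<in>UNIV. of_real (b i j) * g j)"]
    by linarith
  from le_imp_inverse_le[OF this z] show ?thesis
    by (simp only: scalar_T_def norm_inverse divide_inverse mult_1)
qed

lemma Im_scalar_T:
  "- Im (scalar_T b z g i) = Im (z - (\<Sum>j\<in>UNIV. of_real (b i j) * g j)) / (cmod (z - (\<Sum>j\<in>UNIV. of_real (b i j) * g j)))\<^sup>2"
proof -
  have "- Im (inverse w) = Im w / (cmod w)\<^sup>2" for w by (simp add: cmod_power2)
  then show ?thesis unfolding scalar_T_def .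
qed

lemma Im_scalar_T_neg:
  assumes "\<And>j. Im (g j) < 0"
  shows "Im (scalar_T b z g i) < 0"
proof -
  have "0 < - Im (scalar_T b z g i)"
    unfolding Im_scalar_T using Im_denominator_ge[of g i, OF assms] denominator_nonzero[of g i, OF assms] z
    by (intro divide_pos_pos) auto
  then show ?thesis by simp
qed

lemma Im_scalar_T_funpow_neg: "(\<And>j. Im (g j) < 0) \<Longrightarrow> Im ((scalar_T b z ^^ n) g j) < 0"
  by (induction n arbitrary: j) (auto intro: Im_scalar_T_neg)

text \<open>For points of the lower half plane \<open>\<bar>g - h\<bar>\<^sup>2 / (Im g Im h)\<close> is an increasing function of the
  hyperbolic distance.\<close>

lemma scalar_T_contraction:
  fixes g h :: "'n \<Rightarrow> complex"
  assumes g: "\<And>j. Im (g j) < 0" and h: "\<And>j. Im (h j) < 0" and D: "D \<ge> 0"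
    and dist: "\<And>j. (cmod (g j - h j))\<^sup>2 \<le> D * (- Im (g j) * - Im (h j))"
  defines "V \<equiv> \<Sum>i\<in>UNIV. \<Sum>j\<in>UNIV. b i j * - Im (h j)"
  shows "(cmod (scalar_T b z g i - scalar_T b z h i))\<^sup>2 \<le>
    (D * (V / (Im z + V))) * (- Im (scalar_T b z g i) * - Im (scalar_T b z h i))"
proof -
  define p where "p = z - (\<Sum>j\<in>UNIV. of_real (b i j) * g j)"
  define r where "r = z - (\<Sum>j\<in>UNIV. of_real (b i j) * h j)"
  define Y where "Y = (\<Sum>j\<in>UNIV. b i j * - Im (g j))"
  define Vi where "Vi = (\<Sum>j\<in>UNIV. b i j * - Im (h j))"
  have nonneg: "b i j * - Im (g j) \<ge> 0" "b i j * - Im (h j) \<ge> 0" for i j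
    using b_nonneg[of i j] g[of j] h[of j] by (simp_all add: mult_nonneg_nonpos)
  have Y: "Y \<ge> 0" unfolding Y_def by (intro sum_nonneg nonneg)
  have Vi: "Vi \<ge> 0" unfolding Vi_def by (intro sum_nonneg nonneg)
  have ViV: "Vi \<le> V"
    unfolding Vi_def V_def by (intro member_le_sum[of i] sum_nonneg nonneg) auto
  have p: "p \<noteq> 0" "Im p = Im z + Y" and r: "r \<noteq> 0" "Im r = Im z + Vi"
    unfolding p_def r_def Y_def Vi_def using denominator_nonzero g h Im_denominator by auto
  have "cmod (\<Sum>j\<in>UNIV. of_real (b i j) * (g j - h j)) \<le> (\<Sum>j\<in>UNIV. b i j * cmod (g j - h j))"
    by (rule order_trans[OF norm_sum]) (simp add: norm_mult b_nonneg)
  also have "\<dots> \<le> (\<Sum>j\<in>UNIV. sqrt D * (sqrt (b i j * - Im (g j)) * sqrt (b i j * - Im (h j))))"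
  proof (rule sum_mono)
    fix j
    have "cmod (g j - h j) \<le> sqrt (D * (- Im (g j) * - Im (h j)))"
      using dist[of j] by (rule real_le_rsqrt)
    then have "b i j * cmod (g j - h j) \<le> sqrt (b i j) * sqrt (b i j) * sqrt (D * (- Im (g j) * - Im (h j)))"
      using b_nonneg[of i j] by (simp add: mult_left_mono)
    also have "\<dots> = sqrt D * (sqrt (b i j * - Im (g j)) * sqrt (b i j * - Im (h j)))"
      by (simp only: real_sqrt_mult mult_ac)
    finally show "b i j * cmod (g j - h j) \<le> sqrt D * (sqrt (b i j * - Im (g j)) * sqrt (b i j * - Im (h j)))" .
  qed
  finally have "(cmod (\<Sum>j\<in>UNIV. of_real (b i j) * (g j - h j)))\<^sup>2 \<le>
      (\<Sum>j\<in>UNIV. sqrt D * (sqrt (b i j * - Im (g j)) * sqrt (b i j * - Im (h j))))\<^sup>2"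
    by (rule power_mono) simp
  also have "\<dots> = D * (\<Sum>j\<in>UNIV. sqrt (b i j * - Im (g j)) * sqrt (b i j * - Im (h j)))\<^sup>2"
    unfolding sum_distrib_left[symmetric] power_mult_distrib using D by simp
  also have "\<dots> \<le> D * ((\<Sum>j\<in>UNIV. (sqrt (b i j * - Im (g j)))\<^sup>2) * (\<Sum>j\<in>UNIV. (sqrt (b i j * - Im (h j)))\<^sup>2))"
    by (intro mult_left_mono Cauchy_Schwarz_ineq_sum D)
  also have "(\<Sum>j\<in>UNIV. (sqrt (b i j * - Im (g j)))\<^sup>2) = Y"
    unfolding Y_def by (intro sum.cong refl real_sqrt_pow2 nonneg)
  also have "(\<Sum>j\<in>UNIV. (sqrt (b i j * - Im (h j)))\<^sup>2) = Vi"
    unfolding Vi_def by (intro sum.cong refl real_sqrt_pow2 nonneg)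
  \<comment> \<open>The strict gain, from \<open>Vi\<close> to \<open>Im z + Vi\<close>. The factor
    is uniform in \<open>i\<close> because \<open>Vi \<le> V\<close>, and it involves only
    \<open>h\<close>, later the fixed point, and not the moving \<open>g\<close>.\<close>
  also have "D * (Y * Vi) \<le> D * ((Im z + Y) * ((V / (Im z + V)) * (Im z + Vi)))"
  proof (intro mult_left_mono mult_mono D)
    have "Vi * (Im z + V) \<le> V * (Im z + Vi)" using ViV z by (simp add: algebra_simps)
    then show "Vi \<le> V / (Im z + V) * (Im z + Vi)"
      using ViV Vi z by (simp add: field_simps)
  qed (use Y Vi ViV z in auto)
  finally have main: "(cmod (\<Sum>j\<in>UNIV. of_real (b i j) * (g j - h j)))\<^sup>2 \<le> (D * (V / (Im z + V))) * (Im p * Im r)"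
    unfolding p(2) r(2) by (simp add: mult_ac)
  have "scalar_T b z g i - scalar_T b z h i = (r - p) / (p * r)"
    unfolding scalar_T_def p_def[symmetric] r_def[symmetric] using p r by (simp add: field_simps)
  also have "r - p = (\<Sum>j\<in>UNIV. of_real (b i j) * (g j - h j))"
    by (simp add: p_def r_def right_diff_distrib sum_subtractf)
  finally have "(cmod (scalar_T b z g i - scalar_T b z h i))\<^sup>2 =
      (cmod (\<Sum>j\<in>UNIV. of_real (b i j) * (g j - h j)))\<^sup>2 / ((cmod p)\<^sup>2 * (cmod r)\<^sup>2)"
    by (simp add: norm_divide norm_mult power_divide power_mult_distrib)
  also have "\<dots> \<le> ((D * (V / (Im z + V))) * (Im p * Im r)) / ((cmod p)\<^sup>2 * (cmod r)\<^sup>2)"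
    by (intro divide_right_mono main) auto
  also have "\<dots> = (D * (V / (Im z + V))) * (- Im (scalar_T b z g i) * - Im (scalar_T b z h i))"
    unfolding Im_scalar_T p_def[symmetric] r_def[symmetric] by simp
  finally show ?thesis .
qed

theorem scalar_T_funpow_tendsto:
  fixes g h :: "'n \<Rightarrow> complex"
  assumes g: "\<And>j. Im (g j) < 0" and h: "\<And>j. Im (h j) < 0" and fix_h: "\<And>i. scalar_T b z h i = h i"
  shows "(\<lambda>n. (scalar_T b z ^^ n) g i) \<longlonglongrightarrow> h i"
proof -
  define V where "V = (\<Sum>i\<in>UNIV. \<Sum>j\<in>UNIV. b i j * - Im (h j))"
  define q where "q = V / (Im z + V)"
  have "b i j * - Im (h j) \<ge> 0" for i j
    using b_nonneg[of i j] h[of j] by (simp add: mult_nonneg_nonpos)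
  then have "V \<ge> 0" unfolding V_def by (intro sum_nonneg)
  then have q: "q \<ge> 0" "q < 1" using z by (simp_all add: q_def)
  define e where "e j = (cmod (g j - h j))\<^sup>2 / (- Im (g j) * - Im (h j))" for j
  define D where "D = (\<Sum>j\<in>UNIV. e j)"
  have pos: "- Im (g j) * - Im (h j) > 0" for j using g[of j] h[of j] by (intro mult_pos_pos) auto
  have e: "e j \<ge> 0" for j unfolding e_def using pos[of j] by (intro divide_nonneg_pos) auto
  then have D: "D \<ge> 0" unfolding D_def by (intro sum_nonneg)
  have D0: "(cmod (g j - h j))\<^sup>2 \<le> D * (- Im (g j) * - Im (h j))" for j
  proof -
    have "e j \<le> D" unfolding D_def by (intro member_le_sum e) auto
    then show ?thesis unfolding e_def using pos[of j] by (simp only: pos_divide_le_eq)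
  qed
  have bound: "(cmod ((scalar_T b z ^^ n) g j - h j))\<^sup>2 \<le> (D * q ^ n) * (- Im ((scalar_T b z ^^ n) g j) * - Im (h j))" for n j
  proof (induction n arbitrary: j)
    case (Suc n)
    have "(cmod (scalar_T b z ((scalar_T b z ^^ n) g) j - scalar_T b z h j))\<^sup>2 \<le>
        ((D * q ^ n) * q) * (- Im (scalar_T b z ((scalar_T b z ^^ n) g) j) * - Im (scalar_T b z h j))"
      unfolding q_def V_def
      by (rule scalar_T_contraction)
        (use g h Suc.IH D q in \<open>auto simp: q_def V_def intro: Im_scalar_T_funpow_neg\<close>)
    then show ?case by (simp add: fix_h mult_ac)
  qed (use D0 in simp)
  \<comment> \<open>A small hyperbolic distance gives a small Euclidean one as long as imaginary
    parts stay bounded; the bound \<open>1 / Im z\<close> is available after the first step.\<close>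
  have "(\<lambda>n. (scalar_T b z ^^ Suc n) g i - h i) \<longlonglongrightarrow> 0"
  proof (rule Lim_null_comparison)
    define c where "c = D * q * (1 / Im z * - Im (h i))"
    have "cmod ((scalar_T b z ^^ Suc n) g i - h i) \<le> sqrt (c * q ^ n)" for n
    proof (rule real_le_rsqrt)
      have "- Im ((scalar_T b z ^^ Suc n) g i) \<le> cmod ((scalar_T b z ^^ Suc n) g i)"
        using abs_Im_le_cmod[of "(scalar_T b z ^^ Suc n) g i"] by linarith
      also have "\<dots> \<le> 1 / Im z"
        using g by (simp add: scalar_T_bound Im_scalar_T_funpow_neg)
      finally have "(D * q ^ Suc n) * (- Im ((scalar_T b z ^^ Suc n) g i) * - Im (h i)) \<le> (D * q ^ Suc n) * (1 / Im z * - Im (h i))"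
        using D q h[of i] by (intro mult_left_mono mult_right_mono) auto
      then show "(cmod ((scalar_T b z ^^ Suc n) g i - h i))\<^sup>2 \<le> c * q ^ n"
        using bound[of "Suc n" i] by (simp add: c_def mult_ac)
    qed
    then show "\<forall>\<^sub>F n in sequentially. norm ((scalar_T b z ^^ Suc n) g i - h i) \<le> sqrt (c * q ^ n)"
      by (intro always_eventually allI)
    have "(\<lambda>n. sqrt (c * q ^ n)) \<longlonglongrightarrow> sqrt (c * 0)"
      using q by (intro tendsto_intros LIMSEQ_power_zero) simp
    then show "(\<lambda>n. sqrt (c * q ^ n)) \<longlonglongrightarrow> 0" by simp
  qed
  then have "(\<lambda>n. (scalar_T b z ^^ Suc n) g i) \<longlonglongrightarrow> h i" by (simp add: LIM_zero_iff)
  then show ?thesis by (rule LIMSEQ_imp_Suc)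
qed

end

section \<open>Diagonal matrices and measurability\<close>

definition diag_matrix :: "('n \<Rightarrow> complex) \<Rightarrow> complex ^ 'n ^ 'n" where
  "diag_matrix d = (\<chi> i j. if i = j then d i else 0)"

lemma diag_matrix_mult: "(diag_matrix d ** B) $ i $ j = d i * B $ i $ j"
proof -
  have "(diag_matrix d ** B) $ i $ j = (\<Sum>k\<in>UNIV. if k = i then d i * B $ i $ j else 0)"
    unfolding matrix_mult_nth by (intro sum.cong) (auto simp: diag_matrix_def)
  then show ?thesis by simp
qed

lemma diag_matrix_mult_inverse:
  assumes "\<And>i. d i \<noteq> 0"
  shows "diag_matrix d ** diag_matrix (\<lambda>i. inverse (d i)) = mat 1"
  using assms by (simp add: vec_eq_iff diag_matrix_mult) (simp add: diag_matrix_def mat_def)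

lemma invertible_diag_matrix_iff: "invertible (diag_matrix d) \<longleftrightarrow> (\<forall>i. d i \<noteq> 0)"
proof
  assume "invertible (diag_matrix d)"
  then obtain B where B: "diag_matrix d ** B = mat 1" unfolding invertible_def by blast
  show "\<forall>i. d i \<noteq> 0"
  proof
    fix i
    have "d i * B $ i $ i = 1"
      using arg_cong[OF B, of "\<lambda>Y. Y $ i $ i"] by (simp add: diag_matrix_mult) (simp add: mat_def)
    then show "d i \<noteq> 0" by auto
  qed
next
  assume "\<forall>i. d i \<noteq> 0"
  then have "diag_matrix d ** diag_matrix (\<lambda>i. inverse (d i)) = mat 1"
    "diag_matrix (\<lambda>i. inverse (d i)) ** diag_matrix d = mat 1"
    using diag_matrix_mult_inverse[of d] diag_matrix_mult_inverse[of "\<lambda>i. inverse (d i)"] by auto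
  then show "invertible (diag_matrix d)" unfolding invertible_def by blast
qed

text \<open>The default value is recorded as well, because measurability must also cover outcomes
  where a denominator vanishes.\<close>

lemma matrix_inv_diag_matrix:
  "matrix_inv (diag_matrix d) = (if \<forall>i. d i \<noteq> 0 then diag_matrix (\<lambda>i. inverse (d i)) else (SOME B. False))"
proof (cases "\<forall>i. d i \<noteq> 0")
  case True
  then show ?thesis
    using diag_matrix_mult_inverse[of d] diag_matrix_mult_inverse[of "\<lambda>i. inverse (d i)"]
    by (simp add: matrix_inv_unique)
next
  case False
  then have "\<not> invertible (diag_matrix d)" by (simp add: invertible_diag_matrix_iff)
  from matrix_inv_not_invertible[OF this] show ?thesis by (simp only: False if_False)
qed

lemma denominator_diag_matrix:
  "mat z - eta A D = diag_matrix (\<lambda>i. z - (\<Sum>k\<in>UNIV. (A $ i $ k)\<^sup>2 * D $ k $ k))"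
  by (simp add: vec_eq_iff mat_def eta_def diag_matrix_def)

section \<open>Measurability of the iterates and of the Cauchy transform\<close>

lemma borel_measurable_vecI:
  fixes f :: "'w \<Rightarrow> 'b::euclidean_space ^ 'n"
  assumes "\<And>i. (\<lambda>\<omega>. f \<omega> $ i) \<in> borel_measurable M"
  shows "f \<in> borel_measurable M"
proof (rule borel_measurable_euclidean_space[THEN iffD2], rule ballI)
  fix x :: "'b ^ 'n" assume "x \<in> Basis"
  then have "x \<in> (\<Union>i. \<Union>u\<in>Basis. {axis i u})" by (simp only: Basis_vec_def)
  then obtain i u where x: "x = axis i u" by blast
  have "(\<lambda>\<omega>. f \<omega> \<bullet> x) = (\<lambda>\<omega>. f \<omega> $ i \<bullet> u)" by (simp add: x inner_axis)
  then show "(\<lambda>\<omega>. f \<omega> \<bullet> x) \<in> borel_measurable M"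
    by (simp only:) (intro borel_measurable_inner assms borel_measurable_const)
qed

lemma borel_measurable_entry:
  fixes f :: "'w \<Rightarrow> complex ^ 'n ^ 'm"
  assumes "f \<in> borel_measurable M"
  shows "(\<lambda>\<omega>. f \<omega> $ i $ j) \<in> borel_measurable M"
  by (rule borel_measurable_continuous_on[OF _ assms]) (intro continuous_intros)

lemma borel_measurable_T_map:
  fixes A D :: "'w \<Rightarrow> complex ^ 'n ^ 'n"
  assumes A: "A \<in> borel_measurable M" and D: "D \<in> borel_measurable M"
  shows "(\<lambda>\<omega>. T_map (A \<omega>) (mat z) (D \<omega>)) \<in> borel_measurable M"
proof -
  note [measurable] = borel_measurable_entry[OF A] borel_measurable_entry[OF D]
  define d where "d i \<omega> = z - (\<Sum>k\<in>UNIV. (A \<omega> $ i $ k)\<^sup>2 * D \<omega> $ k $ k)" for i \<omega>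
  have d[measurable]: "d i \<in> borel_measurable M" for i
    unfolding d_def by measurable
  have "(\<lambda>\<omega>. diag_matrix (\<lambda>i. inverse (d i \<omega>))) \<in> borel_measurable M"
  proof (intro borel_measurable_vecI)
    fix i j
    show "(\<lambda>\<omega>. diag_matrix (\<lambda>i. inverse (d i \<omega>)) $ i $ j) \<in> borel_measurable M"
      by (cases "i = j") (simp_all add: diag_matrix_def)
  qed
  moreover have "Measurable.pred M (\<lambda>\<omega>. \<forall>i. d i \<omega> \<noteq> 0)" by measurable
  ultimately have "(\<lambda>\<omega>. if \<forall>i. d i \<omega> \<noteq> 0 then diag_matrix (\<lambda>i. inverse (d i \<omega>)) else (SOME B. False))
      \<in> borel_measurable M"
    by (intro measurable_If borel_measurable_const) (auto simp: pred_def)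
  then show ?thesis
    unfolding T_map_def denominator_diag_matrix matrix_inv_diag_matrix d_def .
qed

lemma continuous_on_hadamard: "continuous_on S (\<lambda>A. hadamard A X :: 'a::cstar_algebra ^ 'n ^ 'n)"
proof -
  have "bounded_linear (\<lambda>c. c *\<^sub>C x)" for x :: 'a
    by (rule bounded_linear_intro[where K = "norm x"])
      (simp_all add: scaleC_add_left norm_scaleC scaleR_conv_of_real[where 'a = complex]
        flip: scaleC_of_real scaleC_scaleC)
  note linear = bounded_linear.continuous_on[OF this]
  show ?thesis unfolding hadamard_def by (intro continuous_intros linear)
qed

text \<open>Continuous on the open set of invertibility and constant elsewhere. Regarding it as a
  function of the complex matrix \<open>A\<close> avoids measurability in the possibly non-separable
  algebra.\<close>

lemma borel_measurable_cauchy_transform: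
  fixes X :: "'a::cstar_algebra ^ 'n ^ 'n"
  assumes phi: "cstar_prob_space \<phi>"
  shows "(\<lambda>A. cauchy_transform \<phi> (hadamard A X) (mat z)) \<in> borel_measurable borel"
proof -
  define K where "K A = embed_matrix (mat z) - hadamard A X" for A
  define U where "U = {A. invertible (K A)}"
  have contK: "continuous_on S K" for S
    unfolding K_def by (intro continuous_intros continuous_on_hadamard)
  have "open U"
    using continuous_open_preimage[OF contK open_UNIV open_invertible] by (simp add: U_def vimage_def)
  moreover have "continuous_on U (\<lambda>A. entrywise \<phi> (matrix_inv (K A)))"
    unfolding entrywise_def
    by (intro continuous_intros bounded_linear.continuous_on[OF bounded_linear_phi[OF phi]]
        continuous_on_compose2[OF continuous_on_matrix_inv contK]) (auto simp: U_def)
  ultimately have "(\<lambda>A. if A \<in> U then entrywise \<phi> (matrix_inv (K A)) else entrywise \<phi> (SOME B. False))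
      \<in> borel_measurable borel"
    by (intro borel_measurable_continuous_on_if continuous_intros) auto
  also have "(\<lambda>A. if A \<in> U then entrywise \<phi> (matrix_inv (K A)) else entrywise \<phi> (SOME B. False)) =
      (\<lambda>A. cauchy_transform \<phi> (hadamard A X) (mat z))"
    by (auto simp: fun_eq_iff cauchy_transform_def K_def U_def matrix_inv_not_invertible)
  finally show ?thesis .
qed

section \<open>Convergence of the iteration\<close>

text \<open>The quadratic form is tested on a unit vector.\<close>

lemma Im_diag_lower_half_plane:
  assumes "W \<in> lower_half_plane"
  shows "Im (W $ j $ j) < 0"
proof -
  define v :: "complex ^ 'a" where "v = axis j 1"
  have "v \<noteq> 0" by (simp add: v_def axis_eq_0_iff)
  then have "0 < Re (\<Sum>i\<in>UNIV. \<Sum>k\<in>UNIV. cnj (v $ i) * (- Im_matrix W) $ i $ k * v $ k)"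
    using assms by (simp add: lower_half_plane_def positive_definite_def)
  also have "(\<Sum>i\<in>UNIV. \<Sum>k\<in>UNIV. cnj (v $ i) * (- Im_matrix W) $ i $ k * v $ k) =
      (\<Sum>i\<in>UNIV. \<Sum>k\<in>UNIV. if k = j then (if i = j then - Im_matrix W $ j $ j else 0) else 0)"
    by (intro sum.cong refl) (simp add: v_def axis_def)
  also have "\<dots> = - Im_matrix W $ j $ j" by simp
  also have "\<dots> = - of_real (Im (W $ j $ j))"
    by (simp add: Im_matrix_def adjoint_matrix_def star_complex_def complex_eq_iff)
  finally show ?thesis by simp
qed

text \<open>The real part makes the weight nonnegative for every matrix; on nonnegative real entries
  it is the plain square.\<close>

definition weight :: "complex ^ 'n ^ 'n \<Rightarrow> 'n \<Rightarrow> 'n \<Rightarrow> real" where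
  "weight A i j = (Re (A $ i $ j))\<^sup>2"

lemma weight_nonneg: "weight A i j \<ge> 0"
  by (simp add: weight_def)

lemma square_eq_weight: "A $ i $ j \<in> \<real>\<^sub>\<ge>\<^sub>0 \<Longrightarrow> (A $ i $ j)\<^sup>2 = of_real (weight A i j)"
  by (simp add: weight_def complex_nonneg_Reals_iff complex_eq_iff power2_eq_square)

context
  fixes A :: "complex ^ 'n ^ 'n" and W :: "complex ^ 'n ^ 'n" and z :: complex
  assumes A_real: "\<And>i j. A $ i $ j \<in> \<real>\<^sub>\<ge>\<^sub>0" and z: "Im z > 0" and W: "\<And>j. Im (W $ j $ j) < 0"
begin

abbreviation (input) "iter n \<equiv> (T_map A (mat z) ^^ n) W"
abbreviation (input) "scalar_iter n \<equiv> (scalar_T (weight A) z ^^ n) (\<lambda>j. W $ j $ j)"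

lemma T_map_eq:
  assumes "\<And>j. Im (D $ j $ j) < 0"
  shows "invertible (mat z - eta A D)"
    and "T_map A (mat z) D = diag_matrix (scalar_T (weight A) z (\<lambda>j. D $ j $ j))"
proof -
  have D: "mat z - eta A D = diag_matrix (\<lambda>i. z - (\<Sum>k\<in>UNIV. of_real (weight A i k) * D $ k $ k))"
    unfolding denominator_diag_matrix square_eq_weight[OF A_real] ..
  note nz = denominator_nonzero[of "weight A" z "\<lambda>j. D $ j $ j", OF weight_nonneg z assms]
  then show "invertible (mat z - eta A D)" unfolding D invertible_diag_matrix_iff by (intro allI)
  have "matrix_inv (mat z - eta A D) =
      diag_matrix (\<lambda>i. inverse (z - (\<Sum>k\<in>UNIV. of_real (weight A i k) * D $ k $ k)))"
    unfolding D matrix_inv_diag_matrix by (rule if_P) (intro allI nz)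
  then show "T_map A (mat z) D = diag_matrix (scalar_T (weight A) z (\<lambda>j. D $ j $ j))"
    unfolding T_map_def scalar_T_def .
qed

lemma iter_diag: "iter n $ j $ j = scalar_iter n j"
proof (induction n arbitrary: j)
  case (Suc n)
  have "Im (iter n $ j $ j) < 0" for j
    unfolding Suc by (rule Im_scalar_T_funpow_neg[OF weight_nonneg z W])
  from T_map_eq(2)[OF this] show ?case
    by (simp add: diag_matrix_def Suc)
qed simp

lemma Im_iter_neg: "Im (iter n $ j $ j) < 0"
  unfolding iter_diag by (rule Im_scalar_T_funpow_neg[OF weight_nonneg z W])

lemma invertible_iter: "invertible (mat z - eta A (iter n))"
  by (rule T_map_eq(1)[OF Im_iter_neg])

lemma iter_Suc: "iter (Suc n) = diag_matrix (scalar_iter (Suc n))"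
  using T_map_eq(2)[OF Im_iter_neg[of n]] by (simp add: iter_diag)

text \<open>\<open>W\<close> itself need be neither diagonal nor bounded in terms of
  \<open>Im z\<close>; one application of \<open>T_map\<close> provides both, hence
  \<open>Suc n\<close>.\<close>

lemma norm_iter_le: "norm (iter (Suc n)) \<le> real CARD('n) * real CARD('n) * (1 / Im z)"
proof (rule norm_le_if_entries_le)
  have "cmod (scalar_iter (Suc n) i) \<le> 1 / Im z" for i
    using scalar_T_bound[OF weight_nonneg z Im_scalar_T_funpow_neg[OF weight_nonneg z W]] by simp
  then show "norm (iter (Suc n) $ i $ j) \<le> 1 / Im z" for i j
    unfolding iter_Suc using z by (simp add: diag_matrix_def)
qed

end

theorem iteration_tendsto_cauchy_transform:
  fixes \<phi> :: "'a::cstar_algebra \<Rightarrow> complex"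
    and A :: "complex ^ 'n::{finite,linorder} ^ 'n::{finite,linorder}"
    and X :: "'a ^ 'n::{finite,linorder} ^ 'n::{finite,linorder}"
  assumes phi: "cstar_prob_space \<phi>" and X: "free_circular_family \<phi> X"
    and A: "adjoint_matrix A = A" "\<And>i j. A $ i $ j \<in> \<real>\<^sub>\<ge>\<^sub>0"
    and z: "Im z > 0" and W: "\<And>j. Im (W $ j $ j) < 0"
  shows "(\<lambda>n. (T_map A (mat z) ^^ n) W) \<longlonglongrightarrow> cauchy_transform \<phi> (hadamard A X) (mat z)"
proof -
  define G where "G = cauchy_transform \<phi> (hadamard A X) (mat z)"
  note G = cauchy_transform_fixed_point[OF phi X A z, folded G_def]
  note nonneg = weight_nonneg[of A]
  have "scalar_T (weight A) z (\<lambda>j. G $ j $ j) i = G $ i $ i" for i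
    using G(2)[of i] unfolding scalar_T_def square_eq_weight[OF A(2)]
    by (rule inverse_unique)
  from scalar_T_funpow_tendsto[OF nonneg z W G(1) this]
  have lim: "(\<lambda>n. (scalar_T (weight A) z ^^ n) (\<lambda>j. W $ j $ j) i) \<longlonglongrightarrow> G $ i $ i" for i .
  have "(\<lambda>n. (T_map A (mat z) ^^ Suc n) W) \<longlonglongrightarrow> G"
  proof (intro vec_tendstoI)
    fix i j
    show "(\<lambda>n. (T_map A (mat z) ^^ Suc n) W $ i $ j) \<longlonglongrightarrow> G $ i $ j"
      using LIMSEQ_Suc[OF lim[of i]] G(3)[of i j]
      unfolding iter_Suc[OF A(2) z W] by (cases "i = j") (simp_all add: diag_matrix_def)
  qed
  then show ?thesis unfolding G_def by (rule LIMSEQ_imp_Suc)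
qed

text \<open>Invertibility and integrability are part of the conclusion, so that the limit does not
  rest on default values of \<open>matrix_inv\<close> or of the Bochner integral.\<close>

theorem theorem1:
  fixes M :: "'w measure"
    and \<phi> :: "'a::cstar_algebra \<Rightarrow> complex"
    and A :: "'w \<Rightarrow> complex ^ 'n::{finite,linorder} ^ 'n::{finite,linorder}"
    and X :: "'a ^ 'n::{finite,linorder} ^ 'n::{finite,linorder}"
    and H :: "'w \<Rightarrow> 'a ^ 'n::{finite,linorder} ^ 'n::{finite,linorder}"
    and z :: complex
    and W :: "complex ^ 'n::{finite,linorder} ^ 'n::{finite,linorder}"
  assumes "prob_space M"
    and "cstar_prob_space \<phi>"
    and "semicircular_mixture M \<phi> A X H"
    and "Im z > 0"
    and "W \<in> lower_half_plane"
  shows "(AE \<omega> in M. invertible (embed_matrix (mat z) - H \<omega>)) \<and>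
    integrable M (\<lambda>\<omega>. cauchy_transform \<phi> (H \<omega>) (mat z)) \<and>
    (AE \<omega> in M. \<forall>n. invertible (mat z - eta (A \<omega>) ((T_map (A \<omega>) (mat z) ^^ n) W))) \<and>
    (\<forall>n. integrable M (\<lambda>\<omega>. (T_map (A \<omega>) (mat z) ^^ n) W)) \<and>
    (\<lambda>n. \<integral>\<omega>. (T_map (A \<omega>) (mat z) ^^ n) W \<partial>M)
      \<longlonglongrightarrow> mean_cauchy_transform M \<phi> H (mat z)"
proof -
  interpret prob_space M by fact
  note phi = \<open>cstar_prob_space \<phi>\<close> and z = \<open>Im z > 0\<close>
  note W = Im_diag_lower_half_plane[OF \<open>W \<in> lower_half_plane\<close>]
  have A_meas: "\<And>i j. (\<lambda>\<omega>. A \<omega> $ i $ j) \<in> borel_measurable M"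
    and A_ae: "AE \<omega> in M. adjoint_matrix (A \<omega>) = A \<omega> \<and> (\<forall>i j. A \<omega> $ i $ j \<in> \<real>\<^sub>\<ge>\<^sub>0)"
    and X: "free_circular_family \<phi> X" and H: "H = (\<lambda>\<omega>. hadamard (A \<omega>) X)"
    using assms(3) by (auto simp: semicircular_mixture_def L_infty_minus_def)
  have A: "A \<in> borel_measurable M" by (intro borel_measurable_vecI A_meas)
  define s where "s n \<omega> = (T_map (A \<omega>) (mat z) ^^ n) W" for n \<omega>
  define f where "f \<omega> = cauchy_transform \<phi> (H \<omega>) (mat z)" for \<omega>
  define c where "c = real CARD('n) * real CARD('n) * (1 / Im z)"
  have f: "f \<in> borel_measurable M"
    unfolding f_def H by (rule measurable_compose[OF A borel_measurable_cauchy_transform[OF phi]])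
  have s: "s n \<in> borel_measurable M" for n
  proof (induction n)
    case (Suc n)
    have "s (Suc n) = (\<lambda>\<omega>. T_map (A \<omega>) (mat z) (s n \<omega>))" by (simp add: s_def fun_eq_iff)
    then show ?case using borel_measurable_T_map[OF A Suc] by simp
  qed (simp add: s_def)
  have inv: "AE \<omega> in M. invertible (embed_matrix (mat z) - H \<omega>)"
    using A_ae
  proof eventually_elim
    case (elim \<omega>)
    then have "adjoint_matrix (hadamard (A \<omega>) X) = hadamard (A \<omega>) X"
      by (intro adjoint_hadamard[OF phi X]) auto
    from invertible_upper_half_plane[OF this z] show ?case by (simp add: H)
  qed
  have inv_iter: "AE \<omega> in M. \<forall>n. invertible (mat z - eta (A \<omega>) ((T_map (A \<omega>) (mat z) ^^ n) W))"
    using A_ae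
  proof eventually_elim
    case (elim \<omega>)
    then show ?case using invertible_iter[OF _ z W, of "A \<omega>"] by blast
  qed
  have lim: "AE \<omega> in M. (\<lambda>n. s (Suc n) \<omega>) \<longlonglongrightarrow> f \<omega>"
    using A_ae
  proof eventually_elim
    case (elim \<omega>)
    then have "(\<lambda>n. s n \<omega>) \<longlonglongrightarrow> f \<omega>"
      unfolding s_def f_def H using iteration_tendsto_cauchy_transform[OF phi X _ _ z W, of "A \<omega>"] by blast
    then show ?case by (rule LIMSEQ_Suc)
  qed
  have bound: "AE \<omega> in M. norm (s (Suc n) \<omega>) \<le> c" for n
    using A_ae
  proof eventually_elim
    case (elim \<omega>)
    then show ?case unfolding s_def c_def using norm_iter_le[OF _ z W, of "A \<omega>" n] by blast
  qed
  have int_c: "integrable M (\<lambda>_. c)" by simp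
  note dominated = f s int_c lim bound
  have int_f: "integrable M f" by (rule integrable_dominated_convergence[OF dominated])
  have int_s: "integrable M (s n)" for n
  \<comment> \<open>The dominating constant applies from index 1 on; \<open>s 0\<close> is the
    constant \<open>W\<close>.\<close>
  proof (cases n)
    case 0
    then show ?thesis by (simp add: s_def[abs_def])
  next
    case (Suc k)
    then show ?thesis using integrable_dominated_convergence2[OF dominated, of k] by simp
  qed
  have "(\<lambda>n. \<integral>\<omega>. s (Suc n) \<omega> \<partial>M) \<longlonglongrightarrow> (\<integral>\<omega>. f \<omega> \<partial>M)"
    by (rule integral_dominated_convergence[OF dominated])
  then have "(\<lambda>n. \<integral>\<omega>. s n \<omega> \<partial>M) \<longlonglongrightarrow> (\<integral>\<omega>. f \<omega> \<partial>M)"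
    by (rule LIMSEQ_imp_Suc)
  then have conv: "(\<lambda>n. \<integral>\<omega>. s n \<omega> \<partial>M) \<longlonglongrightarrow> mean_cauchy_transform M \<phi> H (mat z)"
    by (simp only: mean_cauchy_transform_def f_def)
  show ?thesis
    by (intro conjI allI inv inv_iter int_f[unfolded f_def[abs_def]] int_s[unfolded s_def[abs_def]]
        conv[unfolded s_def])
qed

end
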